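(* For $d\ge1$ let $B_d(w)=\sum_{n\ge1}B_{2n}^{(d)}w^n$ and $A_d(w)=\sum_{n\ge0}A_{2n}^{(d)}w^n$. Then: (i) $(1-B_d(w))\cdot A_d(w)=1$. (ii) $B_d$ has radius of convergence $1/(2d)^2$ and its power series converges uniformly on the circle of convergence. It is not holonomic for $d\ge2$, but it is $\Delta$-analytic for all $d\ge1$. (iii) $B_1(w)=1-\sqrt{1-4w}$, $B_1(1/4)=B_2(1/16)=1$, and for $d\ge3$, $B_d(1/(2d)^2)=1-1/m_d=p_d$.
   Context: A walk of length $n$ in $\mathbb Z^d$ is a sequence of $n$ steps, each one of $\pm e_1,\dots,\pm e_d$, starting at the origin. $A_{2n}^{(d)}$ is the number of walks of length $2n$ that end at the origin ($A_0^{(d)}=1$); for $n\ge1$, $B_{2n}^{(d)}$ is the number of walks of length $2n$ that return to the origin for the first time at time $2n$. $m_d=\sum_{n\ge0}A_{2n}^{(d)}/(2d)^{2n}$ (finite for $d\ge3$), and $p_d$ is P\'olya's return probability, i.e. the probability that the simple random walk on $\mathbb Z^d$ (each step uniform among the $2d$ unit steps) ever returns to the origin. A power series over $\mathbb C$ is holonomic if it satisfies a nontrivial linear ODE with coefficients in $\mathbb C(z)$. An analytic function given by a Taylor series of radius of convergence $1$ is $\Delta$-analytic if it extends analytically to a domain $\{|w|<1+\eta,\ |\arg(w-1)|>\phi\}$ for some $\eta>0$, $0<\phi<\pi/2$; one given by a Taylor series $f$ of any finite radius of convergence is $\Delta$-analytic if $f(\zeta w)$ is so for some complex $\zeta\ne0$.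 *)

theory Defs
  imports
    "HOL-Complex_Analysis.Complex_Analysis"
    "HOL-Probability.Probability"
    "HOL-Computational_Algebra.Computational_Algebra"
begin

section \<open>Walks in \<open>\<int>\<^sup>d\<close>\<close>

text \<open>
  A point of \<open>\<int>\<^sup>d\<close> is a function \<open>nat \<Rightarrow> int\<close> whose coordinates with index \<open>\<ge> d\<close> vanish;
  a walk is the list of its steps.
\<close>

definition unit_vec :: "nat \<Rightarrow> nat \<Rightarrow> int" where
  "unit_vec i = (\<lambda>j. if j = i then 1 else 0)"

definition unit_steps :: "nat \<Rightarrow> (nat \<Rightarrow> int) set" where
  "unit_steps d = (\<Union>i<d. {unit_vec i, \<lambda>j. - unit_vec i j})"

definition walks :: "nat \<Rightarrow> nat \<Rightarrow> (nat \<Rightarrow> int) list set" where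
  "walks d n = {xs. length xs = n \<and> set xs \<subseteq> unit_steps d}"

definition endpoint :: "(nat \<Rightarrow> int) list \<Rightarrow> nat \<Rightarrow> int" where
  "endpoint xs = (\<lambda>j. \<Sum>x\<leftarrow>xs. x j)"

definition origin :: "nat \<Rightarrow> int" where
  "origin = (\<lambda>_. 0)"

definition closed_walks :: "nat \<Rightarrow> nat \<Rightarrow> (nat \<Rightarrow> int) list set" where
  "closed_walks d n = {xs \<in> walks d n. endpoint xs = origin}"

definition first_return_walks :: "nat \<Rightarrow> nat \<Rightarrow> (nat \<Rightarrow> int) list set" where
  "first_return_walks d n =
     {xs \<in> closed_walks d n. \<forall>k. 0 < k \<and> k < n \<longrightarrow> endpoint (take k xs) \<noteq> origin}"

definition A_series :: "nat \<Rightarrow> complex fps" where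
  "A_series d = Abs_fps (\<lambda>n. of_nat (card (closed_walks d (2 * n))))"

definition B_series :: "nat \<Rightarrow> complex fps" where
  "B_series d = Abs_fps (\<lambda>n. if n = 0 then 0 else of_nat (card (first_return_walks d (2 * n))))"

definition m_term :: "nat \<Rightarrow> nat \<Rightarrow> real" where
  "m_term d n = real (card (closed_walks d (2 * n))) / real (2 * d) ^ (2 * n)"

text \<open>Only meaningful if \<open>m_term d\<close> is summable.\<close>

definition m_const :: "nat \<Rightarrow> real" where
  "m_const d = (\<Sum>n. m_term d n)"


section \<open>P\'olya's return probability\<close>

text \<open>The law of an infinite sequence of independent uniform steps, for \<open>d \<ge> 1\<close>.\<close>

definition simple_random_walk :: "nat \<Rightarrow> (nat \<Rightarrow> int) stream measure" where
  "simple_random_walk d = stream_space (measure_pmf (pmf_of_set (unit_steps d)))"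

definition return_prob :: "nat \<Rightarrow> real" where
  "return_prob d =
     \<P>(\<omega> in simple_random_walk d. \<exists>n\<ge>1. endpoint (stake n \<omega>) = origin)"


section \<open>Holonomic series\<close>

text \<open>
  The rational function \<open>p / q\<close>, expanded at \<open>0\<close>. As it may have a pole there, the differential
  equation lives in the field of formal Laurent series.
\<close>

definition ratfun_fls :: "complex poly \<Rightarrow> complex poly \<Rightarrow> complex fls" where
  "ratfun_fls p q = fps_to_fls (fps_of_poly p) / fps_to_fls (fps_of_poly q)"

definition holonomic :: "complex fps \<Rightarrow> bool" where
  "holonomic f \<longleftrightarrow>
     (\<exists>r (p :: nat \<Rightarrow> complex poly) (q :: nat \<Rightarrow> complex poly).
        (\<forall>i\<le>r. q i \<noteq> 0) \<and> (\<exists>i\<le>r. p i \<noteq> 0) \<and>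
        (\<Sum>i\<le>r. ratfun_fls (p i) (q i) * fps_to_fls ((fps_deriv ^^ i) f)) = 0)"


section \<open>\<open>\<Delta>\<close>-analyticity\<close>

text \<open>
  \<open>Arg\<close> takes values in \<open>(-\<pi>, \<pi>]\<close>; since \<open>Arg 0 = 0\<close>, the point \<open>1\<close> is excluded. For
  \<open>\<phi> < \<pi>/2\<close> the domain contains the open unit disc.
\<close>

definition Delta_domain :: "real \<Rightarrow> real \<Rightarrow> complex set" where
  "Delta_domain \<eta> \<phi> = {w. norm w < 1 + \<eta> \<and> \<bar>Arg (w - 1)\<bar> > \<phi>}"

definition Delta_analytic_unit :: "complex fps \<Rightarrow> bool" where
  "Delta_analytic_unit f \<longleftrightarrow>
     fps_conv_radius f = 1 \<and>
     (\<exists>\<eta> \<phi> g. 0 < \<eta> \<and> 0 < \<phi> \<and> \<phi> < pi / 2 \<and>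
        g analytic_on Delta_domain \<eta> \<phi> \<and> (\<forall>w\<in>ball 0 1. g w = eval_fps f w))"

text \<open>The coefficients of \<open>f(\<zeta>w)\<close> are those of \<open>f\<close> multiplied by \<open>\<zeta>\<^sup>n\<close>.\<close>

definition Delta_analytic :: "complex fps \<Rightarrow> bool" where
  "Delta_analytic f \<longleftrightarrow>
     (\<exists>\<zeta>. \<zeta> \<noteq> 0 \<and> Delta_analytic_unit (Abs_fps (\<lambda>n. \<zeta> ^ n * fps_nth f n)))"

end

theory Submission
  imports Defs "HOL-Real_Asymp.Real_Asymp"
begin

text \<open>
  Cutting a closed walk at its first return to the origin gives \<open>A = 1 + B A\<close>. All
  the other statements concern analytic properties of \<open>1 - B = 1 / A\<close>, and they are read off from an
  integral for \<open>A\<close>. A closed walk of length \<open>n\<close> contributes to the constant term of the \<open>n\<close>-th power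
  of the trigonometric polynomial \<open>step_sum d \<theta> = 2 (cos \<theta>\<^sub>0 + \<dots> + cos \<theta>\<^bsub>d-1\<^esub>)\<close>, so \<open>A\<close> is the
  expectation, over independent uniform angles, of \<open>1 / (1 - w (step_sum d \<theta>)\<^sup>2)\<close>. This is
  \<open>Green\<close>: it is holomorphic off the cut \<open>[1/(2d)\<^sup>2, \<infinity>)\<close>, and it has no zero there because the
  vanishing of its real and imaginary parts would force \<open>w\<close> onto the cut (\<open>Green_nonzero\<close>). Hence \<open>1 - 1 / Green d\<close>
  extends \<open>B\<close> to the whole cut plane, which is far more than \<open>\<Delta>\<close>-analyticity asks for.

  On the circle of radius \<open>crit d = 1/(2d)\<^sup>2\<close> the terms of \<open>B\<close> have as absolute values the
  probabilities of a first return at time \<open>2n\<close>. These add up to the return probability, so the series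
  converges uniformly there and its value at \<open>crit d\<close> is \<open>return_prob d\<close>. By the renewal equation the
  return probability is \<open>1\<close> or \<open>1 - 1 / m_const d\<close>, according as \<open>m_term d\<close> diverges or converges. To decide which,
  put \<open>Gap d \<theta> = \<Sum>(1 - cos \<theta>\<^sub>j)\<close>. On \<open>(0, 2)\<close> its law has the density
  \<open>\<pi>\<^bsup>-d\<^esup> x\<^bsup>d/2-1\<^esup> \<phi>(x)\<close> with a positive continuous \<open>\<phi>\<close> (\<open>nn_integral_Gap_density\<close>), and the
  sum over \<open>m_term d\<close> is comparable to the expectation of \<open>1 / Gap d\<close>, which is finite for \<open>d \<ge> 3\<close>
  and infinite for \<open>d = 2\<close>. For \<open>d = 1\<close> the coefficients of \<open>A\<close> satisfy a first-order recurrence,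
  which gives \<open>(1 - 4 w) A\<^sup>2 = 1\<close>.

  The factor \<open>\<phi>\<close> is the restriction of a function \<open>Phi\<close> that is holomorphic off \<open>[2, \<infinity>)\<close>. So the
  density continues analytically, and deforming the path of integration continues the Cauchy transform
  of the law, and with it \<open>Green\<close>, through the cut near \<open>crit d\<close>. What appears on the other side is
  \<open>second_sheet\<close>, that is \<open>Green\<close> plus a nonzero multiple of the density
  (\<open>Green_continuation\<close>). As the two sheets differ, \<open>B\<close> cannot be holomorphic on a disc larger than
  \<open>crit d\<close>, which gives the radius of convergence (\<open>radius_B\<close>).

  Finally suppose that \<open>B\<close> solves a linear differential equation with polynomial coefficients. So does
  every continuation of it, in particular \<open>1 - 1 / second_sheet\<close>, which can be followed on the second
  sheet down to \<open>w = 0\<close>. There \<open>Green\<close> stays bounded, while the density term, evaluated at a gap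
  tending to \<open>-\<infinity>\<close>, grows like a power of the logarithm of \<open>w\<close> for \<open>d \<ge> 2\<close>. What the proof uses is
  only that it tends to infinity and is asymptotically constant on the discs of radius \<open>w/4\<close> about
  \<open>w\<close> (\<open>second_sheet_asymp\<close>). So \<open>h = 1 / second_sheet\<close> tends to \<open>0\<close> and varies slowly. Applying the
  Euler operator \<open>z d/dz\<close> to such a function gives something negligible against it, and the lowest order part
  of the equation would force \<open>h = O(w)\<close>, whereas a slowly varying function decays more slowly than
  any positive power of \<open>w\<close> (\<open>no_linear_ode\<close>). This contradiction refutes holonomicity.
\<close>

section \<open>The renewal equation for first returns\<close>

lemma endpoint_append: "endpoint (xs @ ys) j = endpoint xs j + endpoint ys j"
  by (simp add: endpoint_def)

lemma unit_vec_inject: "unit_vec i = unit_vec j \<longleftrightarrow> i = j"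
  by (metis unit_vec_def zero_neq_one)

lemma unit_vec_neq_uminus: "unit_vec i \<noteq> (\<lambda>k. - unit_vec j k)"
proof
  assume "unit_vec i = (\<lambda>k. - unit_vec j k)"
  then have "unit_vec i i = - unit_vec j i" by metis
  then show False by (simp add: unit_vec_def split: if_splits)
qed

lemma finite_unit_steps [simp]: "finite (unit_steps d)"
  by (simp add: unit_steps_def)

lemma sum_unit_steps:
  fixes f :: "(nat \<Rightarrow> int) \<Rightarrow> 'a :: comm_monoid_add"
  shows "(\<Sum>u\<in>unit_steps d. f u) = (\<Sum>i<d. f (unit_vec i) + f (\<lambda>j. - unit_vec i j))"
proof -
  have "(\<Sum>u\<in>unit_steps d. f u) = (\<Sum>i<d. \<Sum>u\<in>{unit_vec i, \<lambda>j. - unit_vec i j}. f u)"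
    unfolding unit_steps_def
  proof (rule sum.UNION_disjoint)
    show "\<forall>i\<in>{..<d}. \<forall>j\<in>{..<d}. i \<noteq> j \<longrightarrow>
        {unit_vec i, \<lambda>k. - unit_vec i k} \<inter> {unit_vec j, \<lambda>k. - unit_vec j k} = {}"
    proof (intro ballI impI)
      fix i j :: nat assume ij: "i \<noteq> j"
      have "(\<lambda>k. - unit_vec i k) \<noteq> (\<lambda>k. - unit_vec j k)"
        using ij by (metis add.inverse_inverse unit_vec_def zero_neq_one)
      then show "{unit_vec i, \<lambda>k. - unit_vec i k} \<inter> {unit_vec j, \<lambda>k. - unit_vec j k} = {}"
        using ij unit_vec_neq_uminus[of i j] unit_vec_neq_uminus[of j i] unit_vec_inject[of i j]
        by (simp add: eq_commute)
    qed
  qed auto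
  also have "\<dots> = (\<Sum>i<d. f (unit_vec i) + f (\<lambda>j. - unit_vec i j))"
    by (rule sum.cong) (auto simp: unit_vec_neq_uminus)
  finally show ?thesis .
qed

lemma card_unit_steps: "card (unit_steps d) = 2 * d"
  using sum_unit_steps[of "\<lambda>_. 1 :: nat" d] by simp

lemma finite_walks [simp]: "finite (walks d n)"
  using finite_lists_length_eq[OF finite_unit_steps, of d n] by (simp add: walks_def conj_commute)

lemma card_walks: "card (walks d n) = (2 * d) ^ n"
  using card_lists_length_eq[OF finite_unit_steps, of d n]
  by (simp add: walks_def card_unit_steps conj_commute)

lemma finite_closed_walks [simp]: "finite (closed_walks d n)"
  by (simp add: closed_walks_def)

lemma finite_first_return_walks [simp]: "finite (first_return_walks d n)"
  by (simp add: first_return_walks_def)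

lemma closed_walks_0: "closed_walks d 0 = {[]}"
  by (auto simp: closed_walks_def walks_def endpoint_def origin_def)

text \<open>Each step changes the coordinate sum by one, so its parity records the length.\<close>

text \<open>
  A step changes the parity of the coordinate sum.
\<close>

lemma closed_walks_even:
  assumes "xs \<in> closed_walks d n" shows "even n"
proof -
  have step: "odd (\<Sum>j<d. u j)" if "u \<in> unit_steps d" for u
  proof -
    obtain i where i: "i < d" and u: "u = unit_vec i \<or> u = (\<lambda>j. - unit_vec i j)"
      using \<open>u \<in> unit_steps d\<close> by (auto simp: unit_steps_def)
    have "(\<Sum>j<d. unit_vec i j) = 1" using i by (simp add: unit_vec_def)
    then show ?thesis using u by (auto simp: sum_negf)
  qed
  have "set ys \<subseteq> unit_steps d \<Longrightarrow> even (\<Sum>j<d. endpoint ys j) \<longleftrightarrow> even (length ys)" for ys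
    by (induction ys) (auto simp: endpoint_def sum.distrib step)
  from this[of xs] assms show ?thesis
    by (simp add: closed_walks_def walks_def origin_def)
qed

lemma first_return_walks_even:
  assumes "xs \<in> first_return_walks d n" shows "even n"
  using assms closed_walks_even by (auto simp: first_return_walks_def)

text \<open>A nonempty closed walk splits uniquely at its first return to the origin.\<close>

text \<open>
  Split a closed walk at its first return; the two pieces determine the walk, and the time of the
  first return makes the classes disjoint.
\<close>

lemma card_closed_walks_renewal:
  assumes n: "n > 0"
  shows "card (closed_walks d n) =
    (\<Sum>k=1..n. card (first_return_walks d k) * card (closed_walks d (n - k)))"
proof -
  (* the walks whose first return happens at time k *)
  define C where "C = (\<lambda>k. (\<lambda>(xs, ys). xs @ ys) ` (first_return_walks d k \<times> closed_walks d (n - k)))"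
  have len: "length xs = k" if "xs \<in> first_return_walks d k" for xs k
    using that by (simp add: first_return_walks_def closed_walks_def walks_def)
  have ep: "endpoint xs = origin" if "xs \<in> first_return_walks d k" for xs k
    using that by (simp add: first_return_walks_def closed_walks_def)
  have cardC: "card (C k) = card (first_return_walks d k) * card (closed_walks d (n - k))" for k
  proof -
    have "inj_on (\<lambda>(xs, ys). xs @ ys) (first_return_walks d k \<times> closed_walks d (n - k))"
    proof (rule inj_onI, clarify)
      fix xs ys us vs
      assume "xs \<in> first_return_walks d k" "us \<in> first_return_walks d k" "xs @ ys = us @ vs"
      then show "xs = us \<and> ys = vs" using len[of xs k] len[of us k] by simp
    qed
    then show ?thesis by (simp add: C_def card_image card_cartesian_product)
  qed
  have eq: "closed_walks d n = (\<Union>k\<in>{1..n}. C k)"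
  proof (intro equalityI subsetI)
    fix zs assume zs: "zs \<in> closed_walks d n"
    then have lz: "length zs = n" and sz: "set zs \<subseteq> unit_steps d" and ez: "endpoint zs = origin"
      by (auto simp: closed_walks_def walks_def)
    define k where "k = (LEAST k. 0 < k \<and> endpoint (take k zs) = origin)"
    have ex: "0 < n \<and> endpoint (take n zs) = origin" using n lz ez by simp
    have k: "0 < k" "endpoint (take k zs) = origin"
      using LeastI[of "\<lambda>k. 0 < k \<and> endpoint (take k zs) = origin", OF ex] by (auto simp: k_def)
    have kn: "k \<le> n" unfolding k_def by (rule Least_le) (rule ex)
    have mini: "endpoint (take l zs) \<noteq> origin" if "0 < l" "l < k" for l
      using not_less_Least[of l "\<lambda>k. 0 < k \<and> endpoint (take k zs) = origin"] that
      by (auto simp: k_def)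
    have "endpoint (drop k zs) = origin"
    proof
      fix j
      have "endpoint zs j = endpoint (take k zs) j + endpoint (drop k zs) j"
        using endpoint_append[of "take k zs" "drop k zs" j] by simp
      then show "endpoint (drop k zs) j = origin j" using ez k by (simp add: origin_def)
    qed
    then have 2: "drop k zs \<in> closed_walks d (n - k)"
      using lz sz set_drop_subset[of k zs] by (auto simp: closed_walks_def walks_def)
    have 1: "take k zs \<in> first_return_walks d k"
      using lz sz kn k mini set_take_subset[of k zs]
      by (auto simp: first_return_walks_def closed_walks_def walks_def min_def)
    have "zs = (\<lambda>(xs, ys). xs @ ys) (take k zs, drop k zs)" by simp
    then have "zs \<in> C k" unfolding C_def using 1 2 by blast
    then show "zs \<in> (\<Union>k\<in>{1..n}. C k)" using k kn by auto
  next
    fix zs assume "zs \<in> (\<Union>k\<in>{1..n}. C k)"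
    then obtain k xs ys where k: "k \<in> {1..n}" and xs: "xs \<in> first_return_walks d k"
      and ys: "ys \<in> closed_walks d (n - k)" and zs: "zs = xs @ ys" by (auto simp: C_def)
    have "endpoint zs = origin"
    proof
      fix j show "endpoint zs j = origin j"
        using ep[OF xs] ys by (simp add: zs endpoint_append closed_walks_def origin_def)
    qed
    then show "zs \<in> closed_walks d n" using xs ys k
      by (auto simp: zs closed_walks_def walks_def first_return_walks_def)
  qed
  have disj: "C k \<inter> C l = {}" if kl: "k < l" "0 < k" for k l
  proof (rule ccontr)
    assume "C k \<inter> C l \<noteq> {}"
    then obtain zs where z: "zs \<in> C k" "zs \<in> C l" by auto
    obtain xs ys where 1: "xs \<in> first_return_walks d k" "zs = xs @ ys"
      using z(1) by (auto simp: C_def)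
    obtain us vs where 2: "us \<in> first_return_walks d l" "zs = us @ vs"
      using z(2) by (auto simp: C_def)
    have "take k us = xs"
    proof -
      have "take k zs = xs" using len[OF 1(1)] by (simp add: 1(2))
      moreover have "take k zs = take k us" using len[OF 2(1)] kl by (simp add: 2(2))
      ultimately show ?thesis by simp
    qed
    then show False using ep[OF 1(1)] 2(1) kl by (auto simp: first_return_walks_def)
  qed
  have "card (closed_walks d n) = (\<Sum>k=1..n. card (C k))"
    unfolding eq
  proof (rule card_UN_disjoint)
    show "\<forall>k\<in>{1..n}. finite (C k)" by (auto simp: C_def)
    show "\<forall>i\<in>{1..n}. \<forall>j\<in>{1..n}. i \<noteq> j \<longrightarrow> C i \<inter> C j = {}"
    proof (intro ballI impI)
      fix i j assume "i \<in> {1..n}" "j \<in> {1..n}" "i \<noteq> j"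
      then show "C i \<inter> C j = {}"
        using disj[of i j] disj[of j i] by (cases "i < j") auto
    qed
  qed auto
  then show ?thesis by (simp add: cardC)
qed

lemma sum_even_reindex:
  fixes f :: "nat \<Rightarrow> 'a :: comm_monoid_add"
  assumes "\<And>k. odd k \<Longrightarrow> f k = 0"
  shows "(\<Sum>k\<le>2*n. f k) = (\<Sum>k\<le>n. f (2*k))"
proof -
  have "(\<Sum>k\<le>2*n. f k) = (\<Sum>k\<in>(\<lambda>k. 2*k) ` {..n}. f k)"
  proof (rule sum.mono_neutral_right)
    show "\<forall>i\<in>{..2 * n} - (*) 2 ` {..n}. f i = 0"
    proof
      fix i assume i: "i \<in> {..2 * n} - (*) 2 ` {..n}"
      have "odd i"
      proof
        assume "even i"
        then obtain k where "i = 2 * k" by (auto elim: evenE)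
        then show False using i by auto
      qed
      then show "f i = 0" by (rule assms)
    qed
  qed auto
  also have "\<dots> = (\<Sum>k\<le>n. f (2*k))" by (subst sum.reindex) (auto simp: inj_on_def)
  finally show ?thesis .
qed

lemma renewal_even:
  assumes "n > 0"
  shows "card (closed_walks d (2 * n)) =
    (\<Sum>k\<le>n. (if k = 0 then 0 else card (first_return_walks d (2 * k))) * card (closed_walks d (2 * (n - k))))"
proof -
  define f where "f = (\<lambda>k. (if k = 0 then 0 else card (first_return_walks d k)) * card (closed_walks d (2 * n - k)))"
  have "card (closed_walks d (2 * n)) = (\<Sum>k=1..2*n. f k)"
    using assms by (subst card_closed_walks_renewal) (auto simp: f_def intro!: sum.cong)
  also have "\<dots> = (\<Sum>k\<le>2*n. f k)"
    by (rule sum.mono_neutral_left) (auto simp: f_def)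
  also have "\<dots> = (\<Sum>k\<le>n. f (2*k))"
  proof (rule sum_even_reindex)
    fix k :: nat assume k: "odd k"
    then have "first_return_walks d k = {}" using first_return_walks_even by blast
    then show "f k = 0" by (simp add: f_def)
  qed
  also have "\<dots> = (\<Sum>k\<le>n. (if k = 0 then 0 else card (first_return_walks d (2 * k))) * card (closed_walks d (2 * (n - k))))"
    by (rule sum.cong) (simp_all add: f_def right_diff_distrib')
  finally show ?thesis .
qed

theorem renewal_equation: "(1 - B_series d) * A_series d = 1"
proof (rule fps_ext)
  fix n
  have nth: "fps_nth ((1 - B_series d) * A_series d) n = fps_nth (A_series d) n - fps_nth (B_series d * A_series d) n"
    by (simp add: ring_distribs)
  show "fps_nth ((1 - B_series d) * A_series d) n = fps_nth 1 n"
  proof (cases "n = 0")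
    case True
    then show ?thesis by (simp add: nth A_series_def B_series_def closed_walks_0)
  next
    case False
    have "fps_nth (B_series d * A_series d) n = (\<Sum>k\<le>n. of_nat ((if k = 0 then 0 else card (first_return_walks d (2 * k))) * card (closed_walks d (2 * (n - k)))))"
      unfolding fps_mult_nth by (rule sum.cong) (auto simp: A_series_def B_series_def)
    also have "\<dots> = of_nat (card (closed_walks d (2 * n)))" using False
      by (subst renewal_even[of n d]) (simp_all only: of_nat_sum neq0_conv)
    also have "\<dots> = fps_nth (A_series d) n"
      by (simp add: A_series_def)
    finally show ?thesis using False by (simp add: nth)
  qed
qed

section \<open>The return probability as a sum over first returns\<close>

lemma unit_steps_nonempty: "d \<ge> 1 \<Longrightarrow> unit_steps d \<noteq> {}"
  by (auto simp: unit_steps_def intro!: exI[of _ "0::nat"])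

definition first_return_prob :: "nat \<Rightarrow> nat \<Rightarrow> real" where
  "first_return_prob d n = (if n = 0 then 0 else real (card (first_return_walks d n)) / real (2 * d) ^ n)"

context fixes d :: nat assumes d: "d \<ge> 1"
begin

abbreviation (input) "step_law \<equiv> measure_pmf (pmf_of_set (unit_steps d))"

interpretation walk: prob_space "stream_space step_law" by (rule prob_space.prob_space_stream_space[OF measure_pmf.prob_space_axioms])

lemma snth_measurable:
  "(\<lambda>\<omega>. f (\<omega> !! i)) \<in> measurable (stream_space step_law) (count_space UNIV)"
  by (rule measurable_compose[OF measurable_snth]) simp

lemma stake_eq_measurable:
  "{\<omega>\<in>space (stream_space step_law). stake n \<omega> = xs} \<in> sets (stream_space step_law)"
proof -
  have "{\<omega>\<in>space (stream_space step_law). stake n \<omega> = xs} =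
    {\<omega>\<in>space (stream_space step_law). length xs = n \<and> (\<forall>i\<in>{..<n}. (\<omega> !! i = xs ! i))}"
    by (auto simp: list_eq_iff_nth_eq)
  also have "\<dots> \<in> sets (stream_space step_law)"
    using snth_measurable[of "\<lambda>u. u = _"]
    by (intro sets.sets_Collect_conj sets.sets_Collect_const sets.sets_Collect_finite_All) (auto simp: pred_def[symmetric])
  finally show ?thesis .
qed

lemma stake_in_measurable:
  assumes "finite W"
  shows "{\<omega>\<in>space (stream_space step_law). stake n \<omega> \<in> W} \<in> sets (stream_space step_law)"
proof -
  have "{\<omega>\<in>space (stream_space step_law). stake n \<omega> \<in> W} = (\<Union>xs\<in>W. {\<omega>\<in>space (stream_space step_law). stake n \<omega> = xs})"
    by auto
  then show ?thesis using assms stake_eq_measurable by (auto intro: sets.finite_UN)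
qed

lemma endpoint_stake_measurable:
  "{\<omega>\<in>space (stream_space step_law). endpoint (stake n \<omega>) = origin} \<in> sets (stream_space step_law)"
proof -
  have e: "endpoint (stake n \<omega>) j = (\<Sum>i<n. (\<omega> !! i) j)" for \<omega> :: "(nat \<Rightarrow> int) stream" and j
    by (simp add: endpoint_def sum_list_sum_nth atLeast0LessThan)
  have "(\<lambda>\<omega>. real_of_int ((\<omega> !! i) j)) \<in> borel_measurable (stream_space step_law)" for i j
    by (rule measurable_compose[OF snth_measurable]) simp
  then have "(\<lambda>\<omega>. \<Sum>i<n. real_of_int ((\<omega> !! i) j)) \<in> borel_measurable (stream_space step_law)" for j
    by (intro borel_measurable_sum)
  then have "{\<omega>\<in>space (stream_space step_law). \<forall>j. (\<Sum>i<n. real_of_int ((\<omega> !! i) j)) = 0} \<in> sets (stream_space step_law)"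
    by measurable
  moreover have "(\<Sum>i<n. real_of_int ((\<omega> !! i) j)) = 0 \<longleftrightarrow> endpoint (stake n \<omega>) j = 0" for \<omega> :: "(nat \<Rightarrow> int) stream" and j
    unfolding e by (metis of_int_0_eq_iff of_int_sum)
  ultimately show ?thesis by (simp add: origin_def fun_eq_iff)
qed

text \<open>
  Condition on the first step; the rest of the stream has the same law.
\<close>

lemma emeasure_stake:
  assumes "xs \<in> walks d n"
  shows "emeasure (stream_space step_law) {\<omega>\<in>space (stream_space step_law). stake n \<omega> = xs} = ennreal ((1 / real (2 * d)) ^ n)"
  using assms
proof (induction n arbitrary: xs)
  case 0
  then show ?case by (simp add: walks_def walk.emeasure_space_1)
next
  case (Suc n)
  then obtain u ys where xs: "xs = u # ys" and u: "u \<in> unit_steps d" and ys: "ys \<in> walks d n"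
    by (auto simp: walks_def length_Suc_conv)
  have "emeasure (stream_space step_law) {\<omega>\<in>space (stream_space step_law). stake (Suc n) \<omega> = xs} =
    (\<integral>\<^sup>+t. emeasure (stream_space step_law) {\<omega>\<in>space (stream_space step_law). t ## \<omega> \<in> {\<omega>\<in>space (stream_space step_law). stake (Suc n) \<omega> = xs}} \<partial>step_law)"
    by (rule prob_space.emeasure_stream_space[OF measure_pmf.prob_space_axioms]) (rule stake_eq_measurable)
  also have "\<dots> = (\<integral>\<^sup>+t. ennreal ((1 / real (2 * d)) ^ n) * indicator {u} t \<partial>step_law)"
  proof (rule nn_integral_cong)
    fix t
    have "{\<omega>\<in>space (stream_space step_law). t ## \<omega> \<in> {\<omega>\<in>space (stream_space step_law). stake (Suc n) \<omega> = xs}} =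
      (if t = u then {\<omega>\<in>space (stream_space step_law). stake n \<omega> = ys} else {})"
      by (auto simp: xs space_stream_space)
    then show "emeasure (stream_space step_law) {\<omega>\<in>space (stream_space step_law). t ## \<omega> \<in> {\<omega>\<in>space (stream_space step_law). stake (Suc n) \<omega> = xs}} =
       ennreal ((1 / real (2 * d)) ^ n) * indicator {u} t"
      using Suc.IH[OF ys] by simp
  qed
  also have "\<dots> = ennreal ((1 / real (2 * d)) ^ n) * ennreal (1 / real (2 * d))"
    using u unit_steps_nonempty[OF d]
    by (subst nn_integral_cmult) (auto simp: emeasure_pmf_single card_unit_steps)
  also have "\<dots> = ennreal ((1 / real (2 * d)) ^ Suc n)"
    by (subst ennreal_mult[symmetric]) (auto simp: mult.commute)
  finally show ?case .
qed

lemma emeasure_stake_in: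
  assumes "W \<subseteq> walks d n"
  shows "emeasure (stream_space step_law) {\<omega>\<in>space (stream_space step_law). stake n \<omega> \<in> W} = ennreal (real (card W) / real (2 * d) ^ n)"
proof -
  have fin: "finite W" using assms finite_walks finite_subset by blast
  note m = stake_eq_measurable[of n]
  have "{\<omega>\<in>space (stream_space step_law). stake n \<omega> \<in> W} = (\<Union>xs\<in>W. {\<omega>\<in>space (stream_space step_law). stake n \<omega> = xs})"
    by auto
  also have "emeasure (stream_space step_law) \<dots> = (\<Sum>xs\<in>W. emeasure (stream_space step_law) {\<omega>\<in>space (stream_space step_law). stake n \<omega> = xs})"
    using fin m by (intro sum_emeasure[symmetric]) (auto simp: disjoint_family_on_def)
  also have "\<dots> = (\<Sum>xs\<in>W. ennreal ((1 / real (2 * d)) ^ n))"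
    using assms by (intro sum.cong emeasure_stake) auto
  also have "\<dots> = ennreal (real (card W) / real (2 * d) ^ n)"
    by (subst sum_ennreal) (simp_all add: power_one_over)
  finally show ?thesis .
qed

text \<open>
  Almost surely all steps are unit steps, and then the event of a return is the disjoint union, over
  \<open>n\<close>, of the events that the first return happens at time \<open>n\<close>.
\<close>

lemma first_return_prob_sums: "first_return_prob d sums return_prob d"
proof -
  define E where "E = (\<lambda>n. {\<omega>\<in>space (stream_space step_law). n > 0 \<and> stake n \<omega> \<in> first_return_walks d n})"
  have E: "E n \<in> sets (stream_space step_law)" for n using stake_in_measurable[of "first_return_walks d n" n] by (cases "n = 0") (auto simp: E_def)
  have Em: "emeasure (stream_space step_law) (E n) = ennreal (first_return_prob d n)" for n
  proof (cases "n = 0")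
    case False
    then show ?thesis using emeasure_stake_in[of "first_return_walks d n" n]
      by (simp add: E_def first_return_prob_def first_return_walks_def closed_walks_def Collect_mono_iff subset_iff)
  qed (simp add: E_def first_return_prob_def)
  have disj: "disjoint_family E"
  proof -
    have "\<omega> \<notin> E k" if "\<omega> \<in> E n" "k < n" for \<omega> n k
    proof
      assume "\<omega> \<in> E k"
      then have k: "0 < k" "endpoint (stake k \<omega>) = origin" by (auto simp: E_def first_return_walks_def closed_walks_def)
      have "take k (stake n \<omega>) = stake k \<omega>" using that by (simp add: take_stake min_def)
      then show False using that k by (auto simp: E_def first_return_walks_def)
    qed
    then show ?thesis unfolding disjoint_family_on_def by (metis disjoint_iff linorder_neqE_nat)
  qed
  (* the sample space contains streams that are not walks, but they have probability 0 *)
  have AEs: "AE \<omega> in stream_space step_law. \<forall>n. stake n \<omega> \<in> walks d n"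
  proof -
    have "AE \<omega> in stream_space step_law. stake n \<omega> \<in> walks d n" for n
    proof (rule walk.AE_I_eq_1)
      show "emeasure (stream_space step_law) {\<omega>\<in>space (stream_space step_law). stake n \<omega> \<in> walks d n} = 1"
        using d by (simp add: emeasure_stake_in card_walks)
    qed (simp add: stake_in_measurable)
    then show ?thesis by (simp add: AE_all_countable)
  qed
  have "return_prob d = measure (stream_space step_law) {\<omega>\<in>space (stream_space step_law). \<exists>n\<ge>1. endpoint (stake n \<omega>) = origin}"
    by (simp add: return_prob_def simple_random_walk_def)
  also have "\<dots> = measure (stream_space step_law) (\<Union>n. E n)"
  proof (rule measure_eq_AE)
    show "AE \<omega> in stream_space step_law. (\<omega> \<in> {\<omega>\<in>space (stream_space step_law). \<exists>n\<ge>1. endpoint (stake n \<omega>) = origin}) = (\<omega> \<in> (\<Union>n. E n))"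
      using AEs AE_space
    proof eventually_elim
      case (elim \<omega>)
      show ?case
      proof
        assume "\<omega> \<in> {\<omega>\<in>space (stream_space step_law). \<exists>n\<ge>1. endpoint (stake n \<omega>) = origin}"
        then obtain n where n: "n > 0 \<and> endpoint (stake n \<omega>) = origin" by (auto simp: Suc_le_eq)
        define k where "k = (LEAST k. k > 0 \<and> endpoint (stake k \<omega>) = origin)"
        have k: "k > 0" "endpoint (stake k \<omega>) = origin"
          using LeastI[of "\<lambda>k. k > 0 \<and> endpoint (stake k \<omega>) = origin", OF n] by (auto simp: k_def)
        have "endpoint (stake j \<omega>) \<noteq> origin" if "0 < j" "j < k" for j
          using not_less_Least[of j "\<lambda>k. k > 0 \<and> endpoint (stake k \<omega>) = origin"] that by (auto simp: k_def)
        then have "stake k \<omega> \<in> first_return_walks d k"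
          using elim k by (auto simp: first_return_walks_def closed_walks_def take_stake min_def)
        then show "\<omega> \<in> (\<Union>n. E n)" using k elim by (auto simp: E_def)
      next
        assume "\<omega> \<in> (\<Union>n. E n)"
        then show "\<omega> \<in> {\<omega>\<in>space (stream_space step_law). \<exists>n\<ge>1. endpoint (stake n \<omega>) = origin}"
          by (auto simp: E_def first_return_walks_def closed_walks_def Suc_le_eq)
      qed
    qed
    have "{\<omega>\<in>space (stream_space step_law). \<exists>n\<ge>1. endpoint (stake n \<omega>) = origin} =
      (\<Union>n\<in>{1..}. {\<omega>\<in>space (stream_space step_law). endpoint (stake n \<omega>) = origin})" by auto
    also have "\<dots> \<in> sets (stream_space step_law)" using endpoint_stake_measurable by (intro sets.countable_UN') auto
    finally show "{\<omega>\<in>space (stream_space step_law). \<exists>n\<ge>1. endpoint (stake n \<omega>) = origin} \<in> sets (stream_space step_law)" .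
    show "(\<Union>n. E n) \<in> sets (stream_space step_law)" using E by auto
  qed
  finally have r: "return_prob d = measure (stream_space step_law) (\<Union>n. E n)" .
  have "(\<lambda>n. measure (stream_space step_law) (E n)) sums measure (stream_space step_law) (\<Union>n. E n)"
    using E disj by (intro walk.finite_measure_UNION) auto
  moreover have "measure (stream_space step_law) (E n) = first_return_prob d n" for n
    using Em[of n] by (simp add: measure_def first_return_prob_def)
  ultimately show ?thesis by (simp add: r)
qed

end

section \<open>Convolution powers of the arcsine density near the edge\<close>

definition slit2 :: "complex set" where
  "slit2 = {y. Im y = 0 \<longrightarrow> Re y < 2}"

lemma slit2_alt: "slit2 = (\<lambda>y. 2 - y) -` (- \<real>\<^sub>\<le>\<^sub>0)"
  by (auto simp: slit2_def complex_nonpos_Reals_iff)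

lemma open_slit2: "open slit2"
  unfolding slit2_alt by (intro open_vimage continuous_intros) auto

lemma slit2_scale:
  assumes "y \<in> slit2" "0 \<le> s" "s \<le> 1" shows "y * of_real s \<in> slit2"
proof -
  have "Re y * s < 2" if "Re y < 2"
  proof (cases "Re y \<le> 0")
    case True
    then have "Re y * s \<le> 0" using assms by (simp add: mult_le_0_iff)
    then show ?thesis by simp
  next
    case False
    then have "Re y * s \<le> Re y * 1" using assms by (intro mult_left_mono) auto
    then show ?thesis using that by simp
  qed
  then show ?thesis using assms by (auto simp: slit2_def)
qed

lemma of_real_slit2: "x < 2 \<Longrightarrow> complex_of_real x \<in> slit2"
  by (simp add: slit2_def)

lemma cos_pi_half_nonneg: "0 \<le> t \<Longrightarrow> t \<le> pi/2 \<Longrightarrow> 0 \<le> cos t"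
  by (rule cos_ge_zero) auto

lemma sin_pi_half_nonneg: "0 \<le> t \<Longrightarrow> t \<le> pi/2 \<Longrightarrow> 0 \<le> sin t"
  by (rule sin_ge_zero) auto

text \<open>
  Up to the factor \<open>\<pi>\<^bsup>-(n+1)\<^esup> x\<^bsup>(n+1)/2-1\<^esup>\<close>, the function \<open>Phi n\<close> is the density on \<open>(0, 2)\<close> of a
  sum of \<open>n + 1\<close> independent variables \<open>1 - cos \<theta>\<close> with \<open>\<theta>\<close> uniform. The recursion is the
  convolution with the arcsine density, after the substitution \<open>v = x (sin t)\<^sup>2\<close> that absorbs the
  singularities at both ends. It makes sense for complex arguments, because \<^const>\<open>slit2\<close> is
  star-shaped about \<open>0\<close>.
\<close>

fun Phi :: "nat \<Rightarrow> complex \<Rightarrow> complex" where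
  "Phi 0 y = 1 / csqrt (2 - y)"
| "Phi (Suc n) y = 2 * integral {0..pi/2}
     (\<lambda>t. of_real (cos t ^ n) * (Phi 0 (y * of_real ((sin t)\<^sup>2)) * Phi n (y * of_real ((cos t)\<^sup>2))))"

declare Phi.simps(2) [simp del]
declare Phi.simps(1) [simp del]

lemma Phi_0_holomorphic: "Phi 0 holomorphic_on slit2"
proof -
  have "(\<lambda>y. 1 / csqrt (2 - y)) holomorphic_on slit2"
    by (intro holomorphic_intros) (auto simp: slit2_alt)
  then show ?thesis by (simp add: Phi.simps(1)[abs_def])
qed

text \<open>
  Differentiation under the integral sign.
\<close>

lemma Phi_holomorphic: "Phi n holomorphic_on slit2"
proof (induction n)
  case 0
  show ?case by (rule Phi_0_holomorphic)
next
  case (Suc n)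
  note [simp] = open_slit2
  have d0: "(Phi 0 has_field_derivative deriv (Phi 0) y) (at y)" if "y \<in> slit2" for y
    using Phi_0_holomorphic open_slit2 that by (rule holomorphic_derivI)
  have dn: "(Phi n has_field_derivative deriv (Phi n) y) (at y)" if "y \<in> slit2" for y
    using Suc open_slit2 that by (rule holomorphic_derivI)
  have c: "continuous_on slit2 (Phi 0)" "continuous_on slit2 (Phi n)"
    "continuous_on slit2 (deriv (Phi 0))" "continuous_on slit2 (deriv (Phi n))"
    using Phi_0_holomorphic Suc holomorphic_deriv[OF _ open_slit2] holomorphic_on_imp_continuous_on
    by blast+
  define f where "f = (\<lambda>y t. of_real (cos t ^ n) * (Phi 0 (y * of_real ((sin t)\<^sup>2)) * Phi n (y * of_real ((cos t)\<^sup>2))))"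
  define fx where "fx = (\<lambda>y t. complex_of_real (cos t ^ n) *
      (deriv (Phi 0) (y * of_real ((sin t)\<^sup>2)) * of_real ((sin t)\<^sup>2) * Phi n (y * of_real ((cos t)\<^sup>2)) +
       Phi 0 (y * of_real ((sin t)\<^sup>2)) * (deriv (Phi n) (y * of_real ((cos t)\<^sup>2)) * of_real ((cos t)\<^sup>2))))"
  have sc: "y * of_real ((sin t)\<^sup>2) \<in> slit2" "y * of_real ((cos t)\<^sup>2) \<in> slit2" if "y \<in> slit2" for y t
    using that by (auto intro!: slit2_scale simp: abs_square_le_1 simp del: of_real_power)
  have cc: "continuous_on (slit2 \<times> cbox 0 (pi/2)) (\<lambda>(y,t). fx y t)"
    unfolding fx_def split_def
    by (intro continuous_intros c(1,2)[THEN continuous_on_compose2] c(3,4)[THEN continuous_on_compose2])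
       (auto intro: sc simp del: of_real_power)
  have cf: "continuous_on (cbox 0 (pi/2)) (f y)" if "y \<in> slit2" for y
    unfolding f_def
    by (intro continuous_intros c(1,2)[THEN continuous_on_compose2])
       (auto intro: sc that simp del: of_real_power)
  have "(\<lambda>y. integral (cbox 0 (pi/2)) (f y)) field_differentiable (at y)" if y: "y \<in> slit2" for y
  proof -
    obtain r where r: "r > 0" "ball y r \<subseteq> slit2" using open_slit2 y open_contains_ball by blast
    have "(\<lambda>y. integral (cbox 0 (pi/2)) (f y)) holomorphic_on ball y r"
    proof (rule leibniz_rule_holomorphic[where fx = fx])
      fix x t assume x: "x \<in> ball y r"
      then have xs: "x \<in> slit2" using r by auto
      have "((\<lambda>x. f x t) has_field_derivative fx x t) (at x)"
      proof -
        have A: "((\<lambda>x. Phi 0 (x * of_real ((sin t)\<^sup>2))) has_field_derivative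
            deriv (Phi 0) (x * of_real ((sin t)\<^sup>2)) * of_real ((sin t)\<^sup>2)) (at x)"
          by (rule DERIV_chain2, rule d0[OF sc(1)[OF xs]]) (rule DERIV_cong[OF DERIV_cmult_right[OF DERIV_ident]], simp)
        have B: "((\<lambda>x. Phi n (x * of_real ((cos t)\<^sup>2))) has_field_derivative
            deriv (Phi n) (x * of_real ((cos t)\<^sup>2)) * of_real ((cos t)\<^sup>2)) (at x)"
          by (rule DERIV_chain2, rule dn[OF sc(2)[OF xs]]) (rule DERIV_cong[OF DERIV_cmult_right[OF DERIV_ident]], simp)
        show ?thesis
          unfolding f_def fx_def
          by (rule DERIV_cong[OF DERIV_cmult[OF DERIV_mult[OF A B]]]) (simp add: algebra_simps)
      qed
      then show "((\<lambda>x. f x t) has_field_derivative fx x t) (at x within ball y r)"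
        by (rule has_field_derivative_at_within)
    next
      fix x assume "x \<in> ball y r"
      then show "f x integrable_on cbox 0 (pi/2)"
        using cf r by (intro integrable_continuous) auto
    next
      show "continuous_on (ball y r \<times> cbox 0 (pi/2)) (\<lambda>(x, t). fx x t)"
        using r by (intro continuous_on_subset[OF cc]) auto
    qed auto
    then show ?thesis using r(1) holomorphic_on_imp_differentiable_at by force
  qed
  then have "(\<lambda>y. 2 * integral (cbox 0 (pi/2)) (f y)) holomorphic_on slit2"
    by (intro holomorphic_intros) (auto simp: holomorphic_on_def field_differentiable_at_within)
  then show ?case by (simp add: f_def Phi.simps(2)[abs_def])
qed

lemma continuous_on_Phi: "continuous_on slit2 (Phi n)"
  using Phi_holomorphic holomorphic_on_imp_continuous_on by blast

lemma HK_integral_of_real: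
  fixes g :: "real \<Rightarrow> real"
  assumes "g integrable_on A"
  shows "integral A (\<lambda>t. complex_of_real (g t)) = of_real (integral A g)"
  using has_integral_of_real[OF integrable_integral[OF assms]] by (rule integral_unique)

lemma Phi_0_of_real: "x < 2 \<Longrightarrow> Phi 0 (of_real x) = of_real (1 / sqrt (2 - x))"
proof -
  assume "x < 2"
  moreover have "2 - complex_of_real x = of_real (2 - x)" by simp
  ultimately show ?thesis by (simp only: Phi.simps(1)) simp
qed

lemma Phi_real: "x < 2 \<Longrightarrow> Phi n (of_real x) \<in> \<real>"
proof (induction n arbitrary: x)
  case 0
  then show ?case by (simp add: Phi_0_of_real)
next
  case (Suc n)
  have sc: "x * s < 2" if "0 \<le> s" "s \<le> 1" for s
    using slit2_scale[OF of_real_slit2 that, OF Suc.prems] by (simp add: slit2_def)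
  have r: "Phi 0 (of_real x * of_real ((sin t)\<^sup>2)) * Phi n (of_real x * of_real ((cos t)\<^sup>2)) \<in> \<real>" for t
  proof -
    have "x * (sin t)\<^sup>2 < 2" "x * (cos t)\<^sup>2 < 2" using sc by (auto simp: abs_square_le_1)
    then have "Phi 0 (of_real (x * (sin t)\<^sup>2)) \<in> \<real>" "Phi n (of_real (x * (cos t)\<^sup>2)) \<in> \<real>"
      using Suc.IH by (simp_all only: Phi_0_of_real Reals_of_real)
    then show ?thesis by simp
  qed
  define g where "g = (\<lambda>t. cos t ^ n * Re (Phi 0 (of_real x * of_real ((sin t)\<^sup>2)) * Phi n (of_real x * of_real ((cos t)\<^sup>2))))"
  have "Phi (Suc n) (of_real x) = 2 * integral {0..pi/2} (\<lambda>t. complex_of_real (g t))"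
    unfolding Phi.simps(2) g_def
    by (intro arg_cong[where f="\<lambda>z. 2 * z"] integral_cong) (simp only: of_real_mult of_real_Re[OF r])
  moreover have "g integrable_on {0..pi/2}"
  proof -
    have sc': "of_real x * of_real ((sin t)\<^sup>2) \<in> slit2" "of_real x * of_real ((cos t)\<^sup>2) \<in> slit2" for t
      using Suc.prems by (auto intro!: slit2_scale of_real_slit2 simp: abs_square_le_1 simp del: of_real_power)
    show ?thesis unfolding g_def
      by (intro integrable_continuous_interval continuous_intros continuous_on_compose2[OF continuous_on_Phi])
         (use sc' in auto)
  qed
  ultimately show ?case by (simp add: HK_integral_of_real)
qed

definition phi :: "nat \<Rightarrow> real \<Rightarrow> real" where
  "phi n x = Re (Phi n (of_real x))"

lemma Phi_of_real: "x < 2 \<Longrightarrow> Phi n (of_real x) = of_real (phi n x)"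
  using Phi_real[of x n] by (simp add: phi_def)

lemma phi_0: "x < 2 \<Longrightarrow> phi 0 x = 1 / sqrt (2 - x)"
  by (simp add: phi_def Phi_0_of_real)

lemma continuous_on_phi: "continuous_on {..<2} (phi n)"
  unfolding phi_def
  by (intro continuous_intros continuous_on_compose2[OF continuous_on_Phi]) (auto simp: of_real_slit2)

lemma scale_less_2:
  fixes x s :: real assumes "x < 2" "0 \<le> s" "s \<le> 1" shows "x * s < 2"
  using slit2_scale[OF of_real_slit2, OF assms] by (simp add: slit2_def)

lemma scale_sin_cos_less_2:
  fixes x :: real assumes "x < 2" shows "x * (sin t)\<^sup>2 < 2" "x * (cos t)\<^sup>2 < 2"
  using assms by (auto intro!: scale_less_2 simp: abs_square_le_1)

lemma phi_Suc_integrand_continuous: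
  assumes "x < 2"
  shows "continuous_on A (\<lambda>t. phi m (x * (sin t)\<^sup>2))" "continuous_on A (\<lambda>t. phi m (x * (cos t)\<^sup>2))"
  by (intro continuous_on_compose2[OF continuous_on_phi] continuous_intros;
      use scale_sin_cos_less_2[OF assms] in auto)+

lemma phi_Suc:
  assumes "x < 2"
  shows "phi (Suc n) x = 2 * integral {0..pi/2} (\<lambda>t. cos t ^ n * (phi 0 (x * (sin t)\<^sup>2) * phi n (x * (cos t)\<^sup>2)))"
proof -
  have "Phi (Suc n) (of_real x) = 2 * integral {0..pi/2} (\<lambda>t. complex_of_real (cos t ^ n * (phi 0 (x * (sin t)\<^sup>2) * phi n (x * (cos t)\<^sup>2))))"
    unfolding Phi.simps(2)
    by (intro arg_cong[where f="\<lambda>z. 2 * z"] integral_cong)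
       (simp only: of_real_mult[symmetric] Phi_of_real scale_sin_cos_less_2[OF assms])
  moreover have "(\<lambda>t. cos t ^ n * (phi 0 (x * (sin t)\<^sup>2) * phi n (x * (cos t)\<^sup>2))) integrable_on {0..pi/2}"
    by (intro integrable_continuous_interval continuous_intros phi_Suc_integrand_continuous assms)
  note i = this
  ultimately have "Phi (Suc n) (of_real x) = 2 * of_real (integral {0..pi/2} (\<lambda>t. cos t ^ n * (phi 0 (x * (sin t)\<^sup>2) * phi n (x * (cos t)\<^sup>2))))"
    by (simp only: HK_integral_of_real[OF i])
  then show ?thesis by (simp add: phi_def)
qed

lemma phi_Suc_integrable:
  "x < 2 \<Longrightarrow> (\<lambda>t. cos t ^ n * (phi 0 (x * (sin t)\<^sup>2) * phi n (x * (cos t)\<^sup>2))) integrable_on {a..b}"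
  by (intro integrable_continuous_interval continuous_intros phi_Suc_integrand_continuous)

lemma phi_pos: "x < 2 \<Longrightarrow> phi n x > 0"
proof (induction n arbitrary: x)
  case 0
  then show ?case by (simp add: phi_0)
next
  case (Suc n)
  let ?g = "\<lambda>t. cos t ^ n * (phi 0 (x * (sin t)\<^sup>2) * phi n (x * (cos t)\<^sup>2))"
  have pos: "phi 0 (x * (sin t)\<^sup>2) * phi n (x * (cos t)\<^sup>2) > 0" for t
    using scale_sin_cos_less_2[OF Suc.prems] Suc.IH by (simp add: phi_0)
  have nn: "?g t \<ge> 0" if "t \<in> {0..pi/2}" for t
    using that pos[of t] cos_pi_half_nonneg[of t] by (intro mult_nonneg_nonneg[OF zero_le_power]) auto
  have "integral {0..pi/2} ?g \<noteq> 0"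
  proof
    assume "integral {0..pi/2} ?g = 0"
    then have "(?g has_integral 0) (cbox 0 (pi/2))"
      using phi_Suc_integrable[OF Suc.prems, of n 0 "pi/2"] by (simp add: has_integral_iff)
    moreover have "continuous_on (cbox 0 (pi/2)) ?g"
      by (intro continuous_intros phi_Suc_integrand_continuous Suc.prems)
    ultimately have "?g 0 = 0"
      using has_integral_0_cbox_imp_0[of 0 "pi/2" ?g 0] nn pi_gt_zero by (auto simp: box_real not_le)
    then show False using pos[of 0] by auto
  qed
  moreover have "integral {0..pi/2} ?g \<ge> 0"
    by (intro integral_nonneg phi_Suc_integrable Suc.prems) (use nn in auto)
  ultimately show ?case by (simp add: phi_Suc Suc.prems)
qed

lemma phi_mono: "x \<le> x' \<Longrightarrow> x' < 2 \<Longrightarrow> phi n x \<le> phi n x'"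
proof (induction n arbitrary: x x')
  case 0
  then show ?case by (simp add: phi_0 frac_le)
next
  case (Suc n)
  have x: "x < 2" using Suc.prems by simp
  have "integral {0..pi/2} (\<lambda>t. cos t ^ n * (phi 0 (x * (sin t)\<^sup>2) * phi n (x * (cos t)\<^sup>2)))
     \<le> integral {0..pi/2} (\<lambda>t. cos t ^ n * (phi 0 (x' * (sin t)\<^sup>2) * phi n (x' * (cos t)\<^sup>2)))"
  proof (intro integral_le phi_Suc_integrable x Suc.prems)
    fix t :: real assume t: "t \<in> {0..pi/2}"
    have l: "x * (sin t)\<^sup>2 \<le> x' * (sin t)\<^sup>2" "x * (cos t)\<^sup>2 \<le> x' * (cos t)\<^sup>2"
      using Suc.prems by (auto intro: mult_right_mono)
    note s = scale_sin_cos_less_2[OF x, of t] scale_sin_cos_less_2[OF Suc.prems(2), of t]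
    show "cos t ^ n * (phi 0 (x * (sin t)\<^sup>2) * phi n (x * (cos t)\<^sup>2))
       \<le> cos t ^ n * (phi 0 (x' * (sin t)\<^sup>2) * phi n (x' * (cos t)\<^sup>2))"
    proof (intro mult_left_mono mult_mono)
      show "phi 0 (x * (sin t)\<^sup>2) \<le> phi 0 (x' * (sin t)\<^sup>2)"
        using l s by (simp add: phi_0 frac_le)
      show "phi n (x * (cos t)\<^sup>2) \<le> phi n (x' * (cos t)\<^sup>2)" using l s by (intro Suc.IH)
      show "0 \<le> cos t ^ n" using t cos_pi_half_nonneg[of t] by simp
    qed (use s phi_pos less_imp_le in auto)
  qed
  then show ?case by (simp add: phi_Suc x Suc.prems)
qed

text \<open>
  For \<open>n = 0\<close> this is the monotonicity of \<open>v / (2 + v c)\<close>. The recursion multiplies \<open>c\<close> by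
  \<open>(sin t)\<^sup>2\<close> and \<open>(cos t)\<^sup>2\<close> in the two factors of the integrand, which is why the induction needs
  a general \<open>c\<close>.
\<close>

lemma phi_scaled_mono:
  assumes "0 \<le> v" "v \<le> v'" "0 \<le> c"
  shows "sqrt v ^ Suc n * phi n (- v * c) \<le> sqrt v' ^ Suc n * phi n (- v' * c)"
  using assms
proof (induction n arbitrary: v v' c)
  case 0
  have v: "0 \<le> v * c" "0 \<le> v' * c" using 0 by auto
  have p: "0 < 2 + v * c" "0 < 2 + v' * c" using v by linarith+
  have le: "v / (2 + v * c) \<le> v' / (2 + v' * c)"
    using p 0 by (simp add: field_simps)
  have "sqrt (v / (2 + v * c)) \<le> sqrt (v' / (2 + v' * c))"
    using le by (rule real_sqrt_le_mono)
  then show ?case using p v by (simp add: phi_0 real_sqrt_divide)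
next
  case (Suc n)
  have v: "0 \<le> v * c" "0 \<le> v' * c" "0 \<le> v'" using Suc.prems by auto
  then have v2: "- v * c < 2" "- v' * c < 2" by linarith+
  have e: "sqrt w ^ Suc (Suc n) * phi (Suc n) (- w * c) = 2 * integral {0..pi/2} (\<lambda>t. cos t ^ n *
     ((sqrt w ^ Suc 0 * phi 0 (- w * (c * (sin t)\<^sup>2))) * (sqrt w ^ Suc n * phi n (- w * (c * (cos t)\<^sup>2)))))"
    if "- w * c < 2" for w
  proof -
    have "sqrt w ^ Suc (Suc n) * phi (Suc n) (- w * c) = 2 * (sqrt w ^ Suc (Suc n) *
       integral {0..pi/2} (\<lambda>t. cos t ^ n * (phi 0 (- w * c * (sin t)\<^sup>2) * phi n (- w * c * (cos t)\<^sup>2))))"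
      by (subst phi_Suc[OF that]) (simp only: mult.left_commute)
    also have "\<dots> = 2 * integral {0..pi/2} (\<lambda>t. sqrt w ^ Suc (Suc n) * (cos t ^ n * (phi 0 (- w * c * (sin t)\<^sup>2) * phi n (- w * c * (cos t)\<^sup>2))))"
      by simp
    finally show ?thesis by (simp add: algebra_simps)
  qed
  have i: "(\<lambda>t. cos t ^ n *
     ((sqrt w ^ Suc 0 * phi 0 (- w * (c * (sin t)\<^sup>2))) * (sqrt w ^ Suc n * phi n (- w * (c * (cos t)\<^sup>2))))) integrable_on {0..pi/2}"
    if "- w * c < 2" for w
    unfolding mult.assoc[symmetric, of "-w" c]
    by (intro integrable_continuous_interval continuous_intros phi_Suc_integrand_continuous that)
  show ?case
    unfolding e[OF v2(1)] e[OF v2(2)]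
  proof (rule mult_left_mono, rule integral_le, rule i[OF v2(1)], rule i[OF v2(2)])
    fix t :: real assume t: "t \<in> {0..pi/2}"
    have nn: "0 \<le> phi k (- (w * (c * s\<^sup>2)))" if "0 \<le> w" for k w s
    proof -
      have "0 \<le> w * (c * s\<^sup>2)" using that Suc.prems by simp
      then show ?thesis using phi_pos[of "- (w * (c * s\<^sup>2))" k] by linarith
    qed
    show "cos t ^ n * ((sqrt v ^ Suc 0 * phi 0 (- v * (c * (sin t)\<^sup>2))) * (sqrt v ^ Suc n * phi n (- v * (c * (cos t)\<^sup>2))))
      \<le> cos t ^ n * ((sqrt v' ^ Suc 0 * phi 0 (- v' * (c * (sin t)\<^sup>2))) * (sqrt v' ^ Suc n * phi n (- v' * (c * (cos t)\<^sup>2))))"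
    proof (rule mult_left_mono, rule mult_mono)
      have p: "0 < 2 + v * (c * (sin t)\<^sup>2)" "0 < 2 + v' * (c * (sin t)\<^sup>2)"
        using v Suc.prems by (auto intro!: add_pos_nonneg)
      have "v / (2 + v * (c * (sin t)\<^sup>2)) \<le> v' / (2 + v' * (c * (sin t)\<^sup>2))"
        using p Suc.prems by (simp add: field_simps)
      then have "sqrt (v / (2 + v * (c * (sin t)\<^sup>2))) \<le> sqrt (v' / (2 + v' * (c * (sin t)\<^sup>2)))"
        by (rule real_sqrt_le_mono)
      then show "sqrt v ^ Suc 0 * phi 0 (- v * (c * (sin t)\<^sup>2)) \<le> sqrt v' ^ Suc 0 * phi 0 (- v' * (c * (sin t)\<^sup>2))"
        using p by (simp add: phi_0 real_sqrt_divide)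
      show "sqrt v ^ Suc n * phi n (- v * (c * (cos t)\<^sup>2)) \<le> sqrt v' ^ Suc n * phi n (- v' * (c * (cos t)\<^sup>2))"
        using Suc.prems by (intro Suc.IH) auto
      show "0 \<le> cos t ^ n" using t cos_pi_half_nonneg[of t] by simp
    qed (use nn v Suc.prems in auto)
  qed auto
qed

section \<open>The law of the gap\<close>

definition angle :: "real measure" where
  "angle = uniform_measure lborel {-pi..pi}"

definition angles :: "nat \<Rightarrow> (nat \<Rightarrow> real) measure" where
  "angles d = PiM {..<d} (\<lambda>_. angle)"

text \<open>
  The distance of the sum of the cosines from its maximum \<open>d\<close>. Small gaps correspond to the
  singularity of the generating functions at the radius of convergence.
\<close>

definition Gap :: "nat \<Rightarrow> (nat \<Rightarrow> real) \<Rightarrow> real" where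
  "Gap d \<theta> = (\<Sum>j<d. 1 - cos (\<theta> j))"

lemma prob_space_angle: "prob_space angle"
  unfolding angle_def by (rule prob_space_uniform_measure) auto

lemma sets_angle [measurable_cong, simp]: "sets angle = sets borel"
  by (simp add: angle_def)

lemma space_angle [simp]: "space angle = UNIV"
  by (simp add: angle_def)

interpretation angle: prob_space angle by (rule prob_space_angle)

interpretation angles: product_prob_space "\<lambda>_. angle" I for I by standard

lemma prob_space_angles: "prob_space (angles d)"
  unfolding angles_def by (rule prob_space_PiM) (rule prob_space_angle)

interpretation anglesP: prob_space "angles d" for d by (rule prob_space_angles)

lemma measurable_coordinate:
  "j < d \<Longrightarrow> (\<lambda>\<theta>. \<theta> j) \<in> borel_measurable (angles d)"
  unfolding angles_def using measurable_component_singleton[of j "{..<d}" "\<lambda>_. angle"] by simp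

lemma measurable_Gap [measurable]: "Gap d \<in> borel_measurable (angles d)"
  unfolding Gap_def[abs_def]
  by (intro borel_measurable_sum borel_measurable_diff borel_measurable_const
      measurable_compose[OF measurable_coordinate borel_measurable_cos] ) auto

lemma Gap_bounds: "0 \<le> Gap d \<theta>" "Gap d \<theta> \<le> 2 * real d"
proof -
  show "0 \<le> Gap d \<theta>" unfolding Gap_def by (intro sum_nonneg) simp
  have "Gap d \<theta> \<le> (\<Sum>j<d. 2)" unfolding Gap_def
  proof (rule sum_mono)
    show "1 - cos (\<theta> i) \<le> 2" for i using cos_ge_minus_one[of "\<theta> i"] by linarith
  qed
  then show "Gap d \<theta> \<le> 2 * real d" by simp
qed

lemma nn_integral_angle:
  assumes [measurable]: "f \<in> borel_measurable borel"
  shows "(\<integral>\<^sup>+x. f x \<partial>angle) = ennreal (1 / (2 * pi)) * (\<integral>\<^sup>+x. f x * indicator {-pi..pi} x \<partial>lborel)"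
proof -
  have "inverse (ennreal (pi * 2)) = ennreal (1 / (2 * pi))"
    by (subst inverse_ennreal) (auto simp: inverse_eq_divide mult.commute)
  then show ?thesis
    by (simp add: angle_def nn_integral_uniform_measure divide_ennreal_def mult.commute)
qed

text \<open>
  The density of \<open>1 - cos \<theta>\<close> on \<open>(0, 2)\<close> for a uniform angle \<open>\<theta>\<close>.
\<close>

definition arcsine :: "real \<Rightarrow> real" where
  "arcsine v = 1 / (pi * sqrt (v * (2 - v)))"

lemma arcsine_measurable [measurable]: "arcsine \<in> borel_measurable borel"
  unfolding arcsine_def by measurable

lemma nn_integral_angle_cos:
  assumes g[measurable]: "g \<in> borel_measurable borel"
  shows "(\<integral>\<^sup>+\<theta>. g (1 - cos \<theta>) \<partial>angle) = (\<integral>\<^sup>+v. g v * ennreal (arcsine v) * indicator {0..2} v \<partial>lborel)"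
proof -
  define h where "h = (\<lambda>\<theta>. g (1 - cos \<theta>))"
  have [measurable]: "h \<in> borel_measurable borel" unfolding h_def by measurable
  have even: "h (- x) = h x" for x by (simp add: h_def)
  have "(\<integral>\<^sup>+x. h x * indicator {-pi..pi} x \<partial>lborel) =
      (\<integral>\<^sup>+x. h x * indicator {0..pi} x + h x * indicator {-pi..<0} x \<partial>lborel)"
    by (intro nn_integral_cong) (auto split: split_indicator)
  also have "\<dots> = (\<integral>\<^sup>+x. h x * indicator {0..pi} x \<partial>lborel) + (\<integral>\<^sup>+x. h x * indicator {-pi..<0} x \<partial>lborel)"
    by (rule nn_integral_add) auto
  also have "(\<integral>\<^sup>+x. h x * indicator {-pi..<0} x \<partial>lborel) = (\<integral>\<^sup>+x. h x * indicator {0<..pi} x \<partial>lborel)"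
  proof -
    have "(\<integral>\<^sup>+x. h x * indicator {-pi..<0} x \<partial>lborel) = ennreal \<bar>-1\<bar> * (\<integral>\<^sup>+x. h (0 + -1 * x) * indicator {-pi..<0} (0 + -1 * x) \<partial>lborel)"
      by (rule nn_integral_real_affine) auto
    also have "\<dots> = (\<integral>\<^sup>+x. h x * indicator {0<..pi} x \<partial>lborel)"
      by (auto simp: even intro!: nn_integral_cong split: split_indicator)
    finally show ?thesis .
  qed
  also have "(\<integral>\<^sup>+x. h x * indicator {0<..pi} x \<partial>lborel) = (\<integral>\<^sup>+x. h x * indicator {0..pi} x \<partial>lborel)"
    by (intro nn_integral_cong_AE eventually_mono[OF AE_lborel_singleton[of 0]]) (auto split: split_indicator)
  also have "(\<integral>\<^sup>+x. h x * indicator {0..pi} x \<partial>lborel) = (\<integral>\<^sup>+x. ennreal pi * (g (1 - cos x) * ennreal (arcsine (1 - cos x)) * ennreal (sin x) * indicator {0..pi} x) \<partial>lborel)"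
  proof (rule nn_integral_cong_AE)
    show "AE x in lborel. h x * indicator {0..pi} x = ennreal pi * (g (1 - cos x) * ennreal (arcsine (1 - cos x)) * ennreal (sin x) * indicator {0..pi} x)"
      using AE_lborel_singleton[of 0] AE_lborel_singleton[of pi]
    proof eventually_elim
      case (elim x)
      show ?case
      proof (cases "x \<in> {0..pi}")
        case True
        then have s: "sin x > 0" using elim by (intro sin_gt_zero) auto
        have "(1 - cos x) * (2 - (1 - cos x)) = (sin x)\<^sup>2"
          by (simp add: sin_squared_eq algebra_simps power2_eq_square)
        then have "arcsine (1 - cos x) = 1 / (pi * sin x)"
          unfolding arcsine_def using s by simp
        then have "ennreal pi * (ennreal (arcsine (1 - cos x)) * ennreal (sin x)) = 1"
          using s by (simp add: ennreal_mult'[symmetric])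
        then have "g (1 - cos x) * (ennreal pi * (ennreal (arcsine (1 - cos x)) * ennreal (sin x))) = g (1 - cos x)"
          by simp
        then show ?thesis using True by (simp add: h_def mult_ac)
      qed simp
    qed
  qed
  also have "\<dots> = ennreal pi * (\<integral>\<^sup>+x. g (1 - cos x) * ennreal (arcsine (1 - cos x)) * ennreal (sin x) * indicator {0..pi} x \<partial>lborel)"
    by (rule nn_integral_cmult) measurable
  also have "(\<integral>\<^sup>+x. g (1 - cos x) * ennreal (arcsine (1 - cos x)) * ennreal (sin x) * indicator {0..pi} x \<partial>lborel)
    = (\<integral>\<^sup>+v. g v * ennreal (arcsine v) * indicator {1 - cos 0..1 - cos pi} v \<partial>lborel)"
    by (rule nn_integral_substitution_aux[symmetric, where g = "\<lambda>x. 1 - cos x"])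
       (auto intro!: derivative_eq_intros continuous_intros sin_ge_zero)
  finally have eq: "(\<integral>\<^sup>+x. h x * indicator {-pi..pi} x \<partial>lborel) =
     ennreal pi * (\<integral>\<^sup>+v. g v * ennreal (arcsine v) * indicator {0..2} v \<partial>lborel) +
     ennreal pi * (\<integral>\<^sup>+v. g v * ennreal (arcsine v) * indicator {0..2} v \<partial>lborel)"
    by simp
  define J where "J = (\<integral>\<^sup>+v. g v * ennreal (arcsine v) * indicator {0..2} v \<partial>lborel)"
  have "(\<integral>\<^sup>+\<theta>. g (1 - cos \<theta>) \<partial>angle) = ennreal (1 / (2 * pi)) * (ennreal pi * J + ennreal pi * J)"
    by (subst nn_integral_angle) (use eq in \<open>simp_all add: h_def J_def\<close>)
  also have "\<dots> = (ennreal (1 / (2 * pi)) * (ennreal pi + ennreal pi)) * J"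
    by (simp add: distrib_right distrib_left mult_ac)
  also have "ennreal (1 / (2 * pi)) * (ennreal pi + ennreal pi) = 1"
    by (simp add: ennreal_plus[symmetric] ennreal_mult'[symmetric] del: ennreal_plus)
  finally show ?thesis by (simp add: J_def)
qed

lemma nn_integral_angle_reflect:
  assumes g[measurable]: "g \<in> borel_measurable borel"
  shows "(\<integral>\<^sup>+\<theta>. g (1 + cos \<theta>) \<partial>angle) = (\<integral>\<^sup>+\<theta>. g (1 - cos \<theta>) \<partial>angle)"
proof -
  have "(\<integral>\<^sup>+\<theta>. g (1 + cos \<theta>) \<partial>angle) = (\<integral>\<^sup>+\<theta>. (\<lambda>v. g (2 - v)) (1 - cos \<theta>) \<partial>angle)"
    by (intro nn_integral_cong) (simp add: algebra_simps)
  also have "\<dots> = (\<integral>\<^sup>+v. g (2 - v) * ennreal (arcsine v) * indicator {0..2} v \<partial>lborel)"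
    by (rule nn_integral_angle_cos) measurable
  also have "\<dots> = ennreal \<bar>-1\<bar> * (\<integral>\<^sup>+v. g (2 - (2 + -1 * v)) * ennreal (arcsine (2 + -1 * v)) * indicator {0..2} (2 + -1 * v) \<partial>lborel)"
    by (rule nn_integral_real_affine) auto
  also have "\<dots> = (\<integral>\<^sup>+v. g v * ennreal (arcsine v) * indicator {0..2} v \<partial>lborel)"
    by (auto simp: arcsine_def mult.commute intro!: nn_integral_cong split: split_indicator)
  also have "\<dots> = (\<integral>\<^sup>+\<theta>. g (1 - cos \<theta>) \<partial>angle)"
    by (rule nn_integral_angle_cos[symmetric]) measurable
  finally show ?thesis .
qed

lemma Gap_fun_upd: "Gap (Suc d) (x(d := y)) = Gap d x + (1 - cos y)"
  by (simp add: Gap_def)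

lemma nn_integral_Gap_Suc:
  assumes [measurable]: "f \<in> borel_measurable borel"
  shows "(\<integral>\<^sup>+\<theta>. f (Gap (Suc d) \<theta>) \<partial>angles (Suc d)) = (\<integral>\<^sup>+y. \<integral>\<^sup>+x. f (Gap d x + (1 - cos y)) \<partial>angles d \<partial>angle)"
proof -
  have m: "(\<lambda>\<theta>. f (Gap (Suc d) \<theta>)) \<in> borel_measurable (PiM (insert d {..<d}) (\<lambda>_. angle))"
    using measurable_compose[OF measurable_Gap[of "Suc d"], of f borel]
    by (simp add: angles_def lessThan_Suc)
  show ?thesis
    unfolding angles_def lessThan_Suc
    by (subst angles.product_nn_integral_insert_rev[OF _ _ m]) (auto simp: Gap_fun_upd)
qed

text \<open>
  The shift \<open>\<theta>\<^sub>j \<mapsto> \<theta>\<^sub>j + \<pi>\<close> of all angles preserves their law; here it is carried out on the law of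
  each \<open>1 - cos \<theta>\<^sub>j\<close>, which is symmetric about \<open>1\<close>.
\<close>

lemma nn_integral_Gap_reflect:
  assumes "f \<in> borel_measurable borel"
  shows "(\<integral>\<^sup>+\<theta>. f (2 * real d - Gap d \<theta>) \<partial>angles d) = (\<integral>\<^sup>+\<theta>. f (Gap d \<theta>) \<partial>angles d)"
  using assms
proof (induction d arbitrary: f)
  case 0
  then show ?case by (simp add: Gap_def)
next
  case (Suc d)
  note [measurable] = Suc.prems
  have "(\<integral>\<^sup>+\<theta>. f (2 * real (Suc d) - Gap (Suc d) \<theta>) \<partial>angles (Suc d))
    = (\<integral>\<^sup>+y. \<integral>\<^sup>+x. f (2 * real (Suc d) - (Gap d x + (1 - cos y))) \<partial>angles d \<partial>angle)"
    by (rule nn_integral_Gap_Suc) measurable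
  also have "\<dots> = (\<integral>\<^sup>+y. \<integral>\<^sup>+x. (\<lambda>u. f (u + (1 + cos y))) (2 * real d - Gap d x) \<partial>angles d \<partial>angle)"
    by (simp add: algebra_simps)
  also have "\<dots> = (\<integral>\<^sup>+y. \<integral>\<^sup>+x. f (Gap d x + (1 + cos y)) \<partial>angles d \<partial>angle)"
    by (intro nn_integral_cong Suc.IH) measurable
  also have "\<dots> = (\<integral>\<^sup>+y. \<integral>\<^sup>+x. f (Gap d x + (1 - cos y)) \<partial>angles d \<partial>angle)"
    by (rule nn_integral_angle_reflect[where g = "\<lambda>v. \<integral>\<^sup>+x. f (Gap d x + v) \<partial>angles d"]) measurable
  also have "\<dots> = (\<integral>\<^sup>+\<theta>. f (Gap (Suc d) \<theta>) \<partial>angles (Suc d))"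
    by (simp add: nn_integral_Gap_Suc)
  finally show ?case .
qed

lemma nn_integral_Gap_arcsine:
  assumes [measurable]: "f \<in> borel_measurable borel"
  shows "(\<integral>\<^sup>+\<theta>. f (Gap (Suc d) \<theta>) \<partial>angles (Suc d)) =
    (\<integral>\<^sup>+v. (\<integral>\<^sup>+x. f (Gap d x + v) \<partial>angles d) * ennreal (arcsine v) * indicator {0..2} v \<partial>lborel)"
proof -
  have "(\<integral>\<^sup>+\<theta>. f (Gap (Suc d) \<theta>) \<partial>angles (Suc d)) = (\<integral>\<^sup>+y. \<integral>\<^sup>+x. f (Gap d x + (1 - cos y)) \<partial>angles d \<partial>angle)"
    by (rule nn_integral_Gap_Suc[OF assms])
  also have "\<dots> = (\<integral>\<^sup>+v. (\<integral>\<^sup>+x. f (Gap d x + v) \<partial>angles d) * ennreal (arcsine v) * indicator {0..2} v \<partial>lborel)"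
    by (rule nn_integral_angle_cos[where g = "\<lambda>v. \<integral>\<^sup>+x. f (Gap d x + v) \<partial>angles d"]) measurable
  finally show ?thesis .
qed

text \<open>
  Only on \<open>(0, 2)\<close> does the gap of \<open>n + 1\<close> angles have a density of this form: from \<open>2\<close> on, the
  upper ends of the individual arcsine laws come into play. Set to \<open>0\<close> elsewhere, as
  \<open>nn_integral_Gap_density\<close> only speaks about gaps below \<open>2\<close>.
\<close>

definition gap_density :: "nat \<Rightarrow> real \<Rightarrow> real" where
  "gap_density n x = (if 0 < x \<and> x < 2 then (1 / pi) ^ Suc n * sqrt x ^ Suc n / x * phi n x else 0)"

lemma gap_density_nonneg: "0 \<le> gap_density n x"
proof -
  have "0 \<le> (1 / pi) ^ Suc n * sqrt x ^ Suc n / x * phi n x" if "0 < x" "x < 2"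
    using that phi_pos[of x n] by (intro mult_nonneg_nonneg divide_nonneg_pos) auto
  then show ?thesis by (simp only: gap_density_def split: if_split) blast
qed

lemma gap_density_measurable [measurable]: "gap_density n \<in> borel_measurable borel"
proof -
  have "(\<lambda>x. indicator {0<..<2} x *\<^sub>R ((1 / pi) ^ Suc n * sqrt x ^ Suc n / x * phi n x)) \<in> borel_measurable borel"
    by (intro borel_measurable_continuous_on_indicator continuous_intros continuous_on_subset[OF continuous_on_phi]) auto
  moreover have "gap_density n = (\<lambda>x. indicator {0<..<2} x *\<^sub>R ((1 / pi) ^ Suc n * sqrt x ^ Suc n / x * phi n x))"
    by (auto simp: fun_eq_iff gap_density_def split: split_indicator)
  ultimately show ?thesis by simp
qed

text \<open>
  The substitution \<open>v = x (sin t)\<^sup>2\<close> turns the convolution integral into the recursion for \<open>phi\<close>.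
\<close>

lemma gap_density_convolution:
  assumes x: "0 < x" "x < 2"
  shows "(\<integral>\<^sup>+v. ennreal (gap_density n (x - v)) * ennreal (arcsine v) * indicator {0..2} v \<partial>lborel) = ennreal (gap_density (Suc n) x)"
proof -
  let ?g = "\<lambda>t. x * (sin t)\<^sup>2"
  have "(\<integral>\<^sup>+v. ennreal (gap_density n (x - v)) * ennreal (arcsine v) * indicator {0..2} v \<partial>lborel) =
        (\<integral>\<^sup>+v. ennreal (gap_density n (x - v)) * ennreal (arcsine v) * indicator {?g 0..?g (pi/2)} v \<partial>lborel)"
    using x by (intro nn_integral_cong) (auto simp: gap_density_def split: split_indicator)
  also have "\<dots> = (\<integral>\<^sup>+t. ennreal (gap_density n (x - ?g t)) * ennreal (arcsine (?g t)) * ennreal (2 * x * sin t * cos t) * indicator {0..pi/2} t \<partial>lborel)"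
    using x by (intro nn_integral_substitution_aux)
       (auto intro!: derivative_eq_intros continuous_intros mult_nonneg_nonneg sin_pi_half_nonneg cos_pi_half_nonneg)
  also have "\<dots> = (\<integral>\<^sup>+t. ennreal ((1 / pi) ^ Suc (Suc n) * sqrt x ^ Suc (Suc n) / x * (2 * (cos t ^ n * (phi 0 (x * (sin t)\<^sup>2) * phi n (x * (cos t)\<^sup>2))))) * indicator {0..pi/2} t \<partial>lborel)"
  proof (rule nn_integral_cong_AE)
    show "AE t in lborel. ennreal (gap_density n (x - ?g t)) * ennreal (arcsine (?g t)) * ennreal (2 * x * sin t * cos t) * indicator {0..pi/2} t =
      ennreal ((1 / pi) ^ Suc (Suc n) * sqrt x ^ Suc (Suc n) / x * (2 * (cos t ^ n * (phi 0 (x * (sin t)\<^sup>2) * phi n (x * (cos t)\<^sup>2))))) * indicator {0..pi/2} t"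
      using AE_lborel_singleton[of 0] AE_lborel_singleton[of "pi/2"]
    proof eventually_elim
      case (elim t)
      show ?case
      proof (cases "t \<in> {0..pi/2}")
        case True
        then have t: "0 < t" "t < pi/2" using elim by auto
        have s: "0 < sin t" "0 < cos t" using t by (auto intro!: sin_gt_zero cos_gt_zero)
        have xg: "x - ?g t = x * (cos t)\<^sup>2" by (simp add: cos_squared_eq algebra_simps)
        have r: "0 < x * (cos t)\<^sup>2" "x * (cos t)\<^sup>2 < 2" "x * (sin t)\<^sup>2 < 2" using x s scale_sin_cos_less_2[of x t] by auto
        have d: "gap_density n (x - ?g t) = (1 / pi) ^ Suc n * (sqrt x * cos t) ^ Suc n / (x * (cos t)\<^sup>2) * phi n (x * (cos t)\<^sup>2)"
          unfolding xg gap_density_def using r s x by (simp add: real_sqrt_mult)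
        have a: "arcsine (?g t) = 1 / (pi * (sqrt x * sin t)) * phi 0 (x * (sin t)\<^sup>2)"
          unfolding arcsine_def using r s x by (simp add: real_sqrt_mult phi_0)
        have "gap_density n (x - ?g t) * arcsine (?g t) * (2 * x * sin t * cos t) =
          (1 / pi) ^ Suc (Suc n) * sqrt x ^ Suc (Suc n) / x * (2 * (cos t ^ n * (phi 0 (x * (sin t)\<^sup>2) * phi n (x * (cos t)\<^sup>2))))"
        proof -
          define S where "S = sqrt x"
          have S: "S > 0" "S * S = x" using x by (auto simp: S_def)
          have pw: "S ^ Suc (Suc n) / x = S ^ n" using S x by (simp add: mult.assoc[symmetric])
          have gen: "(1 / pi) ^ Suc n * (S * c) ^ Suc n / (x * c\<^sup>2) * P * (1 / (pi * (S * u)) * Q) * (2 * x * u * c)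
             = (1 / pi) ^ Suc (Suc n) * S ^ n * (2 * (c ^ n * (Q * P)))"
            if "c > 0" "u > 0" for c u P Q :: real
            using that S(1) x(1) by (simp add: divide_simps power2_eq_square power_mult_distrib)
          show ?thesis unfolding d a S_def[symmetric] times_divide_eq_right[symmetric, of _ "S ^ Suc (Suc n)"] pw
            by (rule gen[OF s(2) s(1)])
        qed
        moreover have "0 \<le> gap_density n (x - ?g t)" by (rule gap_density_nonneg)
        moreover have "0 \<le> arcsine (?g t)" using r s x by (auto simp: arcsine_def)
        ultimately show ?thesis using True x s by (simp add: ennreal_mult'[symmetric] ennreal_mult[symmetric])
      qed simp
    qed
  qed
  also have "\<dots> = ennreal ((1 / pi) ^ Suc (Suc n) * sqrt x ^ Suc (Suc n) / x * (2 * integral {0..pi/2} (\<lambda>t. cos t ^ n * (phi 0 (x * (sin t)\<^sup>2) * phi n (x * (cos t)\<^sup>2)))))"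
  proof (rule nn_integral_has_integral_lebesgue')
    show "((\<lambda>t. (1 / pi) ^ Suc (Suc n) * sqrt x ^ Suc (Suc n) / x * (2 * (cos t ^ n * (phi 0 (x * (sin t)\<^sup>2) * phi n (x * (cos t)\<^sup>2)))))
       has_integral (1 / pi) ^ Suc (Suc n) * sqrt x ^ Suc (Suc n) / x * (2 * integral {0..pi/2} (\<lambda>t. cos t ^ n * (phi 0 (x * (sin t)\<^sup>2) * phi n (x * (cos t)\<^sup>2))))) {0..pi/2}"
      using phi_Suc_integrable[OF x(2)] by (intro has_integral_mult_right integrable_integral)
    show "0 \<le> (1 / pi) ^ Suc (Suc n) * sqrt x ^ Suc (Suc n) / x * (2 * (cos t ^ n * (phi 0 (x * (sin t)\<^sup>2) * phi n (x * (cos t)\<^sup>2))))"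
      if t: "t \<in> {0..pi/2}" for t
    proof -
      have "0 \<le> cos t ^ n" using t cos_pi_half_nonneg by simp
      moreover have "0 \<le> phi 0 (x * (sin t)\<^sup>2)" "0 \<le> phi n (x * (cos t)\<^sup>2)"
        using scale_sin_cos_less_2[OF x(2), of t] phi_pos less_imp_le by blast+
      ultimately show ?thesis using x by simp
    qed
  qed
  also have "\<dots> = ennreal (gap_density (Suc n) x)"
    using x by (simp add: gap_density_def phi_Suc)
  finally show ?thesis .
qed

text \<open>
  Add one angle at a time. As all summands are nonnegative, a gap below \<open>2\<close> involves only smaller gaps
  below \<open>2\<close>, so the truncated laws can be convolved among themselves.
\<close>

lemma nn_integral_Gap_density:
  assumes "f \<in> borel_measurable borel"
  shows "(\<integral>\<^sup>+\<theta>. f (Gap (Suc n) \<theta>) * indicator {..<2} (Gap (Suc n) \<theta>) \<partial>angles (Suc n)) = (\<integral>\<^sup>+x. f x * ennreal (gap_density n x) \<partial>lborel)"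
  using assms
proof (induction n arbitrary: f)
  case 0
  note [measurable] = 0
  have "(\<integral>\<^sup>+\<theta>. f (Gap (Suc 0) \<theta>) * indicator {..<2} (Gap (Suc 0) \<theta>) \<partial>angles (Suc 0)) =
    (\<integral>\<^sup>+v. (\<integral>\<^sup>+x. f (Gap 0 x + v) * indicator {..<2} (Gap 0 x + v) \<partial>angles 0) * ennreal (arcsine v) * indicator {0..2} v \<partial>lborel)"
    by (rule nn_integral_Gap_arcsine) measurable
  also have "\<dots> = (\<integral>\<^sup>+v. f v * indicator {..<2} v * ennreal (arcsine v) * indicator {0..2} v \<partial>lborel)"
    by (simp add: Gap_def anglesP.emeasure_space_1)
  also have "\<dots> = (\<integral>\<^sup>+x. f x * ennreal (gap_density 0 x) \<partial>lborel)"
  proof (rule nn_integral_cong)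
    fix v :: real
    have "arcsine v = gap_density 0 v" if "0 < v" "v < 2"
    proof -
      have "gap_density 0 v = 1 / pi * (sqrt v / v) * (1 / sqrt (2 - v))"
        using that by (simp add: gap_density_def phi_0)
      also have "sqrt v / v = 1 / sqrt v" using that by (simp add: field_simps)
      finally show ?thesis using that by (simp add: arcsine_def real_sqrt_mult)
    qed
    moreover have "arcsine 0 = 0" by (simp add: arcsine_def)
    ultimately show "f v * indicator {..<2} v * ennreal (arcsine v) * indicator {0..2} v = f v * ennreal (gap_density 0 v)"
      by (cases "v = 0") (auto simp: gap_density_def split: split_indicator)
  qed
  finally show ?case .
next
  case (Suc n)
  note [measurable] = Suc.prems
  have "(\<integral>\<^sup>+\<theta>. f (Gap (Suc (Suc n)) \<theta>) * indicator {..<2} (Gap (Suc (Suc n)) \<theta>) \<partial>angles (Suc (Suc n))) =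
    (\<integral>\<^sup>+v. (\<integral>\<^sup>+x. f (Gap (Suc n) x + v) * indicator {..<2} (Gap (Suc n) x + v) \<partial>angles (Suc n)) * ennreal (arcsine v) * indicator {0..2} v \<partial>lborel)"
    by (rule nn_integral_Gap_arcsine) measurable
  also have "\<dots> = (\<integral>\<^sup>+v. (\<integral>\<^sup>+x. f x * indicator {..<2} x * ennreal (gap_density n (x - v)) \<partial>lborel) * ennreal (arcsine v) * indicator {0..2} v \<partial>lborel)"
  proof (rule nn_integral_cong)
    fix v :: real
    show "(\<integral>\<^sup>+x. f (Gap (Suc n) x + v) * indicator {..<2} (Gap (Suc n) x + v) \<partial>angles (Suc n)) * ennreal (arcsine v) * indicator {0..2} v =
      (\<integral>\<^sup>+x. f x * indicator {..<2} x * ennreal (gap_density n (x - v)) \<partial>lborel) * ennreal (arcsine v) * indicator {0..2} v"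
    proof (cases "v \<in> {0..2}")
      case True
      have "(\<integral>\<^sup>+x. f (Gap (Suc n) x + v) * indicator {..<2} (Gap (Suc n) x + v) \<partial>angles (Suc n)) =
        (\<integral>\<^sup>+x. (\<lambda>u. f (u + v) * indicator {..<2} (u + v)) (Gap (Suc n) x) * indicator {..<2} (Gap (Suc n) x) \<partial>angles (Suc n))"
        using True by (intro nn_integral_cong) (auto split: split_indicator)
      also have "\<dots> = (\<integral>\<^sup>+x. f (x + v) * indicator {..<2} (x + v) * ennreal (gap_density n x) \<partial>lborel)"
        by (rule Suc.IH) measurable
      also have "\<dots> = ennreal \<bar>1\<bar> * (\<integral>\<^sup>+x. f (-v + 1 * x + v) * indicator {..<2} (-v + 1 * x + v) * ennreal (gap_density n (-v + 1 * x)) \<partial>lborel)"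
        by (rule nn_integral_real_affine) auto
      finally show ?thesis by simp
    qed simp
  qed
  also have "\<dots> = (\<integral>\<^sup>+v. \<integral>\<^sup>+x. f x * indicator {..<2} x * ennreal (gap_density n (x - v)) * (ennreal (arcsine v) * indicator {0..2} v) \<partial>lborel \<partial>lborel)"
    by (rule nn_integral_cong, subst mult.assoc, rule nn_integral_multc[symmetric]) measurable
  also have "\<dots> = (\<integral>\<^sup>+x. \<integral>\<^sup>+v. f x * indicator {..<2} x * ennreal (gap_density n (x - v)) * (ennreal (arcsine v) * indicator {0..2} v) \<partial>lborel \<partial>lborel)"
    by (rule lborel_pair.Fubini') measurable
  also have "\<dots> = (\<integral>\<^sup>+x. f x * indicator {..<2} x * (\<integral>\<^sup>+v. ennreal (gap_density n (x - v)) * ennreal (arcsine v) * indicator {0..2} v \<partial>lborel) \<partial>lborel)"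
    by (subst nn_integral_cmult[symmetric]) (auto simp: mult.assoc)
  also have "\<dots> = (\<integral>\<^sup>+x. f x * ennreal (gap_density (Suc n) x) \<partial>lborel)"
  proof (rule nn_integral_cong)
    fix x :: real
    consider "0 < x" "x < 2" | "x \<ge> 2" | "x \<le> 0" by linarith
    then show "f x * indicator {..<2} x * (\<integral>\<^sup>+v. ennreal (gap_density n (x - v)) * ennreal (arcsine v) * indicator {0..2} v \<partial>lborel) = f x * ennreal (gap_density (Suc n) x)"
    proof cases
      case 1
      then show ?thesis by (simp add: gap_density_convolution)
    next
      case 2
      then show ?thesis by (simp add: gap_density_def)
    next
      case 3
      then have "(\<integral>\<^sup>+v. ennreal (gap_density n (x - v)) * ennreal (arcsine v) * indicator {0..2} v \<partial>lborel) = (\<integral>\<^sup>+v. 0 \<partial>(lborel :: real measure))"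
        by (intro nn_integral_cong) (auto simp: gap_density_def split: split_indicator)
      with 3 show ?thesis by (simp add: gap_density_def)
    qed
  qed
  finally show ?case .
qed

section \<open>Counting closed walks by Fourier integrals\<close>

text \<open>
  A Cauchy transform \<open>\<integral> c / (p - z q)\<close> is holomorphic where the denominators stay away from \<open>0\<close>: the
  difference quotients converge uniformly on the probability space. The weight \<open>c\<close> is used for
  cutting out the part of the space where the denominators do come close to \<open>0\<close>.
\<close>

lemma cauchy_transform_holomorphic:
  fixes c p q :: "'a \<Rightarrow> real"
  assumes M: "prob_space M"
    and [measurable]: "c \<in> borel_measurable M" "p \<in> borel_measurable M" "q \<in> borel_measurable M"
    and c: "\<And>x. x \<in> space M \<Longrightarrow> \<bar>c x\<bar> \<le> 1" and q: "\<And>x. x \<in> space M \<Longrightarrow> \<bar>q x\<bar> \<le> Q"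
    and S: "open S"
    and sep: "\<And>z. z \<in> S \<Longrightarrow> \<exists>\<delta>>0. \<forall>x\<in>space M. c x \<noteq> 0 \<longrightarrow> \<delta> \<le> norm (of_real (p x) - z * of_real (q x))"
  shows "(\<lambda>z. \<integral>x. of_real (c x) / (of_real (p x) - z * of_real (q x)) \<partial>M) holomorphic_on S"
proof -
  interpret prob_space M by (rule M)
  define F where "F = (\<lambda>z. \<integral>x. complex_of_real (c x) / (of_real (p x) - z * of_real (q x)) \<partial>M)"
  have "(F has_field_derivative (\<integral>x. complex_of_real (c x) * of_real (q x) / (of_real (p x) - z * of_real (q x))\<^sup>2 \<partial>M)) (at z)"
    (is "(F has_field_derivative ?D) (at z)") if z: "z \<in> S" for z
  proof -
    obtain \<delta> where d: "\<delta> > 0" and dx: "\<And>x. x \<in> space M \<Longrightarrow> c x \<noteq> 0 \<Longrightarrow> \<delta> \<le> norm (of_real (p x) - z * of_real (q x))"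
      using sep[OF z] by blast
    define R where "R = \<bar>Q\<bar> + 1"
    have R: "R > 0" "\<bar>q x\<bar> \<le> R" if "x \<in> space M" for x using q[OF that] by (auto simp: R_def)
    have R0: "R > 0" by (simp add: R_def)
    have low: "\<delta> / 2 \<le> norm (of_real (p x) - (z + h) * of_real (q x))"
      if "x \<in> space M" "c x \<noteq> 0" "norm h \<le> \<delta> / (2 * R)" for x h
    proof -
      have "norm (h * of_real (q x)) \<le> \<delta> / (2 * R) * R"
        unfolding norm_mult using that R[of x] d by (intro mult_mono) auto
      then have "norm (h * of_real (q x)) \<le> \<delta> / 2" using R0 by simp
      moreover have "of_real (p x) - (z + h) * of_real (q x) = (of_real (p x) - z * of_real (q x)) - h * of_real (q x)"
        by (simp add: algebra_simps)
      then have "norm (of_real (p x) - (z + h) * of_real (q x)) \<ge> norm (of_real (p x) - z * of_real (q x)) - norm (h * of_real (q x))"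
        by (metis norm_triangle_ineq2)
      ultimately show ?thesis using dx[OF that(1,2)] by linarith
    qed
    have int: "integrable M (\<lambda>x. complex_of_real (c x) / (of_real (p x) - (z + h) * of_real (q x)))"
      if "norm h \<le> \<delta> / (2 * R)" for h
    proof (rule integrable_const_bound[where B = "2 / \<delta>"])
      show "AE x in M. norm (complex_of_real (c x) / (of_real (p x) - (z + h) * of_real (q x))) \<le> 2 / \<delta>"
      proof (rule AE_I2)
        fix x assume x: "x \<in> space M"
        show "norm (complex_of_real (c x) / (of_real (p x) - (z + h) * of_real (q x))) \<le> 2 / \<delta>"
        proof (cases "c x = 0")
          case False
          have "norm (complex_of_real (c x) / (of_real (p x) - (z + h) * of_real (q x))) \<le> 1 / (\<delta> / 2)"
            unfolding norm_divide using c[OF x] low[OF x False that] d by (intro frac_le) auto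
          then show ?thesis by simp
        qed (use d in auto)
      qed
    qed measurable
    have intD: "integrable M (\<lambda>x. complex_of_real (c x) * of_real (q x) / (of_real (p x) - z * of_real (q x))\<^sup>2)"
    proof (rule integrable_const_bound[where B = "R / \<delta>\<^sup>2"])
      show "AE x in M. norm (complex_of_real (c x) * of_real (q x) / (of_real (p x) - z * of_real (q x))\<^sup>2) \<le> R / \<delta>\<^sup>2"
      proof (rule AE_I2)
        fix x assume x: "x \<in> space M"
        show "norm (complex_of_real (c x) * of_real (q x) / (of_real (p x) - z * of_real (q x))\<^sup>2) \<le> R / \<delta>\<^sup>2"
        proof (cases "c x = 0")
          case False
          have "\<bar>c x\<bar> * \<bar>q x\<bar> \<le> 1 * R" using c[OF x] R[OF x] by (intro mult_mono) auto
          then show ?thesis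
            unfolding norm_divide norm_mult norm_power norm_of_real using dx[OF x False] d R[OF x]
            by (intro frac_le power_mono) auto
        qed (use d R0 in auto)
      qed
    qed measurable
    have bound: "norm ((F (z + h) - F z) / h - ?D) \<le> norm h * (R\<^sup>2 * 2 / \<delta> ^ 3)"
      if h: "h \<noteq> 0" "norm h \<le> \<delta> / (2 * R)" for h
    proof -
      have "(F (z + h) - F z) / h - ?D = (\<integral>x. (complex_of_real (c x) / (of_real (p x) - (z + h) * of_real (q x))
          - complex_of_real (c x) / (of_real (p x) - (z + 0) * of_real (q x))) / h
          - complex_of_real (c x) * of_real (q x) / (of_real (p x) - z * of_real (q x))\<^sup>2 \<partial>M)"
        unfolding F_def using int[OF h(2)] int[of 0] intD d R0 by simp
      also have "norm \<dots> \<le> (\<integral>x. norm h * (R\<^sup>2 * 2 / \<delta> ^ 3) \<partial>M)"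
      proof (rule order_trans[OF integral_norm_bound integral_mono[OF integrable_norm]])
        show "integrable M (\<lambda>x. (complex_of_real (c x) / (of_real (p x) - (z + h) * of_real (q x))
          - complex_of_real (c x) / (of_real (p x) - (z + 0) * of_real (q x))) / h
          - complex_of_real (c x) * of_real (q x) / (of_real (p x) - z * of_real (q x))\<^sup>2)"
          using int[OF h(2)] int[of 0] intD d R0 by simp
        fix x assume x: "x \<in> space M"
        show "norm ((complex_of_real (c x) / (of_real (p x) - (z + h) * of_real (q x))
          - complex_of_real (c x) / (of_real (p x) - (z + 0) * of_real (q x))) / h
          - complex_of_real (c x) * of_real (q x) / (of_real (p x) - z * of_real (q x))\<^sup>2) \<le> norm h * (R\<^sup>2 * 2 / \<delta> ^ 3)"
        proof (cases "c x = 0")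
          case False
          define u where "u = of_real (p x) - z * complex_of_real (q x)"
          define v where "v = of_real (p x) - (z + h) * complex_of_real (q x)"
          have u: "norm u \<ge> \<delta>" "u \<noteq> 0" using dx[OF x False] d by (auto simp: u_def)
          have v: "norm v \<ge> \<delta> / 2" "v \<noteq> 0" using low[OF x False h(2)] d by (auto simp: v_def)
          have uv: "v = u - h * of_real (q x)" by (simp add: u_def v_def algebra_simps)
          have "(of_real (c x) / v - of_real (c x) / u) / h - of_real (c x) * of_real (q x) / u\<^sup>2
            = of_real (c x) * h * (of_real (q x))\<^sup>2 / (v * u\<^sup>2)"
            using u v h by (simp add: field_simps power2_eq_square) (simp add: uv algebra_simps)
          also have "norm \<dots> = \<bar>c x\<bar> * norm h * \<bar>q x\<bar>\<^sup>2 / (norm v * norm u ^ 2)"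
            by (simp add: norm_mult norm_divide norm_power)
          also have "\<dots> \<le> 1 * norm h * R\<^sup>2 / ((\<delta> / 2) * \<delta>\<^sup>2)"
            using c[OF x] R[OF x] u v d by (intro frac_le mult_mono power_mono) (auto simp: power_mono)
          also have "\<dots> = norm h * (R\<^sup>2 * 2 / \<delta> ^ 3)" by (simp add: power3_eq_cube power2_eq_square)
          finally show ?thesis by (simp add: u_def v_def)
        qed (use d in auto)
      qed auto
      also have "\<dots> = norm h * (R\<^sup>2 * 2 / \<delta> ^ 3)" by (simp add: prob_space)
      finally show ?thesis .
    qed
    have "((\<lambda>h. (F (z + h) - F z) / h - ?D) \<longlongrightarrow> 0) (at 0)"
    proof (rule Lim_null_comparison)
      have "\<forall>\<^sub>F h in at 0. h \<noteq> (0::complex)" by (simp add: eventually_at_filter)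
      moreover have "\<forall>\<^sub>F h in at (0::complex). norm h \<le> \<delta> / (2 * R)"
        unfolding eventually_at using d R0 by (intro exI[of _ "\<delta> / (2 * R)"]) auto
      ultimately show "\<forall>\<^sub>F h in at 0. norm ((F (z + h) - F z) / h - ?D) \<le> norm h * (R\<^sup>2 * 2 / \<delta> ^ 3)"
        by eventually_elim (rule bound)
      show "((\<lambda>h::complex. norm h * (R\<^sup>2 * 2 / \<delta> ^ 3)) \<longlongrightarrow> 0) (at 0)"
        by (intro tendsto_mult_left_zero tendsto_norm_zero tendsto_ident_at)
    qed
    then show ?thesis by (simp add: DERIV_def LIM_zero_iff)
  qed
  then have "F holomorphic_on S"
    using S by (auto simp: holomorphic_on_open)
  then show ?thesis by (simp add: F_def)
qed

lemma cis_linear_measurable: "(\<lambda>\<theta>::real. cis (a * \<theta>)) \<in> borel_measurable borel"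
  by (intro borel_measurable_continuous_onI continuous_intros)

text \<open>
  Orthogonality of the characters and the recurrence for the one-dimensional walk both come from the
  vanishing of the mean of a derivative over a period.
\<close>

lemma integral_angle_derivative:
  fixes F f :: "real \<Rightarrow> 'a :: euclidean_space"
  assumes F: "\<And>t. (F has_vector_derivative f t) (at t)" and f: "continuous_on UNIV f" and per: "F pi = F (-pi)"
  shows "(\<integral>t. f t \<partial>angle) = 0"
proof -
  have "(\<integral>t. indicator {-pi..pi} t *\<^sub>R f t \<partial>lborel) = F pi - F (-pi)"
    by (rule integral_FTC_Icc)
       (auto intro: has_vector_derivative_at_within[OF F] continuous_on_subset[OF f])
  then have 0: "(\<integral>t. indicator {-pi..pi} t *\<^sub>R f t \<partial>lborel) = 0" using per by simp
  have eq: "angle = density lborel (\<lambda>t. ennreal (indicator {-pi..pi} t / (2 * pi)))"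
    unfolding angle_def uniform_measure_def
    by (intro density_cong AE_I2) (auto simp: divide_ennreal[symmetric] ennreal_indicator split: split_indicator)
  have "(\<integral>t. f t \<partial>angle) = (\<integral>t. (indicator {-pi..pi} t / (2 * pi)) *\<^sub>R f t \<partial>lborel)"
    unfolding eq using f by (intro integral_density) (auto intro: borel_measurable_continuous_onI)
  also have "\<dots> = (\<integral>t. (1 / (2 * pi)) *\<^sub>R (indicator {-pi..pi} t *\<^sub>R f t) \<partial>lborel)"
    by simp
  also have "\<dots> = 0" by (subst integral_scaleR_right) (simp add: 0)
  finally show ?thesis .
qed

lemma integral_angle_character:
  fixes k :: int
  shows "(\<integral>\<theta>. cis (of_int k * \<theta>) \<partial>angle) = (if k = 0 then 1 else 0)"
proof (cases "k = 0")
  case True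
  then show ?thesis using angle.prob_space by simp
next
  case False
  define F where "F = (\<lambda>\<theta>::real. cis (of_int k * \<theta>) / (\<i> * of_int k))"
  have "(\<integral>\<theta>. cis (of_int k * \<theta>) \<partial>angle) = 0"
  proof (rule integral_angle_derivative)
    show "(F has_vector_derivative cis (of_int k * x)) (at x)" for x
    proof -
      have "((\<lambda>z. exp (\<i> * of_int k * z) / (\<i> * of_int k)) has_field_derivative exp (\<i> * of_int k * of_real x)) (at (of_real x))"
        using False by (auto intro!: derivative_eq_intros)
      then have "((\<lambda>x. exp (\<i> * of_int k * of_real x) / (\<i> * of_int k)) has_vector_derivative exp (\<i> * of_int k * of_real x)) (at x)"
        by (rule has_vector_derivative_real_field)
      then show ?thesis
        by (simp add: F_def cis_conv_exp mult.assoc)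
    qed
    have "cis (of_int k * pi) = cis (of_int k * (- pi) + 2 * pi * of_int k)" by (simp add: algebra_simps)
    also have "\<dots> = cis (of_int k * (- pi))" by (simp only: cis_mult[symmetric] cis_multiple_2pi Ints_of_int) simp
    finally show "F pi = F (- pi)" by (simp add: F_def)
  qed (intro continuous_intros)
  then show ?thesis using False by simp
qed

definition character :: "nat \<Rightarrow> (nat \<Rightarrow> int) \<Rightarrow> (nat \<Rightarrow> real) \<Rightarrow> complex" where
  "character d v \<theta> = (\<Prod>j<d. cis (of_int (v j) * \<theta> j))"

lemma character_measurable [measurable]: "character d v \<in> borel_measurable (angles d)"
proof -
  have "(\<lambda>\<theta>. cis (of_int (v j) * \<theta> j)) \<in> borel_measurable (angles d)" if "j < d" for j
    using measurable_compose[OF measurable_coordinate[OF that], of "\<lambda>x. cis (of_int (v j) * x)" borel]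
    by (simp add: borel_measurable_continuous_onI continuous_intros)
  then show ?thesis unfolding character_def[abs_def] by (intro borel_measurable_prod) auto
qed

lemma character_integrable [simp]: "integrable (angles d) (character d v)"
  by (rule anglesP.integrable_const_bound[where B = 1]) (auto simp: character_def prod_norm[symmetric])

lemma integral_character:
  "(\<integral>\<theta>. character d v \<theta> \<partial>angles d) = (if \<forall>j<d. v j = 0 then 1 else 0)"
proof -
  have "(\<integral>\<theta>. character d v \<theta> \<partial>angles d) = (\<Prod>j<d. \<integral>\<theta>. cis (of_int (v j) * \<theta>) \<partial>angle)"
    unfolding character_def angles_def
  proof (rule angles.product_integral_prod)
    show "integrable angle (\<lambda>\<theta>. cis (of_int (v j) * \<theta>))" for j
      by (rule angle.integrable_const_bound[where B = 1])
         (use cis_linear_measurable[of "of_int (v j)"] in auto)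
  qed simp
  also have "\<dots> = (\<Prod>j<d. if v j = 0 then 1 else 0)" by (simp add: integral_angle_character)
  also have "\<dots> = (if \<forall>j<d. v j = 0 then 1 else 0)"
    by (induction d) (auto simp: less_Suc_eq)
  finally show ?thesis .
qed

lemma character_add: "character d (\<lambda>j. u j + v j) \<theta> = character d u \<theta> * character d v \<theta>"
  by (simp add: character_def prod.distrib[symmetric] cis_mult distrib_right)

lemma character_unit_vec: "i < d \<Longrightarrow> character d (unit_vec i) \<theta> = cis (\<theta> i)"
  "i < d \<Longrightarrow> character d (\<lambda>j. - unit_vec i j) \<theta> = cis (- \<theta> i)"
proof -
  assume i: "i < d"
  have "character d (unit_vec i) \<theta> = (\<Prod>j<d. if j = i then cis (\<theta> i) else 1)"
    unfolding character_def by (intro prod.cong) (auto simp: unit_vec_def)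
  then show "character d (unit_vec i) \<theta> = cis (\<theta> i)" using i by (simp add: prod.delta)
  have "character d (\<lambda>j. - unit_vec i j) \<theta> = (\<Prod>j<d. if j = i then cis (- \<theta> i) else 1)"
    unfolding character_def by (intro prod.cong) (auto simp: unit_vec_def)
  then show "character d (\<lambda>j. - unit_vec i j) \<theta> = cis (- \<theta> i)" using i by (simp add: prod.delta)
qed

definition step_sum :: "nat \<Rightarrow> (nat \<Rightarrow> real) \<Rightarrow> real" where
  "step_sum d \<theta> = 2 * (real d - Gap d \<theta>)"

lemma step_sum_measurable [measurable]: "step_sum d \<in> borel_measurable (angles d)"
  unfolding step_sum_def[abs_def] by measurable

lemma step_sum_bound: "\<bar>step_sum d \<theta>\<bar> \<le> 2 * real d"
  using Gap_bounds[of d \<theta>] by (simp add: step_sum_def abs_le_iff)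

lemma sum_character_unit_steps: "(\<Sum>u\<in>unit_steps d. character d u \<theta>) = of_real (step_sum d \<theta>)"
proof -
  have "(\<Sum>u\<in>unit_steps d. character d u \<theta>) = (\<Sum>i<d. cis (\<theta> i) + cis (- \<theta> i))"
    by (simp add: sum_unit_steps character_unit_vec)
  also have "\<dots> = (\<Sum>i<d. of_real (2 * cos (\<theta> i)))"
    by (intro sum.cong) (auto simp: complex_eq_iff)
  also have "\<dots> = of_real (step_sum d \<theta>)"
    by (simp add: step_sum_def Gap_def sum_subtractf sum_distrib_left)
  finally show ?thesis .
qed

lemma walks_Suc: "walks d (Suc n) = (\<lambda>(u, xs). u # xs) ` (unit_steps d \<times> walks d n)"
  by (auto simp: walks_def length_Suc_conv image_iff)

lemma sum_character_walks:
  "(\<Sum>xs\<in>walks d n. character d (endpoint xs) \<theta>) = of_real (step_sum d \<theta>) ^ n"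
proof (induction n)
  case 0
  have "walks d 0 = {[]}" by (auto simp: walks_def)
  then show ?case by (simp add: endpoint_def character_def)
next
  case (Suc n)
  have e: "endpoint (u # xs) = (\<lambda>j. u j + endpoint xs j)" for u xs by (simp add: endpoint_def)
  have "(\<Sum>xs\<in>walks d (Suc n). character d (endpoint xs) \<theta>) =
     (\<Sum>(u, xs)\<in>unit_steps d \<times> walks d n. character d u \<theta> * character d (endpoint xs) \<theta>)"
    unfolding walks_Suc
    by (subst sum.reindex) (auto simp: inj_on_def e character_add split_def)
  also have "\<dots> = (\<Sum>u\<in>unit_steps d. character d u \<theta>) * (\<Sum>xs\<in>walks d n. character d (endpoint xs) \<theta>)"
    by (simp add: sum_product sum.cartesian_product)
  also have "\<dots> = of_real (step_sum d \<theta>) ^ Suc n"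
    by (simp add: Suc sum_character_unit_steps)
  finally show ?case .
qed

lemma endpoint_coordinate_ge:
  assumes "xs \<in> walks d n" "d \<le> j" shows "endpoint xs j = 0"
proof -
  have "set ys \<subseteq> unit_steps d \<Longrightarrow> endpoint ys j = 0" for ys
    using assms(2) by (induction ys) (auto simp: endpoint_def unit_steps_def unit_vec_def)
  then show ?thesis using assms(1) by (simp add: walks_def)
qed

text \<open>
  Expand the power of \<open>step_sum\<close>, the sum of the characters of all unit steps, into the characters of
  the endpoints of all walks. Only the walks that end at the origin have a nonzero mean.
\<close>

theorem closed_walks_moment:
  "(\<integral>\<theta>. step_sum d \<theta> ^ n \<partial>angles d) = real (card (closed_walks d n))"
proof -
  have "complex_of_real (\<integral>\<theta>. step_sum d \<theta> ^ n \<partial>angles d) = (\<integral>\<theta>. of_real (step_sum d \<theta>) ^ n \<partial>angles d)"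
    by (subst integral_complex_of_real[symmetric]) simp
  also have "\<dots> = (\<integral>\<theta>. (\<Sum>xs\<in>walks d n. character d (endpoint xs) \<theta>) \<partial>angles d)"
    by (simp add: sum_character_walks)
  also have "\<dots> = (\<Sum>xs\<in>walks d n. if \<forall>j<d. endpoint xs j = 0 then 1 else 0)"
    by (simp add: integral_character)
  also have "\<dots> = (\<Sum>xs\<in>walks d n. if endpoint xs = origin then 1 else 0)"
  proof (intro sum.cong refl if_cong)
    fix xs assume xs: "xs \<in> walks d n"
    show "(\<forall>j<d. endpoint xs j = 0) = (endpoint xs = origin)"
      using endpoint_coordinate_ge[OF xs] by (auto simp: origin_def fun_eq_iff) (metis not_le)
  qed
  also have "\<dots> = of_nat (card (closed_walks d n))"
    by (simp add: sum.If_cases closed_walks_def Int_def)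
  finally show ?thesis by (metis of_real_eq_iff of_real_of_nat_eq)
qed

section \<open>Green's function on the cut plane\<close>

text \<open>
  The critical value of \<open>w\<close>, at which \<open>1 - w (step_sum d \<theta>)\<^sup>2\<close> starts to vanish; it will turn out to
  be the radius of convergence of \<open>B_series d\<close>.
\<close>

definition crit :: "nat \<Rightarrow> real" where
  "crit d = 1 / (2 * real d)\<^sup>2"

definition cut_plane :: "nat \<Rightarrow> complex set" where
  "cut_plane d = {w. Im w = 0 \<longrightarrow> Re w < crit d}"

definition Green :: "nat \<Rightarrow> complex \<Rightarrow> complex" where
  "Green d w = (\<integral>\<theta>. 1 / (1 - w * of_real ((step_sum d \<theta>)\<^sup>2)) \<partial>angles d)"

lemma crit_pos: "d \<ge> 1 \<Longrightarrow> 0 < crit d"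
  by (simp add: crit_def)

lemma step_sum_sq: "0 \<le> (step_sum d \<theta>)\<^sup>2" "(step_sum d \<theta>)\<^sup>2 \<le> (2 * real d)\<^sup>2"
proof -
  show "(step_sum d \<theta>)\<^sup>2 \<le> (2 * real d)\<^sup>2"
    using step_sum_bound[of d \<theta>] by (intro iffD1[OF abs_le_square_iff]) simp
qed simp

lemma open_cut_plane: "open (cut_plane d)"
proof -
  have "cut_plane d = (\<lambda>w. of_real (crit d) - w) -` (- \<real>\<^sub>\<le>\<^sub>0)"
    by (auto simp: cut_plane_def complex_nonpos_Reals_iff)
  then show ?thesis by (auto intro!: open_vimage continuous_intros)
qed

lemma cut_plane_separation:
  assumes "w \<in> cut_plane d"
  shows "\<exists>\<delta>>0. \<forall>t\<in>{0..(2 * real d)\<^sup>2}. \<delta> \<le> norm (1 - w * of_real t)"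
proof -
  have "continuous_on {0..(2 * real d)\<^sup>2} (\<lambda>t. norm (1 - w * of_real t))" by (intro continuous_intros)
  then obtain t0 where t0: "t0 \<in> {0..(2 * real d)\<^sup>2}"
    "\<And>t. t \<in> {0..(2 * real d)\<^sup>2} \<Longrightarrow> norm (1 - w * of_real t0) \<le> norm (1 - w * of_real t)"
    using continuous_attains_inf[of "{0..(2 * real d)\<^sup>2}" "\<lambda>t. norm (1 - w * of_real t)"] by auto
  have "1 - w * of_real t0 \<noteq> 0"
  proof
    assume "1 - w * of_real t0 = 0"
    then have e: "w * of_real t0 = 1" by simp
    then have "Im (w * of_real t0) = 0" "Re (w * of_real t0) = 1" by simp_all
    then have i: "Im w * t0 = 0" and r: "Re w * t0 = 1" by simp_all
    have "t0 > 0" using r t0(1) by (cases "t0 = 0") auto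
    with i assms have "Re w < 1 / (2 * real d)\<^sup>2" by (simp add: cut_plane_def crit_def)
    then have "Re w * t0 < 1 / (2 * real d)\<^sup>2 * t0" using \<open>t0 > 0\<close> by (rule mult_strict_right_mono)
    also have "\<dots> \<le> 1" using t0(1) \<open>t0 > 0\<close> by (simp add: divide_simps)
    finally show False using r by simp
  qed
  then show ?thesis using t0(2) by (intro exI[of _ "norm (1 - w * of_real t0)"]) auto
qed

lemma Green_holomorphic: "Green d holomorphic_on cut_plane d"
proof -
  have "(\<lambda>w. \<integral>\<theta>. of_real 1 / (of_real 1 - w * of_real ((step_sum d \<theta>)\<^sup>2)) \<partial>angles d) holomorphic_on cut_plane d"
  proof (rule cauchy_transform_holomorphic[where Q = "(2 * real d)\<^sup>2"])
    show "prob_space (angles d)" by (rule prob_space_angles)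
    show "\<bar>(step_sum d \<theta>)\<^sup>2\<bar> \<le> (2 * real d)\<^sup>2" for \<theta> using step_sum_sq[of d \<theta>] by simp
    show "\<exists>\<delta>>0. \<forall>\<theta>\<in>space (angles d). 1 \<noteq> (0::real) \<longrightarrow> \<delta> \<le> norm (of_real 1 - w * of_real ((step_sum d \<theta>)\<^sup>2))"
      if "w \<in> cut_plane d" for w
      using cut_plane_separation[OF that] step_sum_sq[of d] by (auto simp del: of_real_power)
  qed (auto intro: open_cut_plane)
  then show ?thesis by (simp add: Green_def[abs_def])
qed

text \<open>
  Multiply numerator and denominator of the integrand by the conjugate of the denominator. If the
  integral vanishes, then \<open>\<alpha> = cnj w * \<beta>\<close>, where \<open>\<alpha>\<close> and \<open>\<beta>\<close> are the means of a positive weight \<open>c\<close> and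
  of \<open>(step_sum d \<theta>)\<^sup>2 c\<close>. So \<open>w\<close> is real, and \<open>w = \<alpha> / \<beta> \<ge> 1/(2d)\<^sup>2\<close> lies on the cut.
\<close>

lemma Green_nonzero:
  assumes d: "d \<ge> 1" and w: "w \<in> cut_plane d"
  shows "Green d w \<noteq> 0"
proof
  assume G0: "Green d w = 0"
  obtain \<delta> where \<delta>: "\<delta> > 0" "\<And>t. t \<in> {0..(2 * real d)\<^sup>2} \<Longrightarrow> \<delta> \<le> norm (1 - w * of_real t)"
    using cut_plane_separation[OF w] by blast
  define t where "t = (\<lambda>\<theta>. (step_sum d \<theta>)\<^sup>2)"
  have t: "0 \<le> t \<theta>" "t \<theta> \<le> (2 * real d)\<^sup>2" for \<theta> using step_sum_sq[of d \<theta>] by (auto simp: t_def)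
  have [measurable]: "t \<in> borel_measurable (angles d)" unfolding t_def[abs_def] by measurable
  define c where "c = (\<lambda>\<theta>. 1 / (norm (1 - w * of_real (t \<theta>)))\<^sup>2)"
  have [measurable]: "c \<in> borel_measurable (angles d)" unfolding c_def[abs_def] by measurable
  have low: "\<delta> \<le> norm (1 - w * of_real (t \<theta>))" for \<theta> using \<delta>(2) t by auto
  have c_up: "c \<theta> \<le> 1 / \<delta>\<^sup>2" for \<theta>
    unfolding c_def using low[of \<theta>] \<delta>(1) by (intro frac_le power_mono) auto
  define K where "K = 1 + norm w * (2 * real d)\<^sup>2"
  have K: "K > 0" by (auto simp: K_def intro!: add_pos_nonneg)
  have c_low: "1 / K\<^sup>2 \<le> c \<theta>" for \<theta>
  proof -
    have "norm (1 - w * of_real (t \<theta>)) \<le> 1 + norm w * t \<theta>"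
      using norm_triangle_ineq4[of 1 "w * of_real (t \<theta>)"] t(1)[of \<theta>] by (simp add: norm_mult)
    also have "\<dots> \<le> K" unfolding K_def using t by (intro add_left_mono mult_left_mono) auto
    finally show ?thesis unfolding c_def using low[of \<theta>] \<delta>(1) by (intro frac_le power_mono) auto
  qed
  have c0: "0 \<le> c \<theta>" for \<theta> by (simp add: c_def)
  have ic: "integrable (angles d) c"
    by (rule anglesP.integrable_const_bound[where B = "1 / \<delta>\<^sup>2"]) (use c_up c0 in auto)
  have itc: "integrable (angles d) (\<lambda>\<theta>. t \<theta> * c \<theta>)"
    by (rule anglesP.integrable_const_bound[where B = "(2 * real d)\<^sup>2 * (1 / \<delta>\<^sup>2)"])
       (use c_up c0 t in \<open>auto intro!: AE_I2 mult_mono simp: abs_mult simp del: times_divide_eq_right\<close>)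
  define \<alpha> where "\<alpha> = (\<integral>\<theta>. c \<theta> \<partial>angles d)"
  define \<beta> where "\<beta> = (\<integral>\<theta>. t \<theta> * c \<theta> \<partial>angles d)"
  have "\<alpha> \<ge> (\<integral>\<theta>. 1 / K\<^sup>2 \<partial>angles d)" unfolding \<alpha>_def by (intro integral_mono ic c_low) auto
  then have "\<alpha> \<ge> 1 / K\<^sup>2" by (simp add: anglesP.prob_space)
  moreover have "1 / K\<^sup>2 > 0" using K by simp
  ultimately have \<alpha>: "\<alpha> > 0" by linarith
  have \<beta>0: "\<beta> \<ge> 0" unfolding \<beta>_def using t c0 by (intro integral_nonneg_AE) auto
  have "\<beta> \<le> (\<integral>\<theta>. (2 * real d)\<^sup>2 * c \<theta> \<partial>angles d)"
    unfolding \<beta>_def using t c0 by (intro integral_mono itc ic integrable_mult_right mult_right_mono) auto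
  then have \<beta>1: "\<beta> \<le> (2 * real d)\<^sup>2 * \<alpha>" by (simp add: \<alpha>_def)
  have "Green d w = (\<integral>\<theta>. of_real (c \<theta>) - cnj w * of_real (t \<theta> * c \<theta>) \<partial>angles d)"
    unfolding Green_def
  proof (intro Bochner_Integration.integral_cong refl)
    fix \<theta>
    define u where "u = 1 - w * of_real (t \<theta>)"
    have "u \<noteq> 0" using low[of \<theta>] \<delta>(1) by (auto simp: u_def)
    have "1 / u = cnj u / of_real ((norm u)\<^sup>2)"
      using \<open>u \<noteq> 0\<close> complex_norm_square[of u] by (simp add: field_simps)
    also have "\<dots> = cnj u * of_real (c \<theta>)" by (simp add: c_def u_def[symmetric])
    finally show "1 / (1 - w * of_real ((step_sum d \<theta>)\<^sup>2)) = of_real (c \<theta>) - cnj w * of_real (t \<theta> * c \<theta>)"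
      by (simp add: u_def t_def algebra_simps)
  qed
  also have "\<dots> = of_real \<alpha> - cnj w * of_real \<beta>"
    using ic itc by (simp add: \<alpha>_def \<beta>_def del: of_real_mult)
  finally have eq: "of_real \<alpha> = cnj w * of_real \<beta>" using G0 by simp
  then have "Re (of_real \<alpha>) = Re (cnj w * of_real \<beta>)" "Im (of_real \<alpha>) = Im (cnj w * of_real \<beta>)" by simp_all
  then have r: "\<alpha> = Re w * \<beta>" and i: "Im w * \<beta> = 0" by simp_all
  then have b: "\<beta> > 0" using \<alpha> \<beta>0 by (cases "\<beta> = 0") auto
  then have "Re w < crit d" using i w by (simp add: cut_plane_def)
  then have "\<alpha> < crit d * \<beta>" unfolding r using b by (rule mult_strict_right_mono)
  also have "\<dots> \<le> crit d * ((2 * real d)\<^sup>2 * \<alpha>)" using \<beta>1 crit_pos[OF d] by (intro mult_left_mono) auto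
  also have "\<dots> = \<alpha>" using d by (simp add: crit_def)
  finally show False by simp
qed

lemma Green_power_series:
  assumes d: "d \<ge> 1" and w: "norm w < crit d"
  shows "(\<lambda>n. fps_nth (A_series d) n * w ^ n) sums Green d w"
proof -
  define \<rho> where "\<rho> = norm w * (2 * real d)\<^sup>2"
  have \<rho>: "0 \<le> \<rho>" "\<rho> < 1" using w d by (auto simp: \<rho>_def crit_def field_simps)
  define f where "f = (\<lambda>n \<theta>. w ^ n * complex_of_real (step_sum d \<theta> ^ (2 * n)))"
  have nf: "norm (f n \<theta>) \<le> \<rho> ^ n" for n \<theta>
  proof -
    have "norm (f n \<theta>) = (norm w * (step_sum d \<theta>)\<^sup>2) ^ n"
      by (simp add: f_def norm_mult norm_power power_mult power_mult_distrib)
    also have "\<dots> \<le> \<rho> ^ n"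
      unfolding \<rho>_def by (rule power_mono, rule mult_left_mono, rule step_sum_sq) auto
    finally show ?thesis .
  qed
  have sum\<rho>: "summable (\<lambda>n. \<rho> ^ n)" using \<rho> by (intro summable_geometric) auto
  have int: "integrable (angles d) (f n)" for n
    by (rule anglesP.integrable_const_bound[where B = "\<rho> ^ n"]) (use nf in \<open>auto simp: f_def[abs_def]\<close>)
  have 1: "AE \<theta> in angles d. summable (\<lambda>n. norm (f n \<theta>))"
    using nf by (intro AE_I2 summable_comparison_test'[OF sum\<rho>]) auto
  have 2: "summable (\<lambda>n. \<integral>\<theta>. norm (f n \<theta>) \<partial>angles d)"
  proof (rule summable_comparison_test'[OF sum\<rho>])
    fix n
    have "(\<integral>\<theta>. norm (f n \<theta>) \<partial>angles d) \<le> (\<integral>\<theta>. \<rho> ^ n \<partial>angles d)"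
      using nf int by (intro integral_mono) auto
    then show "norm (\<integral>\<theta>. norm (f n \<theta>) \<partial>angles d) \<le> \<rho> ^ n" by (simp add: anglesP.prob_space)
  qed
  have "(\<lambda>n. \<integral>\<theta>. f n \<theta> \<partial>angles d) sums (\<integral>\<theta>. (\<Sum>n. f n \<theta>) \<partial>angles d)"
    using int 1 2 by (rule sums_integral)
  moreover have "(\<integral>\<theta>. f n \<theta> \<partial>angles d) = fps_nth (A_series d) n * w ^ n" for n
    unfolding f_def integral_mult_right_zero integral_complex_of_real closed_walks_moment
    by (simp add: A_series_def)
  moreover have "(\<Sum>n. f n \<theta>) = 1 / (1 - w * of_real ((step_sum d \<theta>)\<^sup>2))" for \<theta>
  proof -
    have "norm (w * of_real ((step_sum d \<theta>)\<^sup>2)) \<le> \<rho>" using nf[of 1 \<theta>] by (simp add: f_def)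
    then have "(\<lambda>n. (w * of_real ((step_sum d \<theta>)\<^sup>2)) ^ n) sums (1 / (1 - w * of_real ((step_sum d \<theta>)\<^sup>2)))"
      using \<rho> by (intro geometric_sums) auto
    then show ?thesis by (simp add: sums_iff f_def power_mult_distrib power_mult)
  qed
  ultimately show ?thesis by (simp add: Green_def)
qed

lemma radius_A_ge: "d \<ge> 1 \<Longrightarrow> fps_conv_radius (A_series d) \<ge> ereal (crit d)"
  unfolding fps_conv_radius_def
proof (rule conv_radius_geI_ex)
  fix r assume d: "d \<ge> 1" and r: "0 < r" "ereal r < ereal (crit d)"
  show "\<exists>z. norm z = r \<and> summable (\<lambda>n. fps_nth (A_series d) n * z ^ n)"
    using Green_power_series[OF d, of "of_real r"] r by (intro exI[of _ "of_real r"]) (auto simp: sums_iff)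
qed

lemma eval_A: "d \<ge> 1 \<Longrightarrow> norm w < crit d \<Longrightarrow> eval_fps (A_series d) w = Green d w"
  using Green_power_series by (simp add: eval_fps_def sums_iff)

lemma ball_subset_cut_plane: "d \<ge> 1 \<Longrightarrow> ball 0 (crit d) \<subseteq> cut_plane d"
  using le_less_trans[OF complex_Re_le_cmod] by (auto simp: cut_plane_def)

lemma eval_B:
  assumes d: "d \<ge> 1" and rB: "fps_conv_radius (B_series d) \<ge> ereal (crit d)" and w: "norm w < crit d"
  shows "eval_fps (B_series d) w = 1 - 1 / Green d w"
proof -
  have rA: "ereal (norm w) < fps_conv_radius (A_series d)" using radius_A_ge[OF d] w
    by (meson ereal_less(2) less_ereal.simps(1) less_le_trans)
  have rB': "ereal (norm w) < fps_conv_radius (B_series d)" using rB w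
    by (meson less_ereal.simps(1) less_le_trans)
  have r1: "ereal (norm w) < fps_conv_radius (1 - B_series d)"
    using fps_conv_radius_diff[of 1 "B_series d"] rB' by (auto simp: min_def split: if_splits intro: less_le_trans)
  have "eval_fps ((1 - B_series d) * A_series d) w = 1" by (simp add: renewal_equation)
  then have "(1 - eval_fps (B_series d) w) * Green d w = 1"
    using rA rB' r1 w d by (simp add: eval_fps_mult eval_fps_diff eval_A)
  moreover have "Green d w \<noteq> 0" using Green_nonzero[OF d] ball_subset_cut_plane[OF d] w by (auto simp: subset_iff)
  ultimately show ?thesis by (simp add: field_simps)
qed

text \<open>
  The continuation \<open>1 - 1 / Green d\<close> lives on the whole cut plane, which after rescaling contains every
  \<open>\<Delta>\<close>-domain; the choice of \<open>\<eta> = 1\<close> and \<open>\<phi> = 1\<close> is arbitrary.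
\<close>

lemma Delta_analytic_B:
  assumes d: "d \<ge> 1" and R: "fps_conv_radius (B_series d) = ereal (crit d)"
  shows "Delta_analytic (B_series d)"
proof -
  define \<zeta> where "\<zeta> = complex_of_real (crit d)"
  have z: "\<zeta> \<noteq> 0" "norm \<zeta> = crit d" using crit_pos[OF d] by (auto simp: \<zeta>_def)
  define f where "f = Abs_fps (\<lambda>n. \<zeta> ^ n * fps_nth (B_series d) n)"
  have rad: "fps_conv_radius f = 1"
  proof -
    have "conv_radius (\<lambda>n. \<zeta> ^ n * fps_nth (B_series d) n) = conv_radius (fps_nth (B_series d)) / ereal (norm \<zeta>)"
      using z by (intro conv_radius_mult_power) auto
    also have "\<dots> = ereal (crit d) / ereal (crit d)" using R z by (simp add: fps_conv_radius_def)
    also have "\<dots> = 1" using crit_pos[OF d] by (simp add: one_ereal_def)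
    finally show ?thesis by (simp add: fps_conv_radius_def f_def fps_nth_Abs_fps[abs_def])
  qed
  define g where "g = (\<lambda>w. 1 - 1 / Green d (\<zeta> * w))"
  have sub: "\<zeta> * w \<in> cut_plane d" if "w \<in> Delta_domain 1 1" for w
  proof -
    have "Re w < 1" if im: "Im w = 0"
    proof (rule ccontr)
      assume "\<not> Re w < 1"
      then have "w - 1 = of_real (Re w - 1)" "Re w - 1 \<ge> 0" using im by (auto simp: complex_eq_iff)
      then have "Arg (w - 1) = 0" by (metis Arg_eq_0 Reals_of_real Re_complex_of_real Arg_zero)
      then show False using \<open>w \<in> Delta_domain 1 1\<close> by (simp add: Delta_domain_def)
    qed
    then show ?thesis using crit_pos[OF d] by (auto simp: cut_plane_def \<zeta>_def)
  qed
  have opn: "open ((\<lambda>w. \<zeta> * w) -` cut_plane d)"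
    by (intro open_vimage open_cut_plane continuous_intros)
  have "g holomorphic_on (\<lambda>w. \<zeta> * w) -` cut_plane d"
    unfolding g_def
    by (intro holomorphic_intros holomorphic_on_compose_gen[OF _ Green_holomorphic, unfolded o_def])
       (auto simp: Green_nonzero[OF d])
  then have "g analytic_on (\<lambda>w. \<zeta> * w) -` cut_plane d" using opn by (simp add: analytic_on_open)
  then have "g analytic_on Delta_domain 1 1" by (rule analytic_on_subset) (use sub in auto)
  moreover have "g w = eval_fps f w" if "w \<in> ball 0 1" for w
  proof -
    have "eval_fps f w = eval_fps (B_series d) (\<zeta> * w)"
      by (simp add: eval_fps_def f_def power_mult_distrib mult_ac)
    also have "\<dots> = g w" unfolding g_def
      using that z crit_pos[OF d] R by (intro eval_B d) (auto simp: norm_mult)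
    finally show ?thesis by simp
  qed
  ultimately have "Delta_analytic_unit f"
    unfolding Delta_analytic_unit_def using rad pi_gt3 by (intro conjI exI[of _ 1] exI[of _ g]) auto
  then show ?thesis unfolding Delta_analytic_def f_def using z by blast
qed

section \<open>Recurrence and transience\<close>

definition beta :: "nat \<Rightarrow> nat \<Rightarrow> real" where
  "beta d n = first_return_prob d (2 * n)"

lemma beta_nonneg: "0 \<le> beta d n"
  by (simp add: beta_def first_return_prob_def)

lemma beta_sums: "d \<ge> 1 \<Longrightarrow> beta d sums return_prob d"
proof -
  assume d: "d \<ge> 1"
  have "(\<lambda>n. first_return_prob d (2 * n)) sums return_prob d \<longleftrightarrow> first_return_prob d sums return_prob d"
  proof (rule sums_mono_reindex)
    show "strict_mono (\<lambda>n::nat. 2 * n)" by (simp add: strict_mono_def)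
    fix n assume "n \<notin> range (\<lambda>n::nat. 2 * n)"
    then have "odd n" by (auto elim: evenE)
    then have "first_return_walks d n = {}" using first_return_walks_even by blast
    then show "first_return_prob d n = 0" by (simp add: first_return_prob_def)
  qed
  then show ?thesis using first_return_prob_sums[OF d] by (simp add: beta_def[abs_def])
qed

lemma B_term_crit: "fps_nth (B_series d) n * of_real (crit d) ^ n = of_real (beta d n)"
proof -
  have "crit d ^ n = 1 / real (2 * d) ^ (2 * n)"
    unfolding crit_def power_one_over by (simp add: power_mult power_mult_distrib)
  then have "fps_nth (B_series d) n * of_real (crit d) ^ n = fps_nth (B_series d) n * of_real (1 / real (2 * d) ^ (2 * n))"
    by (simp only: of_real_power[symmetric])
  also have "\<dots> = of_real (beta d n)"
    by (simp add: B_series_def beta_def first_return_prob_def)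
  finally show ?thesis .
qed

lemma return_prob_le_1: "d \<ge> 1 \<Longrightarrow> return_prob d \<le> 1"
  unfolding return_prob_def simple_random_walk_def
  by (intro prob_space.prob_le_1 prob_space.prob_space_stream_space measure_pmf.prob_space_axioms)

lemma radius_B_ge: "d \<ge> 1 \<Longrightarrow> fps_conv_radius (B_series d) \<ge> ereal (crit d)"
proof -
  assume d: "d \<ge> 1"
  have "summable (\<lambda>n. fps_nth (B_series d) n * of_real (crit d) ^ n)"
    unfolding B_term_crit using beta_sums[OF d] by (auto simp: sums_iff summable_of_real)
  then have "conv_radius (fps_nth (B_series d)) \<ge> norm (complex_of_real (crit d))"
    by (rule conv_radius_geI)
  then show ?thesis using crit_pos[OF d] by (simp add: fps_conv_radius_def)
qed

lemma B_term_norm: "d \<ge> 1 \<Longrightarrow> norm w = crit d \<Longrightarrow> norm (fps_nth (B_series d) n * w ^ n) = beta d n"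
proof -
  assume d: "d \<ge> 1" and w: "norm w = crit d"
  have "norm (fps_nth (B_series d) n * w ^ n) = norm (fps_nth (B_series d) n * of_real (crit d) ^ n)"
    using crit_pos[OF d] by (simp add: norm_mult norm_power w)
  then show ?thesis unfolding B_term_crit using beta_nonneg by simp
qed

text \<open>
  On the critical circle the terms are dominated by the first-return probabilities.
\<close>

lemma B_uniformly_convergent:
  assumes d: "d \<ge> 1"
  shows "uniformly_convergent_on (sphere 0 (crit d)) (\<lambda>N w. \<Sum>n<N. fps_nth (B_series d) n * w ^ n)"
  unfolding uniformly_convergent_on_def
proof (rule exI, rule Weierstrass_m_test)
  show "norm (fps_nth (B_series d) n * w ^ n) \<le> beta d n" if "w \<in> sphere 0 (crit d)" for n w
    using B_term_norm[OF d, of w n] that by simp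
  show "summable (beta d)" using beta_sums[OF d] by (simp add: sums_iff)
qed

lemma eval_B_crit: "d \<ge> 1 \<Longrightarrow> eval_fps (B_series d) (of_real (crit d)) = of_real (return_prob d)"
  using sums_of_real[OF beta_sums, of d, where 'a = complex] by (simp add: eval_fps_def B_term_crit sums_iff)

lemma m_term_0: "m_term d 0 = 1"
  by (simp add: m_term_def closed_walks_0)

lemma m_term_nonneg: "0 \<le> m_term d n"
  by (simp add: m_term_def)

lemma m_term_renewal:
  assumes d: "d \<ge> 1" and n: "n > 0"
  shows "m_term d n = (\<Sum>k\<le>n. beta d k * m_term d (n - k))"
proof -
  have "m_term d n = (\<Sum>k\<le>n. real ((if k = 0 then 0 else card (first_return_walks d (2 * k))) * card (closed_walks d (2 * (n - k))))) / real (2 * d) ^ (2 * n)"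
    unfolding m_term_def using renewal_even[OF n, of d] by (simp only: of_nat_sum)
  also have "\<dots> = (\<Sum>k\<le>n. beta d k * m_term d (n - k))"
    unfolding sum_divide_distrib
  proof (rule sum.cong)
    fix k assume "k \<in> {..n}"
    then have "2 * n = 2 * k + 2 * (n - k)" by simp
    then have eq: "real (2 * d) ^ (2 * n) = real (2 * d) ^ (2 * k) * real (2 * d) ^ (2 * (n - k))"
      using power_add[of "real (2 * d)" "2 * k" "2 * (n - k)"] by (simp only:)
    have gen: "real ((if k = 0 then 0 else x) * y) / (P * Q) = (if 2 * k = 0 then 0 else real x / P) * (real y / Q)"
      for x y :: nat and P Q :: real by simp
    show "real ((if k = 0 then 0 else card (first_return_walks d (2 * k))) * card (closed_walks d (2 * (n - k)))) / real (2 * d) ^ (2 * n)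
      = beta d k * m_term d (n - k)"
      unfolding eq beta_def first_return_prob_def m_term_def by (rule gen)
  qed simp
  finally show ?thesis .
qed

text \<open>
  By the renewal equation the expected numbers \<open>a\<close> of visits before a given time satisfy \<open>a \<le> 1 + p a\<close>, where
  \<open>p\<close> is the probability of ever returning. If \<open>p < 1\<close>, they are bounded by \<open>1 / (1 - p)\<close>.
\<close>

lemma recurrent_if_not_summable:
  assumes d: "d \<ge> 1" and div: "\<not> summable (m_term d)"
  shows "return_prob d = 1"
proof (rule ccontr)
  assume "return_prob d \<noteq> 1"
  then have R: "return_prob d < 1" using return_prob_le_1[OF d] by simp
  have bs: "summable (beta d)" "suminf (beta d) = return_prob d" using beta_sums[OF d] by (auto simp: sums_iff)
  have "summable (m_term d)"
  proof (rule summableI_nonneg_bounded[where x = "1 / (1 - return_prob d)"])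
    fix N
    define a where "a = (\<Sum>n<N. m_term d n)"
    have a0: "a \<ge> 0" unfolding a_def by (intro sum_nonneg m_term_nonneg)
    have "a \<le> (\<Sum>n<N. (if n = 0 then 1 else 0) + (\<Sum>k\<le>n. beta d k * m_term d (n - k)))"
      unfolding a_def
    proof (rule sum_mono)
      fix n show "m_term d n \<le> (if n = 0 then 1 else 0) + (\<Sum>k\<le>n. beta d k * m_term d (n - k))"
        using m_term_renewal[OF d, of n] by (cases "n = 0") (auto simp: m_term_0 beta_nonneg)
    qed
    also have "\<dots> = (\<Sum>n<N. if n = 0 then 1 else 0) + (\<Sum>n<N. \<Sum>k\<le>n. beta d k * m_term d (n - k))"
      by (rule sum.distrib)
    also have "(\<Sum>n<N. if n = 0 then 1 else (0::real)) \<le> 1" by (simp add: sum.If_cases)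
    also have "(\<Sum>n<N. \<Sum>k\<le>n. beta d k * m_term d (n - k)) \<le> (\<Sum>k<N. beta d k) * a"
    proof -
      have "(\<Sum>n<N. \<Sum>k\<le>n. beta d k * m_term d (n - k)) = (\<Sum>(i, j)\<in>{(i, j). i + j < N}. beta d i * m_term d j)"
        by (rule sum.triangle_reindex[symmetric])
      also have "\<dots> \<le> (\<Sum>(i, j)\<in>{..<N} \<times> {..<N}. beta d i * m_term d j)"
        by (rule sum_mono2) (auto simp: beta_nonneg m_term_nonneg)
      also have "\<dots> = (\<Sum>k<N. beta d k) * a" by (simp add: a_def sum_product sum.cartesian_product)
      finally show ?thesis .
    qed
    also have "(\<Sum>k<N. beta d k) * a \<le> return_prob d * a"
      using sum_le_suminf[OF bs(1), of "{..<N}"] beta_nonneg bs(2) a0 by (intro mult_right_mono) auto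
    finally have "a * (1 - return_prob d) \<le> 1" by (simp add: algebra_simps)
    then show "(\<Sum>n<N. m_term d n) \<le> 1 / (1 - return_prob d)"
      using R by (simp add: a_def pos_le_divide_eq)
  qed (rule m_term_nonneg)
  then show False using div by simp
qed

text \<open>
  The Cauchy product of the two absolutely convergent series evaluates the renewal equation at the
  critical point.
\<close>

lemma return_prob_transient:
  assumes d: "d \<ge> 1" and s: "summable (m_term d)"
  shows "1 - 1 / m_const d = return_prob d"
proof -
  have bs: "summable (\<lambda>n. norm (beta d n))" "suminf (beta d) = return_prob d"
    using beta_sums[OF d] beta_nonneg by (auto simp: sums_iff)
  have s': "summable (\<lambda>n. norm (m_term d n))" using s m_term_nonneg by simp
  have c: "(\<lambda>n. \<Sum>k\<le>n. beta d k * m_term d (n - k)) sums (return_prob d * m_const d)"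
    using Cauchy_product_sums[OF bs(1) s'] bs(2) by (simp add: m_const_def)
  have "(\<lambda>n. (if n = 0 then 1 else 0) + (\<Sum>k\<le>n. beta d k * m_term d (n - k))) sums (1 + return_prob d * m_const d)"
    using sums_single[of 0 "\<lambda>_. 1::real"] c by (intro sums_add) auto
  moreover have "(if n = 0 then 1 else 0) + (\<Sum>k\<le>n. beta d k * m_term d (n - k)) = m_term d n" for n
    using m_term_renewal[OF d, of n] by (cases "n = 0") (auto simp: m_term_0 beta_def first_return_prob_def)
  ultimately have eq: "m_const d = 1 + return_prob d * m_const d" by (simp add: m_const_def sums_iff)
  have "m_const d \<noteq> 0" using eq by auto
  then show ?thesis using eq by (simp add: field_simps)
qed

lemma m_term_integral: "d \<ge> 1 \<Longrightarrow> (\<integral>\<^sup>+\<theta>. ennreal ((1 - Gap d \<theta> / real d) ^ (2 * n)) \<partial>angles d) = ennreal (m_term d n)"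
proof -
  assume d: "d \<ge> 1"
  have e: "(1 - Gap d \<theta> / real d) ^ (2 * n) = step_sum d \<theta> ^ (2 * n) / real (2 * d) ^ (2 * n)" for \<theta>
  proof -
    have "1 - Gap d \<theta> / real d = step_sum d \<theta> / real (2 * d)" using d by (simp add: step_sum_def field_simps)
    then show ?thesis by (simp only: power_divide)
  qed
  have "(\<integral>\<^sup>+\<theta>. ennreal (step_sum d \<theta> ^ (2 * n) / real (2 * d) ^ (2 * n)) \<partial>angles d) =
      ennreal (\<integral>\<theta>. step_sum d \<theta> ^ (2 * n) / real (2 * d) ^ (2 * n) \<partial>angles d)"
  proof (rule nn_integral_eq_integral)
    show "integrable (angles d) (\<lambda>\<theta>. step_sum d \<theta> ^ (2 * n) / real (2 * d) ^ (2 * n))"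
    proof (rule anglesP.integrable_const_bound[where B = 1])
      show "AE \<theta> in angles d. norm (step_sum d \<theta> ^ (2 * n) / real (2 * d) ^ (2 * n)) \<le> 1"
      proof (rule AE_I2)
        fix \<theta>
        have "\<bar>step_sum d \<theta>\<bar> ^ (2 * n) \<le> (2 * real d) ^ (2 * n)" using step_sum_bound[of d \<theta>] by (intro power_mono) auto
        then show "norm (step_sum d \<theta> ^ (2 * n) / real (2 * d) ^ (2 * n)) \<le> 1"
          using d by (simp add: power_abs divide_le_eq)
      qed
    qed measurable
  qed (auto simp: power_mult)
  also have "\<dots> = ennreal (m_term d n)" by (simp add: closed_walks_moment m_term_def)
  finally show ?thesis by (simp add: e)
qed

lemma sum_m_term_integral:
  "d \<ge> 1 \<Longrightarrow> (\<Sum>n. ennreal (m_term d n)) = (\<integral>\<^sup>+\<theta>. (\<Sum>n. ennreal ((1 - Gap d \<theta> / real d) ^ (2 * n))) \<partial>angles d)"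
  by (subst nn_integral_suminf) (auto simp: m_term_integral)

text \<open>
  A geometric series with ratio \<open>(1 - x/d)\<^sup>2\<close>, whose sum is split into partial fractions. The two poles
  \<open>x = 0\<close> and \<open>x = 2 d\<close> are exchanged by the symmetry of the law of the gap.
\<close>

lemma geometric_gap:
  assumes d: "d \<ge> 1" and x: "0 < x" "x < 2 * real d"
  shows "(\<Sum>n. ennreal ((1 - x / real d) ^ (2 * n))) = ennreal (real d / 2 * (1 / x + 1 / (2 * real d - x)))"
proof -
  define u where "u = x / real d"
  have u: "0 < u" "u < 2" using x d by (auto simp: u_def field_simps)
  have "\<bar>1 - u\<bar> < 1" using u by (simp add: abs_if)
  then have t: "0 \<le> (1 - u)\<^sup>2" "(1 - u)\<^sup>2 < 1" by (auto simp: abs_square_less_1)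
  have "(\<lambda>n. ((1 - u)\<^sup>2) ^ n) sums (1 / (1 - (1 - u)\<^sup>2))"
    using t by (intro geometric_sums) auto
  then have "(\<Sum>n. ennreal (((1 - u)\<^sup>2) ^ n)) = ennreal (1 / (1 - (1 - u)\<^sup>2))"
    by (intro suminf_ennreal_eq) auto
  moreover have "1 / (1 - (1 - u)\<^sup>2) = real d / 2 * (1 / x + 1 / (2 * real d - x))"
  proof -
    have xu: "x = u * real d" using d by (simp add: u_def)
    have "1 - (1 - u)\<^sup>2 = u * (2 - u)" by (simp add: power2_eq_square algebra_simps)
    moreover have "2 * real d - x = real d * (2 - u)" by (simp add: xu algebra_simps)
    moreover have "1 / (u * (2 - u)) = real d / 2 * (1 / (u * real d) + 1 / (real d * (2 - u)))"
      using u d by (simp add: divide_simps) (simp add: algebra_simps)?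
    ultimately show ?thesis by (simp only: xu[symmetric])
  qed
  moreover have "(1 - x / real d) ^ (2 * n) = ((1 - u)\<^sup>2) ^ n" for n by (simp add: u_def power_mult)
  ultimately show ?thesis by (simp only:)
qed

text \<open>
  The sum is at most a multiple of the mean of \<open>1 / Gap d\<close>. For \<open>d \<ge> 3\<close> the density of the gap is at
  most a multiple of \<open>sqrt x\<close> near \<open>0\<close>, so that this mean is finite.
\<close>

lemma summable_m_term:
  assumes d: "d \<ge> 3" shows "summable (m_term d)"
proof -
  obtain n where n: "d = Suc n" "n \<ge> 2" using d by (cases d) auto
  have d1: "d \<ge> 1" using d by simp
  (* with value \<open>\<top>\<close> at 0, so that the bound below holds at the poles as well *)
  define D where "D = (\<lambda>x::real. ennreal (real d) / ennreal x)"
  have Dm [measurable]: "D \<in> borel_measurable borel" unfolding D_def by measurable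
  have D_real: "D x = ennreal (real d / x)" if "x > 0" for x using that by (simp add: D_def divide_ennreal)
  have D_top: "D x = \<top>" if "x \<le> 0" for x using that d by (simp add: D_def ennreal_neg ennreal_divide_zero)
  have le: "(\<Sum>k. ennreal ((1 - Gap d \<theta> / real d) ^ (2 * k))) \<le> D (Gap d \<theta>) + D (2 * real d - Gap d \<theta>)" for \<theta>
  proof (cases "0 < Gap d \<theta> \<and> Gap d \<theta> < 2 * real d")
    case True
    have half: "real d / 2 * (1 / a + 1 / b) \<le> real d / a + real d / b" if "a > 0" "b > 0" for a b :: real
    proof -
      have "real d / 2 * (1 / a + 1 / b) \<le> real d * (1 / a + 1 / b)" using that by (intro mult_right_mono) auto
      then show ?thesis by (simp add: distrib_left)
    qed
    have "real d / 2 * (1 / Gap d \<theta> + 1 / (2 * real d - Gap d \<theta>)) \<le> real d / Gap d \<theta> + real d / (2 * real d - Gap d \<theta>)"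
      using True by (intro half) auto
    then show ?thesis using True
      by (subst geometric_gap[OF d1]) (auto simp: D_real ennreal_plus[symmetric] simp del: ennreal_plus)
  next
    case False
    then show ?thesis using D_top[of "Gap d \<theta>"] D_top[of "2 * real d - Gap d \<theta>"] by auto
  qed
  define C where "C = (1 / pi) ^ Suc n * phi n 1 * real d"
  have C0: "C \<ge> 0" using phi_pos[of 1 n] by (simp add: C_def)
  have small: "(\<integral>\<^sup>+x. (D x * indicator {..<1} x) * ennreal (gap_density n x) \<partial>lborel) \<le> ennreal (2 * C)"
  proof -
    have "(\<integral>\<^sup>+x. (D x * indicator {..<1} x) * ennreal (gap_density n x) \<partial>lborel) \<le> (\<integral>\<^sup>+x. ennreal (C * (1 / sqrt x)) * indicator {0\<^sup>2..1\<^sup>2} x \<partial>lborel)"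
    proof (rule nn_integral_mono)
      fix x :: real
      show "(D x * indicator {..<1} x) * ennreal (gap_density n x) \<le> ennreal (C * (1 / sqrt x)) * indicator {0\<^sup>2..1\<^sup>2} x"
      proof (cases "0 < x \<and> x < 1")
        case True
        then have x: "0 < x" "x < 1" by auto
        define S where "S = sqrt x"
        have S: "0 < S" "S \<le> 1" "x = S * S" using x by (auto simp: S_def)
        have p: "phi n x \<le> phi n 1" "0 < phi n x" using phi_mono[of x 1 n] phi_pos[of x n] x by auto
        have "S ^ Suc n \<le> S ^ 3" using S n by (intro power_decreasing) auto
        then have "real d / x * ((1 / pi) ^ Suc n * S ^ Suc n / x * phi n x) \<le> real d / x * ((1 / pi) ^ Suc n * S ^ 3 / x * phi n 1)"
          using p x S by (intro mult_left_mono mult_mono divide_right_mono) auto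
        also have "\<dots> = C * (S ^ 3 / (x * x))" by (simp add: C_def field_simps)
        also have "S ^ 3 / (x * x) = 1 / S" using S by (simp add: S(3) power3_eq_cube)
        finally show ?thesis using x S(1)
          by (auto simp: D_real gap_density_def ennreal_mult'[symmetric] S_def[symmetric] intro!: ennreal_leI)
      qed (auto simp: gap_density_def split: split_indicator)
    qed
    also have "\<dots> = (\<integral>\<^sup>+s. ennreal (C * (1 / sqrt (s\<^sup>2))) * ennreal (2 * s) * indicator {0..1} s \<partial>lborel)"
      by (rule nn_integral_substitution_aux) (auto intro!: derivative_eq_intros continuous_intros)
    also have "\<dots> \<le> (\<integral>\<^sup>+s. ennreal (2 * C) * indicator {0..1} s \<partial>(lborel :: real measure))"
    proof (rule nn_integral_mono)
      fix s :: real
      show "ennreal (C * (1 / sqrt (s\<^sup>2))) * ennreal (2 * s) * indicator {0..1} s \<le> ennreal (2 * C) * indicator {0..1} s"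
        using C0 by (cases "s > 0") (auto simp: ennreal_mult'[symmetric] split: split_indicator)
    qed
    also have "\<dots> = ennreal (2 * C)" by (simp add: nn_integral_cmult_indicator)
    finally show ?thesis .
  qed
  have DG: "(\<integral>\<^sup>+\<theta>. D (Gap d \<theta>) \<partial>angles d) \<le> ennreal (2 * C) + ennreal (real d)"
  proof -
    have "(\<integral>\<^sup>+\<theta>. D (Gap d \<theta>) \<partial>angles d) \<le> (\<integral>\<^sup>+\<theta>. (D (Gap d \<theta>) * indicator {..<1} (Gap d \<theta>)) * indicator {..<2} (Gap d \<theta>) + ennreal (real d) \<partial>angles d)"
    proof (rule nn_integral_mono)
      fix \<theta>
      have "D (Gap d \<theta>) \<le> ennreal (real d)" if "Gap d \<theta> \<ge> 1"
        using that by (simp add: D_real ennreal_leI divide_le_eq mult_le_cancel_left1)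
      then show "D (Gap d \<theta>) \<le> (D (Gap d \<theta>) * indicator {..<1} (Gap d \<theta>)) * indicator {..<2} (Gap d \<theta>) + ennreal (real d)"
        by (auto split: split_indicator)
    qed
    also have "\<dots> = (\<integral>\<^sup>+\<theta>. (D (Gap d \<theta>) * indicator {..<1} (Gap d \<theta>)) * indicator {..<2} (Gap d \<theta>) \<partial>angles d) + ennreal (real d)"
      by (subst nn_integral_add) (auto simp: anglesP.emeasure_space_1)
    also have "(\<integral>\<^sup>+\<theta>. (D (Gap d \<theta>) * indicator {..<1} (Gap d \<theta>)) * indicator {..<2} (Gap d \<theta>) \<partial>angles d)
       = (\<integral>\<^sup>+x. (D x * indicator {..<1} x) * ennreal (gap_density n x) \<partial>lborel)"
      unfolding n(1) by (rule nn_integral_Gap_density[where f = "\<lambda>x. D x * indicator {..<1} x"]) measurable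
    finally show ?thesis using small by (meson add_right_mono order_trans)
  qed
  have "(\<Sum>k. ennreal (m_term d k)) \<le> (\<integral>\<^sup>+\<theta>. D (Gap d \<theta>) + D (2 * real d - Gap d \<theta>) \<partial>angles d)"
    unfolding sum_m_term_integral[OF d1] by (intro nn_integral_mono le)
  also have "\<dots> = (\<integral>\<^sup>+\<theta>. D (Gap d \<theta>) \<partial>angles d) + (\<integral>\<^sup>+\<theta>. D (2 * real d - Gap d \<theta>) \<partial>angles d)"
    by (rule nn_integral_add) measurable
  also have "(\<integral>\<^sup>+\<theta>. D (2 * real d - Gap d \<theta>) \<partial>angles d) = (\<integral>\<^sup>+\<theta>. D (Gap d \<theta>) \<partial>angles d)"
    by (rule nn_integral_Gap_reflect) measurable
  also have "(\<integral>\<^sup>+\<theta>. D (Gap d \<theta>) \<partial>angles d) + (\<integral>\<^sup>+\<theta>. D (Gap d \<theta>) \<partial>angles d) \<le> (ennreal (2 * C) + ennreal (real d)) + (ennreal (2 * C) + ennreal (real d))"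
    using DG by (rule add_mono) (rule DG)
  also have "\<dots> < \<top>" by (simp add: less_top[symmetric])
  finally have "(\<Sum>k. ennreal (m_term d k)) \<noteq> \<top>" by simp
  then show ?thesis by (rule summable_suminf_not_top[OF m_term_nonneg])
qed

text \<open>
  In dimension two the density of the gap has a positive lower bound \<open>c\<close> on \<open>(0, 1]\<close>, so that the mean of
  \<open>1 / Gap\<close> is infinite.
\<close>

lemma not_summable_m_term_2: "\<not> summable (m_term 2)"
proof
  assume s: "summable (m_term 2)"
  define m where "m = m_const 2"
  have m0: "m \<ge> 0" unfolding m_def m_const_def using s m_term_nonneg by (rule suminf_nonneg)
  have sm: "(\<Sum>k. ennreal (m_term 2 k)) = ennreal m"
    unfolding m_def m_const_def using s m_term_nonneg by (rule suminf_ennreal2[rotated])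
  define c where "c = (1 / pi)\<^sup>2 * phi 1 0"
  have c: "c > 0" using phi_pos[of 0 1] by (simp add: c_def)
  (* chosen so that the integral of \<open>c / x\<close> over \<open>[e, 1]\<close> is \<open>m + 1\<close> *)
  define e where "e = exp (- (m + 1) / c)"
  have e: "0 < e" "e < 1" using c m0 by (auto simp: e_def divide_neg_pos)
  have I: "((\<lambda>x. c * (1 / x)) has_integral (c * ln 1 - c * ln e)) {e..1}"
    using e by (intro fundamental_theorem_of_calculus)
      (auto intro!: derivative_eq_intros simp: has_real_derivative_iff_has_vector_derivative[symmetric])
  have "ennreal (m + 1) = ennreal (c * ln 1 - c * ln e)" using c by (simp add: e_def add.commute)
  also have "\<dots> = (\<integral>\<^sup>+x. ennreal (c * (1 / x)) * indicator {e..1} x \<partial>lborel)"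
    using I e c by (intro nn_integral_has_integral_lebesgue'[symmetric]) auto
  also have "\<dots> \<le> (\<integral>\<^sup>+x. (ennreal (1 / x) * indicator {0<..} x) * ennreal (gap_density 1 x) \<partial>lborel)"
  proof (rule nn_integral_mono)
    fix x :: real
    show "ennreal (c * (1 / x)) * indicator {e..1} x \<le> (ennreal (1 / x) * indicator {0<..} x) * ennreal (gap_density 1 x)"
    proof (cases "x \<in> {e..1}")
      case True
      then have x: "0 < x" "x \<le> 1" using e by auto
      have "gap_density 1 x = (1 / pi)\<^sup>2 * phi 1 x" using x by (simp add: gap_density_def power2_eq_square)
      moreover have "c \<le> (1 / pi)\<^sup>2 * phi 1 x" unfolding c_def using x phi_mono[of 0 x 1] by (intro mult_left_mono) auto
      ultimately have "c \<le> gap_density 1 x" by (simp only:)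
      then have "c * (1 / x) \<le> 1 / x * gap_density 1 x" using x by (simp add: divide_right_mono)
      then show ?thesis using True x by (simp add: ennreal_mult'[symmetric] ennreal_leI)
    qed simp
  qed
  also have "\<dots> = (\<integral>\<^sup>+\<theta>. (ennreal (1 / Gap (Suc 1) \<theta>) * indicator {0<..} (Gap (Suc 1) \<theta>)) * indicator {..<2} (Gap (Suc 1) \<theta>) \<partial>angles (Suc 1))"
    by (rule nn_integral_Gap_density[symmetric, where f = "\<lambda>x. ennreal (1 / x) * indicator {0<..} x"]) measurable
  also have "\<dots> \<le> (\<integral>\<^sup>+\<theta>. (\<Sum>k. ennreal ((1 - Gap (Suc 1) \<theta> / real (Suc 1)) ^ (2 * k))) \<partial>angles (Suc 1))"
  proof (rule nn_integral_mono)
    fix \<theta>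
    define x where "x = Gap (Suc 1) \<theta>"
    have "ennreal (1 / x) \<le> (\<Sum>k. ennreal ((1 - x / real (Suc 1)) ^ (2 * k)))" if "0 < x" "x < 2"
    proof -
      have "1 / x \<le> 1 / x + 1 / (4 - x)" using that by simp
      also have "\<dots> = real (Suc 1) / 2 * (1 / x + 1 / (2 * real (Suc 1) - x))" by simp
      finally have "ennreal (1 / x) \<le> ennreal (real (Suc 1) / 2 * (1 / x + 1 / (2 * real (Suc 1) - x)))"
        by (rule ennreal_leI)
      also have "\<dots> = (\<Sum>k. ennreal ((1 - x / real (Suc 1)) ^ (2 * k)))"
        using that by (intro geometric_gap[symmetric]) auto
      finally show ?thesis .
    qed
    then show "(ennreal (1 / Gap (Suc 1) \<theta>) * indicator {0<..} (Gap (Suc 1) \<theta>)) * indicator {..<2} (Gap (Suc 1) \<theta>)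
      \<le> (\<Sum>k. ennreal ((1 - Gap (Suc 1) \<theta> / real (Suc 1)) ^ (2 * k)))"
      unfolding x_def[symmetric]
      by (cases "0 < x"; cases "x < 2"; simp only: indicator_simps greaterThan_iff lessThan_iff not_less
          mult_1_right mult_zero_right mult_zero_left zero_le simp_thms)
  qed
  also have "\<dots> = (\<Sum>k. ennreal (m_term (Suc 1) k))" by (rule sum_m_term_integral[symmetric]) simp
  also have "\<dots> = ennreal m" using sm by (simp add: numeral_2_eq_2)
  finally show False using m0 by (simp add: ennreal_le_iff)
qed

section \<open>The one-dimensional walk\<close>

lemma closed_walks_1_moment: "real (card (closed_walks 1 k)) = (\<integral>t. (2 * cos t) ^ k \<partial>angle)"
proof -
  have "real (card (closed_walks 1 k)) = (\<integral>\<theta>. (\<Prod>j\<in>{..<1}. (2 * cos (\<theta> j)) ^ k) \<partial>angles 1)"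
    by (simp add: closed_walks_moment[symmetric] step_sum_def Gap_def)
  also have "\<dots> = (\<Prod>j\<in>{..<1::nat}. \<integral>t. (2 * cos t) ^ k \<partial>angle)"
    unfolding angles_def
  proof (rule angles.product_integral_prod)
    show "integrable angle (\<lambda>t. (2 * cos t) ^ k)"
      by (rule angle.integrable_const_bound[where B = "2 ^ k"])
         (auto simp: power_abs abs_mult intro!: AE_I2 power_le_one)
  qed simp
  finally show ?thesis by simp
qed

text \<open>
  The recurrence of the central binomial coefficients, from integrating the derivative of
  \<open>sin t (cos t)\<^bsup>2n+1\<^esup>\<close> over a period.
\<close>

lemma closed_walks_1_Suc:
  "real (n + 1) * real (card (closed_walks 1 (2 * (n + 1)))) = real (4 * n + 2) * real (card (closed_walks 1 (2 * n)))"
proof -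
  have int: "integrable angle (\<lambda>t. (2 * cos t) ^ k)" for k
    by (rule angle.integrable_const_bound[where B = "2 ^ k"])
       (auto simp: power_abs abs_mult intro!: AE_I2 power_le_one)
  have "(\<integral>t. real (n + 1) * (2 * cos t) ^ (2 * (n + 1)) - real (4 * n + 2) * (2 * cos t) ^ (2 * n) \<partial>angle) = 0"
  proof (rule integral_angle_derivative[where F = "\<lambda>t. 2 ^ (2 * n + 1) * (sin t * cos t ^ Suc (2 * n))"])
    fix t :: real
    have "((\<lambda>t. 2 ^ (2 * n + 1) * (sin t * cos t ^ Suc (2 * n))) has_real_derivative
       2 ^ (2 * n + 1) * (cos t * cos t ^ Suc (2 * n) - sin t * (real (2 * n + 1) * (cos t ^ (2 * n) * sin t)))) (at t)"
      by (rule DERIV_cong[OF DERIV_cmult[OF DERIV_mult[OF DERIV_sin DERIV_power[OF DERIV_cos]]]]) simp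
    also have "2 ^ (2 * n + 1) * (cos t * cos t ^ Suc (2 * n) - sin t * (real (2 * n + 1) * (cos t ^ (2 * n) * sin t)))
      = real (n + 1) * (2 * cos t) ^ (2 * (n + 1)) - real (4 * n + 2) * (2 * cos t) ^ (2 * n)"
    proof -
      have s: "sin t * sin t = 1 - cos t * cos t" using sin_squared_eq[of t] by (simp add: power2_eq_square)
      have "cos t * cos t ^ Suc (2 * n) - sin t * (real (2 * n + 1) * (cos t ^ (2 * n) * sin t))
         = cos t ^ (2 * n) * (cos t * cos t - real (2 * n + 1) * (sin t * sin t))" by (simp add: algebra_simps)
      also have "\<dots> = cos t ^ (2 * n) * (real (2 * n + 2) * (cos t * cos t) - real (2 * n + 1))"
        unfolding s by (simp add: algebra_simps)
      finally have e: "cos t * cos t ^ Suc (2 * n) - sin t * (real (2 * n + 1) * (cos t ^ (2 * n) * sin t))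
         = cos t ^ (2 * n) * (real (2 * n + 2) * (cos t * cos t) - real (2 * n + 1))" .
      have p: "(2 * cos t) ^ (2 * (n + 1)) = 4 * (cos t * cos t) * (2 ^ (2 * n) * cos t ^ (2 * n))"
        "(2 * cos t) ^ (2 * n) = 2 ^ (2 * n) * cos t ^ (2 * n)"
        by (simp_all add: power_mult_distrib)
      show ?thesis unfolding e p by (simp add: algebra_simps)
    qed
    finally show "((\<lambda>t. 2 ^ (2 * n + 1) * (sin t * cos t ^ Suc (2 * n))) has_vector_derivative
       real (n + 1) * (2 * cos t) ^ (2 * (n + 1)) - real (4 * n + 2) * (2 * cos t) ^ (2 * n)) (at t)"
      by (simp only: has_real_derivative_iff_has_vector_derivative)
  qed (auto intro!: continuous_intros)
  then have "real (n + 1) * (\<integral>t. (2 * cos t) ^ (2 * (n + 1)) \<partial>angle) - real (4 * n + 2) * (\<integral>t. (2 * cos t) ^ (2 * n) \<partial>angle) = 0"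
    by (simp only: Bochner_Integration.integral_diff[OF integrable_mult_right[OF int] integrable_mult_right[OF int]]
        integral_mult_right_zero)
  then show ?thesis by (simp only: closed_walks_1_moment)
qed

text \<open>
  The recurrence says \<open>(1 - 4 w) A' = 2 A\<close>, so the derivative of \<open>(1 - 4 w) A\<^sup>2\<close> vanishes.
\<close>

lemma A_series_1: "(1 - 4 * fps_X) * (A_series 1)\<^sup>2 = 1"
proof -
  define A where "A = A_series 1"
  have ode: "(1 - 4 * fps_X) * fps_deriv A = 2 * A"
  proof (rule fps_ext)
    fix n
    have "real (n + 1) * real (card (closed_walks 1 (2 * (n + 1)))) = real (4 * n + 2) * real (card (closed_walks 1 (2 * n)))"
      by (rule closed_walks_1_Suc)
    then have "complex_of_real (real (n + 1) * real (card (closed_walks 1 (2 * (n + 1))))) = of_real (real (4 * n + 2) * real (card (closed_walks 1 (2 * n))))"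
      by (simp only:)
    then have r: "of_nat (n + 1) * fps_nth A (n + 1) = of_nat (4 * n + 2) * fps_nth A n"
      by (simp add: A_def A_series_def)
    have "fps_nth ((1 - 4 * fps_X) * fps_deriv A) n = fps_nth (fps_deriv A) n - 4 * fps_nth (fps_X * fps_deriv A) n"
      by (simp add: left_diff_distrib mult.assoc fps_numeral_fps_const)
    also have "fps_nth (fps_X * fps_deriv A) n = of_nat n * fps_nth A n"
      by (cases n) auto
    also have "fps_nth (fps_deriv A) n = of_nat (4 * n + 2) * fps_nth A n" using r by simp
    finally show "fps_nth ((1 - 4 * fps_X) * fps_deriv A) n = fps_nth (2 * A) n"
      by (simp add: fps_numeral_fps_const algebra_simps)
  qed
  have d4: "fps_deriv (4 * fps_X :: complex fps) = 4" by (simp add: fps_numeral_fps_const)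
  have "fps_deriv ((1 - 4 * fps_X) * A\<^sup>2) = 2 * A * ((1 - 4 * fps_X) * fps_deriv A) - 4 * A\<^sup>2"
    by (simp add: d4 power2_eq_square algebra_simps)
  also have "\<dots> = 0" unfolding ode by (simp add: power2_eq_square algebra_simps)
  finally have "(1 - 4 * fps_X) * A\<^sup>2 = fps_const (fps_nth ((1 - 4 * fps_X) * A\<^sup>2) 0)"
    by (simp only: fps_deriv_eq_0_iff)
  also have "fps_nth ((1 - 4 * fps_X) * A\<^sup>2) 0 = 1"
    by (simp add: A_def A_series_def closed_walks_0 power2_eq_square)
  finally show ?thesis by (simp add: A_def)
qed

lemma B_series_1_square: "(1 - B_series 1) * (1 - B_series 1) = 1 - 4 * fps_X"
proof -
  have "(1 - B_series 1) * (1 - B_series 1) = (1 - B_series 1) * (1 - B_series 1) * ((1 - 4 * fps_X) * (A_series 1)\<^sup>2)"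
    by (simp only: A_series_1 mult_1_right)
  also have "\<dots> = (1 - 4 * fps_X) * (((1 - B_series 1) * A_series 1) * ((1 - B_series 1) * A_series 1))"
    by (simp add: power2_eq_square mult_ac)
  finally show ?thesis by (simp only: renewal_equation mult_1_right)
qed

text \<open>
  The square of \<open>1 - B\<close> is \<open>1 - 4 w\<close>, and \<open>\<bar>B\<bar> \<le> 1\<close> on the closed disc puts \<open>1 - B\<close> into the
  right half plane (or at \<open>0\<close>), which selects the principal branch. The Cauchy product is taken directly, since
  points on the boundary circle are included.
\<close>

lemma eval_B_1:
  assumes w: "norm w \<le> 1 / 4"
  shows "eval_fps (B_series 1) w = 1 - csqrt (1 - 4 * w)"
proof -
  define b where "b = eval_fps (B_series 1) w"
  have c1: "crit 1 = 1/4" by (simp add: crit_def power2_eq_square)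
  have bs: "beta 1 sums return_prob 1" by (rule beta_sums) simp
  have bd: "norm (fps_nth (B_series 1) n * w ^ n) \<le> beta 1 n" for n
  proof -
    have "norm (fps_nth (B_series 1) n * w ^ n) \<le> norm (fps_nth (B_series 1) n * of_real (crit 1) ^ n)"
      unfolding norm_mult norm_power using w by (intro mult_left_mono power_mono) (auto simp: c1[unfolded One_nat_def])
    then show ?thesis unfolding B_term_crit using beta_nonneg by simp
  qed
  have sB: "summable (\<lambda>n. norm (fps_nth (B_series 1) n * w ^ n))"
    by (rule summable_comparison_test'[OF sums_summable[OF bs], of 0]) (simp only: norm_of_real real_norm_def abs_norm_cancel bd)
  define f where "f = 1 - B_series 1"
  have sf: "summable (\<lambda>n. norm (fps_nth f n * w ^ n))"
  proof -
    have "summable (\<lambda>n. norm (fps_nth (B_series 1) (Suc n) * w ^ Suc n))"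
      using sB by (subst summable_Suc_iff)
    moreover have "norm (fps_nth f (Suc n) * w ^ Suc n) = norm (fps_nth (B_series 1) (Suc n) * w ^ Suc n)" for n
      by (simp add: f_def norm_mult)
    ultimately have "summable (\<lambda>n. norm (fps_nth f (Suc n) * w ^ Suc n))" by (simp only:)
    then show ?thesis by (subst (asm) summable_Suc_iff)
  qed
  have ef: "eval_fps f w = 1 - b"
  proof -
    have "(\<lambda>n. fps_nth 1 n * w ^ n - fps_nth (B_series 1) n * w ^ n) sums (1 - b)"
    proof (rule sums_diff)
      have e: "(\<lambda>n. fps_nth 1 n * w ^ n) = (\<lambda>n. if n = 0 then 1 else 0)" by auto
      show "(\<lambda>n. fps_nth 1 n * w ^ n) sums 1" unfolding e by (rule sums_single[of 0 "\<lambda>_. 1::complex"])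
      show "(\<lambda>n. fps_nth (B_series 1) n * w ^ n) sums b"
        using summable_norm_cancel[OF sB] by (simp add: b_def eval_fps_def summable_sums)
    qed
    then show ?thesis by (simp add: eval_fps_def f_def left_diff_distrib sums_iff)
  qed
  have sq: "(1 - b)\<^sup>2 = 1 - 4 * w"
  proof -
    have "(1 - b)\<^sup>2 = (\<Sum>n. fps_nth f n * w ^ n) * (\<Sum>n. fps_nth f n * w ^ n)"
      using ef by (simp add: eval_fps_def power2_eq_square)
    also have "\<dots> = (\<Sum>n. \<Sum>i\<le>n. (fps_nth f i * w ^ i) * (fps_nth f (n - i) * w ^ (n - i)))"
      using sf sf by (rule Cauchy_product)
    also have "\<dots> = (\<Sum>n. fps_nth (f * f) n * w ^ n)"
    proof (rule suminf_cong)
      fix n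
      have eqn: "(fps_nth f i * w ^ i) * (fps_nth f (n - i) * w ^ (n - i)) = (fps_nth f i * fps_nth f (n - i)) * w ^ n" if "i \<le> n" for i
      proof -
        have "w ^ n = w ^ i * w ^ (n - i)" using that by (simp flip: power_add)
        then show ?thesis by (simp add: mult_ac)
      qed
      show "(\<Sum>i\<le>n. (fps_nth f i * w ^ i) * (fps_nth f (n - i) * w ^ (n - i))) = fps_nth (f * f) n * w ^ n"
        unfolding fps_mult_nth sum_distrib_right atLeast0AtMost
        by (intro sum.cong refl, rule eqn) simp
    qed
    also have "\<dots> = eval_fps (fps_of_poly [:1, -4:]) w"
    proof -
      have "1 - 4 * fps_X = fps_of_poly [:1, -4 :: complex:]"
      proof (rule fps_ext)
        fix n show "fps_nth (1 - 4 * fps_X) n = fps_nth (fps_of_poly [:1, -4 :: complex:]) n"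
          by (cases n) (auto simp: coeff_pCons fps_numeral_fps_const split: nat.split)
      qed
      then show ?thesis unfolding f_def B_series_1_square eval_fps_def by (simp only:)
    qed
    also have "\<dots> = 1 - 4 * w" by (simp only: eval_fps_of_poly) simp
    finally show ?thesis .
  qed
  have "norm b \<le> suminf (beta 1)"
    unfolding b_def eval_fps_def by (rule norm_suminf_le[OF bd sums_summable[OF bs]])
  then have nb: "norm b \<le> 1"
    unfolding sums_unique[OF bs, symmetric] using return_prob_le_1[of 1] by linarith
  have "0 < Re (1 - b) \<or> Re (1 - b) = 0 \<and> 0 \<le> Im (1 - b)"
  proof (cases "Re b = 1")
    case True
    then have "(Re b)\<^sup>2 + (Im b)\<^sup>2 \<le> 1" using nb by (simp add: cmod_def)
    then show ?thesis using True by simp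
  next
    case False
    then show ?thesis using complex_Re_le_cmod[of b] nb by auto
  qed
  then have "csqrt (1 - 4 * w) = 1 - b" using sq by (intro csqrt_unique) auto
  then show ?thesis by (simp add: b_def)
qed

section \<open>Analytic continuation across the cut\<close>

lemma cauchy_linepath_holomorphic:
  assumes f: "continuous_on (closed_segment b c) f" and S: "open S" "S \<inter> closed_segment b c = {}"
  shows "(\<lambda>w. contour_integral (linepath b c) (\<lambda>u. f u / (u - w))) holomorphic_on S"
proof -
  have "((\<lambda>w. contour_integral (linepath b c) (\<lambda>u. f u / (u - w))) has_field_derivative
     (of_nat 1 * contour_integral (linepath b c) (\<lambda>u. f u / (u - w) ^ Suc 1))) (at w)" if w: "w \<in> S" for w
  proof (rule Cauchy_next_derivative(2)[where S = S and B = "norm (c - b)"])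
    show "continuous_on (path_image (linepath b c)) f" using f by simp
    show "norm (vector_derivative (linepath b c) (at t)) \<le> norm (c - b)" for t by simp
    show "((\<lambda>u. f u / (u - w) ^ 1) has_contour_integral contour_integral (linepath b c) (\<lambda>u. f u / (u - w))) (linepath b c)"
      if "w \<in> S - path_image (linepath b c)" for w
    proof -
      have "continuous_on (closed_segment b c) (\<lambda>u. f u / (u - w))"
        using that f by (intro continuous_intros) auto
      then have "(\<lambda>u. f u / (u - w)) contour_integrable_on linepath b c"
        by (rule contour_integrable_continuous_linepath)
      then show ?thesis by (simp add: has_contour_integral_integral)
    qed
  qed (use S w in auto)
  then show ?thesis using S(1) by (auto simp: holomorphic_on_open)
qed

text \<open>
  The integral along a real segment continues across it: replace the segment by the two lower legs of a
  right triangle. Above the real axis nothing changes by Cauchy's theorem; a point that has moved below the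
  axis lies inside the triangle, and the difference is the value at \<open>Y\<close> by Cauchy's formula.
\<close>

lemma cauchy_integral_continuation:
  fixes \<rho> :: "complex \<Rightarrow> complex" and a r :: real
  assumes Q: "convex Q" "open Q" "\<rho> holomorphic_on Q" and r: "r > 0"
    and vert: "of_real (a - r) \<in> Q" "Complex a (- r) \<in> Q" "of_real (a + r) \<in> Q"
  obtains F where "F holomorphic_on ball (of_real a) (r / 2)"
    "\<And>Y. Y \<in> ball (of_real a) (r / 2) \<Longrightarrow> Im Y > 0 \<Longrightarrow> F Y = contour_integral (linepath (of_real (a - r)) (of_real (a + r))) (\<lambda>u. \<rho> u / (u - Y))"
    "\<And>Y. Y \<in> ball (of_real a) (r / 2) \<Longrightarrow> Im Y < 0 \<Longrightarrow> F Y = contour_integral (linepath (of_real (a - r)) (of_real (a + r))) (\<lambda>u. \<rho> u / (u - Y)) + 2 * of_real pi * \<i> * \<rho> Y"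
proof -
  define A where "A = complex_of_real (a - r)"
  define p where "p = Complex a (- r)"
  define C where "C = complex_of_real (a + r)"
  note defs = A_def p_def C_def
  have V: "A \<in> Q" "p \<in> Q" "C \<in> Q" using vert by (auto simp: defs)
  have hull: "convex hull {A, p, C} \<subseteq> Q" using V Q(1) by (intro hull_minimal) auto
  have seg: "closed_segment x y \<subseteq> Q" if "x \<in> Q" "y \<in> Q" for x y
    using Q(1) that by (simp add: closed_segment_subset)
  have cont: "continuous_on Q \<rho>" using Q(3) by (rule holomorphic_on_imp_continuous_on)
  have Ap: "Re z + Im z = a - r" if "z \<in> closed_segment A p" for z
    using that unfolding in_segment by (clarsimp simp: defs) (simp add: algebra_simps)?
  have pC: "Re z - Im z = a + r" if "z \<in> closed_segment p C" for z
    using that unfolding in_segment by (clarsimp simp: defs) (simp add: algebra_simps)?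
  have AC: "Im z = 0" if "z \<in> closed_segment A C" for z
    using that unfolding in_segment by (clarsimp simp: defs)
  have near: "\<bar>Re z - a\<bar> < r / 2 \<and> \<bar>Im z\<bar> < r / 2" if "z \<in> ball (of_real a) (r / 2)" for z
  proof -
    have "norm (z - of_real a) < r / 2" using that by (simp add: dist_norm norm_minus_commute)
    then show ?thesis using abs_Re_le_cmod[of "z - of_real a"] abs_Im_le_cmod[of "z - of_real a"] by auto
  qed
  have off1: "z \<notin> closed_segment A p" if "z \<in> ball (of_real a) (r / 2)" for z
    using near[OF that] Ap[of z] by (auto simp: abs_if split: if_splits)
  have off2: "z \<notin> closed_segment p C" if "z \<in> ball (of_real a) (r / 2)" for z
    using near[OF that] pC[of z] by (auto simp: abs_if split: if_splits)
  define F where "F = (\<lambda>Y. contour_integral (linepath A p) (\<lambda>u. \<rho> u / (u - Y)) + contour_integral (linepath p C) (\<lambda>u. \<rho> u / (u - Y)))"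
  have hol: "F holomorphic_on ball (of_real a) (r / 2)"
    unfolding F_def using off1 off2 seg V
    by (intro holomorphic_on_add cauchy_linepath_holomorphic continuous_on_subset[OF cont]) auto
  have int: "(\<lambda>u. \<rho> u / (u - Y)) contour_integrable_on linepath x y"
    if "Y \<notin> closed_segment x y" "x \<in> Q" "y \<in> Q" for x y Y
    using that seg[OF that(2,3)]
    by (intro contour_integrable_continuous_linepath continuous_intros continuous_on_subset[OF cont]) auto
  have tri: "F Y = contour_integral (linepath A C) (\<lambda>u. \<rho> u / (u - Y)) + I"
    if Y: "Y \<in> ball (of_real a) (r / 2)" "Im Y \<noteq> 0"
      and I: "((\<lambda>u. \<rho> u / (u - Y)) has_contour_integral I) (linepath A p +++ linepath p C +++ linepath C A)" for Y I
  proof -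
    have CA: "Y \<notin> closed_segment C A" using AC[of Y] Y(2) by (auto simp: closed_segment_commute)
    have "contour_integral (linepath A p +++ linepath p C +++ linepath C A) (\<lambda>u. \<rho> u / (u - Y)) = I"
      using I by (rule contour_integral_unique)
    then have "contour_integral (linepath A p) (\<lambda>u. \<rho> u / (u - Y)) + (contour_integral (linepath p C) (\<lambda>u. \<rho> u / (u - Y))
       + contour_integral (linepath C A) (\<lambda>u. \<rho> u / (u - Y))) = I"
      using int[OF off1[OF Y(1)] V(1,2)] int[OF off2[OF Y(1)] V(2,3)] int[OF CA V(3,1)] by simp
    moreover have "contour_integral (linepath C A) (\<lambda>u. \<rho> u / (u - Y)) = - contour_integral (linepath A C) (\<lambda>u. \<rho> u / (u - Y))"
      using contour_integral_reversepath[of "linepath A C" "\<lambda>u. \<rho> u / (u - Y)"] by simp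
    ultimately show ?thesis by (simp add: F_def algebra_simps)
  qed
  show thesis
  proof (rule that[OF hol], fold A_def C_def)
    fix Y assume Y: "Y \<in> ball (of_real a) (r / 2)" "Im Y > 0"
    have "Im z \<le> 0" if "z \<in> convex hull {A, p, C}" for z
    proof -
      have "convex {z. Im z \<le> 0}" by (rule convex_halfspace_Im_le)
      then have "convex hull {A, p, C} \<subseteq> {z. Im z \<le> 0}" using r by (intro hull_minimal) (auto simp: defs)
      then show ?thesis using that by auto
    qed
    then have "Y \<notin> convex hull {A, p, C}" using Y(2) by force
    then have "(\<lambda>u. \<rho> u / (u - Y)) holomorphic_on convex hull {A, p, C}"
      by (intro holomorphic_intros holomorphic_on_subset[OF Q(3) hull]) auto
    then have "((\<lambda>u. \<rho> u / (u - Y)) has_contour_integral 0) (linepath A p +++ linepath p C +++ linepath C A)"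
      by (rule Cauchy_theorem_triangle)
    then show "F Y = contour_integral (linepath A C) (\<lambda>u. \<rho> u / (u - Y))"
      using tri[OF Y(1)] Y(2) by simp
  next
    fix Y assume Y: "Y \<in> ball (of_real a) (r / 2)" "Im Y < 0"
    (* the interior of the triangle, described by its three sides *)
    define O' where "O' = {z. Im z < 0} \<inter> {z. Re z + Im z > a - r} \<inter> {z. Re z - Im z < a + r}"
    have "open O'" unfolding O'_def
      by (intro open_Int open_Collect_less continuous_intros)
    moreover have "O' \<subseteq> convex hull {A, p, C}"
    proof
      fix z assume z: "z \<in> O'"
      (* barycentric coordinates with respect to p, A and C *)
      define y where "y = - Im z / r"
      define x where "x = (1 + Im z / r - (Re z - a) / r) / 2"
      define v where "v = (1 + Im z / r + (Re z - a) / r) / 2"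
      have "0 \<le> y" using z r by (auto simp: y_def O'_def divide_nonpos_pos)
      moreover have "x = (r + Im z - (Re z - a)) / (2 * r)" "v = (r + Im z + (Re z - a)) / (2 * r)"
        using r by (auto simp: x_def v_def field_simps)
      then have "0 \<le> x" "0 \<le> v" using z r by (auto simp: O'_def)
      moreover have "x + y + v = 1" by (simp add: x_def y_def v_def field_simps)
      moreover have "z = x *\<^sub>R A + y *\<^sub>R p + v *\<^sub>R C"
        using r by (auto simp: complex_eq_iff defs x_def y_def v_def field_simps)
      ultimately show "z \<in> convex hull {A, p, C}" unfolding convex_hull_3 by blast
    qed
    ultimately have "O' \<subseteq> interior (convex hull {A, p, C})" by (rule interior_maximal[rotated])
    moreover have "Y \<in> O'" using near[OF Y(1)] Y(2) by (auto simp: O'_def abs_if split: if_splits)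
    ultimately have YI: "Y \<in> interior (convex hull {A, p, C})" by auto
    have "0 < Im ((p - A) * cnj (p - Y))"
    proof -
      have "Im ((p - A) * cnj (p - Y)) = r * ((Re Y + Im Y) - (a - r))"
        by (simp add: defs algebra_simps)
      then show ?thesis using \<open>Y \<in> O'\<close> r by (simp add: O'_def)
    qed
    then have wn: "winding_number (linepath A p +++ linepath p C +++ linepath C A) Y = 1"
      using winding_number_triangle[OF YI] by simp
    have YQ: "Y \<in> interior Q" using YI hull interior_mono by blast
    have "closed_segment C A \<subseteq> Q - {Y}" using AC[of Y] Y(2) seg V by (auto simp: closed_segment_commute)
    moreover have "closed_segment A p \<subseteq> Q - {Y}" "closed_segment p C \<subseteq> Q - {Y}" using seg V off1[OF Y(1)] off2[OF Y(1)] by auto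
    ultimately have "((\<lambda>w. \<rho> w / (w - Y)) has_contour_integral (2 * of_real pi * \<i> * winding_number (linepath A p +++ linepath p C +++ linepath C A) Y * \<rho> Y))
        (linepath A p +++ linepath p C +++ linepath C A)"
      using Cauchy_integral_formula_convex_simple[OF Q(1) Q(3) YQ, of "linepath A p +++ linepath p C +++ linepath C A"]
      by (simp add: path_image_join)
    then show "F Y = contour_integral (linepath A C) (\<lambda>u. \<rho> u / (u - Y)) + 2 * of_real pi * \<i> * \<rho> Y"
      using tri[OF Y(1)] Y(2) by (simp add: wn)
  qed
qed

definition resolvent :: "nat \<Rightarrow> complex \<Rightarrow> complex" where
  "resolvent d Y = (\<integral>\<theta>. 1 / (of_real (Gap d \<theta>) - Y) \<partial>angles d)"

text \<open>
  The analytic continuation of \<^const>\<open>gap_density\<close> from \<open>(0, 2)\<close>.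
\<close>

definition density_ext :: "nat \<Rightarrow> complex \<Rightarrow> complex" where
  "density_ext n z = of_real ((1 / pi) ^ Suc n) * csqrt z ^ Suc n / z * Phi n z"

lemma density_ext_holomorphic: "density_ext n holomorphic_on {z. 0 < Re z \<and> Re z < 2}"
proof -
  have "(\<lambda>z. of_real ((1 / pi) ^ Suc n) * csqrt z ^ Suc n / z * Phi n z) holomorphic_on {z. 0 < Re z \<and> Re z < 2}"
    by (intro holomorphic_intros holomorphic_on_subset[OF Phi_holomorphic])
       (auto simp: slit2_def complex_nonpos_Reals_iff)
  then show ?thesis by (simp add: density_ext_def[abs_def])
qed

lemma density_ext_of_real: "0 < x \<Longrightarrow> x < 2 \<Longrightarrow> density_ext n (of_real x) = of_real (gap_density n x)"
  by (simp add: density_ext_def gap_density_def Phi_of_real)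

lemma integral_Gap_density:
  assumes I: "I \<in> sets borel" "I \<subseteq> {..<2}" and h: "h \<in> borel_measurable borel"
  shows "(\<integral>\<theta>. indicator I (Gap (Suc n) \<theta>) *\<^sub>R (h (Gap (Suc n) \<theta>) :: complex) \<partial>angles (Suc n)) =
    (\<integral>x. (indicator I x * gap_density n x) *\<^sub>R h x \<partial>lborel)"
proof -
  note [measurable] = I(1) h
  define \<nu> where "\<nu> = distr (angles (Suc n)) borel (Gap (Suc n))"
  have [simp, measurable_cong]: "sets \<nu> = sets borel" by (simp add: \<nu>_def)
  have eq: "density \<nu> (\<lambda>x. ennreal (indicator I x)) = density lborel (\<lambda>x. ennreal (indicator I x * gap_density n x))"
  proof (rule measure_eqI)
    fix A assume "A \<in> sets (density \<nu> (\<lambda>x. ennreal (indicator I x)))"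
    then have [measurable]: "A \<in> sets borel" by simp
    have "emeasure (density \<nu> (\<lambda>x. ennreal (indicator I x))) A = (\<integral>\<^sup>+x. ennreal (indicator I x) * indicator A x \<partial>\<nu>)"
      by (rule emeasure_density) auto
    also have "\<dots> = (\<integral>\<^sup>+\<theta>. ennreal (indicator I (Gap (Suc n) \<theta>)) * indicator A (Gap (Suc n) \<theta>) \<partial>angles (Suc n))"
      unfolding \<nu>_def by (rule nn_integral_distr) auto
    also have "\<dots> = (\<integral>\<^sup>+\<theta>. (ennreal (indicator I (Gap (Suc n) \<theta>)) * indicator A (Gap (Suc n) \<theta>)) * indicator {..<2} (Gap (Suc n) \<theta>) \<partial>angles (Suc n))"
      using I(2) by (intro nn_integral_cong) (auto split: split_indicator)
    also have "\<dots> = (\<integral>\<^sup>+x. (ennreal (indicator I x) * indicator A x) * ennreal (gap_density n x) \<partial>lborel)"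
      by (rule nn_integral_Gap_density[where f = "\<lambda>x. ennreal (indicator I x) * indicator A x"]) measurable
    also have "\<dots> = (\<integral>\<^sup>+x. ennreal (indicator I x * gap_density n x) * indicator A x \<partial>lborel)"
      by (intro nn_integral_cong) (auto split: split_indicator)
    also have "\<dots> = emeasure (density lborel (\<lambda>x. ennreal (indicator I x * gap_density n x))) A"
      by (rule emeasure_density[symmetric]) auto
    finally show "emeasure (density \<nu> (\<lambda>x. ennreal (indicator I x))) A = emeasure (density lborel (\<lambda>x. ennreal (indicator I x * gap_density n x))) A" .
  qed simp
  have "(\<integral>\<theta>. indicator I (Gap (Suc n) \<theta>) *\<^sub>R h (Gap (Suc n) \<theta>) \<partial>angles (Suc n)) = (\<integral>x. indicator I x *\<^sub>R h x \<partial>\<nu>)"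
    unfolding \<nu>_def by (rule integral_distr[symmetric]) auto
  also have "\<dots> = (\<integral>x. h x \<partial>density \<nu> (\<lambda>x. ennreal (indicator I x)))"
    by (rule integral_density[symmetric]) auto
  also have "\<dots> = (\<integral>x. (indicator I x * gap_density n x) *\<^sub>R h x \<partial>lborel)"
    unfolding eq by (rule integral_density) (auto simp: gap_density_nonneg)
  finally show ?thesis .
qed

text \<open>
  Near \<open>a\<close> the law of the gap has an analytic density, and its contribution continues by
  \<open>cauchy_integral_continuation\<close>. The contribution of the gaps at distance more than \<open>a/2\<close> from \<open>a\<close> is
  holomorphic near \<open>a\<close> anyway.
\<close>

lemma resolvent_continuation:
  assumes a: "0 < a" "a < 1"
  obtains F e where "e > 0" "F holomorphic_on ball (of_real a) e"
    "\<And>Y. Y \<in> ball (of_real a) e \<Longrightarrow> Im Y > 0 \<Longrightarrow> F Y = resolvent (Suc n) Y"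
    "\<And>Y. Y \<in> ball (of_real a) e \<Longrightarrow> Im Y < 0 \<Longrightarrow> F Y = resolvent (Suc n) Y + 2 * of_real pi * \<i> * density_ext n Y"
proof -
  define r where "r = a / 2"
  have r: "r > 0" "a - r > 0" "a + r < 2" using a by (auto simp: r_def)
  define I where "I = {a - r..a + r}"
  define Q where "Q = {z. 0 < Re z \<and> Re z < 2}"
  have Q: "convex Q" "open Q" "density_ext n holomorphic_on Q"
  proof -
    have "Q = {z. Re z > 0} \<inter> {z. Re z < 2}" by (auto simp: Q_def)
    then show "convex Q" "open Q"
      by (simp_all add: convex_Int convex_halfspace_Re_gt convex_halfspace_Re_lt open_Int open_halfspace_Re_gt open_halfspace_Re_lt)
    show "density_ext n holomorphic_on Q" unfolding Q_def by (rule density_ext_holomorphic)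
  qed
  obtain F1 where F1: "F1 holomorphic_on ball (of_real a) (r / 2)"
    "\<And>Y. Y \<in> ball (of_real a) (r / 2) \<Longrightarrow> Im Y > 0 \<Longrightarrow> F1 Y = contour_integral (linepath (of_real (a - r)) (of_real (a + r))) (\<lambda>u. density_ext n u / (u - Y))"
    "\<And>Y. Y \<in> ball (of_real a) (r / 2) \<Longrightarrow> Im Y < 0 \<Longrightarrow> F1 Y = contour_integral (linepath (of_real (a - r)) (of_real (a + r))) (\<lambda>u. density_ext n u / (u - Y)) + 2 * of_real pi * \<i> * density_ext n Y"
    by (rule cauchy_integral_continuation[OF Q r(1), of a]) (use r a in \<open>auto simp: Q_def\<close>)
  define F2 where "F2 = (\<lambda>Y::complex. \<integral>\<theta>. of_real (indicator (- I) (Gap (Suc n) \<theta>)) / (of_real (Gap (Suc n) \<theta>) - Y * of_real 1) \<partial>angles (Suc n))"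
  have F2: "F2 holomorphic_on ball (of_real a) (r / 2)"
    unfolding F2_def
  proof (rule cauchy_transform_holomorphic[where Q = 1])
    show "prob_space (angles (Suc n))" by (rule prob_space_angles)
    show "(\<lambda>\<theta>. indicator (- I) (Gap (Suc n) \<theta>)) \<in> borel_measurable (angles (Suc n))"
      unfolding I_def by measurable
    fix Y assume Y: "Y \<in> ball (complex_of_real a) (r / 2)"
    have "r / 2 \<le> norm (of_real (Gap (Suc n) \<theta>) - Y * of_real 1)" if "indicator (- I) (Gap (Suc n) \<theta>) \<noteq> (0::real)" for \<theta>
    proof -
      have "\<bar>Gap (Suc n) \<theta> - a\<bar> \<ge> r" using that by (auto simp: I_def indicator_def abs_if split: if_splits)
      then have "norm (complex_of_real (Gap (Suc n) \<theta>) - of_real a) \<ge> r" by (simp flip: of_real_diff)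
      moreover have "norm (complex_of_real a - Y) < r / 2" using Y by (simp add: dist_norm)
      ultimately show ?thesis
        using norm_triangle_ineq2[of "complex_of_real (Gap (Suc n) \<theta>) - of_real a" "Y - of_real a"]
        by (simp add: norm_minus_commute)
    qed
    then show "\<exists>\<delta>>0. \<forall>\<theta>\<in>space (angles (Suc n)). indicator (- I) (Gap (Suc n) \<theta>) \<noteq> (0::real) \<longrightarrow> \<delta> \<le> norm (of_real (Gap (Suc n) \<theta>) - Y * of_real 1)"
      using r(1) by (intro exI[of _ "r / 2"]) auto
  qed (auto simp: indicator_def)
  have split: "resolvent (Suc n) Y = contour_integral (linepath (of_real (a - r)) (of_real (a + r))) (\<lambda>u. density_ext n u / (u - Y)) + F2 Y"
    if Y: "Im Y \<noteq> 0" for Y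
  proof -
    define h where "h = (\<lambda>x. 1 / (complex_of_real x - Y))"
    have nz: "complex_of_real x - Y \<noteq> 0" for x using Y by auto
    have hm [measurable]: "h \<in> borel_measurable borel" unfolding h_def by measurable
    have hb: "norm (h x) \<le> 1 / \<bar>Im Y\<bar>" for x
      unfolding h_def norm_divide using abs_Im_le_cmod[of "complex_of_real x - Y"] Y by (auto intro!: frac_le)
    have Im': "(\<lambda>\<theta>. indicat_real J (Gap (Suc n) \<theta>)) \<in> borel_measurable (angles (Suc n))" if "J \<in> sets borel" for J
      using that by measurable
    have IJ: "I \<in> sets borel" "- I \<in> sets borel" by (auto simp: I_def)
    have int: "integrable (angles (Suc n)) (\<lambda>\<theta>. indicat_real J (Gap (Suc n) \<theta>) *\<^sub>R h (Gap (Suc n) \<theta>))" if "J \<in> sets borel" for J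
    proof (rule anglesP.integrable_const_bound[where B = "1 / \<bar>Im Y\<bar>"])
      show "AE \<theta> in angles (Suc n). norm (indicat_real J (Gap (Suc n) \<theta>) *\<^sub>R h (Gap (Suc n) \<theta>)) \<le> 1 / \<bar>Im Y\<bar>"
        using hb by (auto simp: indicator_def)
      show "(\<lambda>\<theta>. indicat_real J (Gap (Suc n) \<theta>) *\<^sub>R h (Gap (Suc n) \<theta>)) \<in> borel_measurable (angles (Suc n))"
        using that by measurable
    qed
    have "resolvent (Suc n) Y = (\<integral>\<theta>. indicator I (Gap (Suc n) \<theta>) *\<^sub>R h (Gap (Suc n) \<theta>) + indicator (- I) (Gap (Suc n) \<theta>) *\<^sub>R h (Gap (Suc n) \<theta>) \<partial>angles (Suc n))"
      unfolding resolvent_def h_def by (intro Bochner_Integration.integral_cong) (auto simp: indicator_def)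
    also have "\<dots> = (\<integral>\<theta>. indicator I (Gap (Suc n) \<theta>) *\<^sub>R h (Gap (Suc n) \<theta>) \<partial>angles (Suc n)) + (\<integral>\<theta>. indicator (- I) (Gap (Suc n) \<theta>) *\<^sub>R h (Gap (Suc n) \<theta>) \<partial>angles (Suc n))"
      by (rule Bochner_Integration.integral_add[OF int[OF IJ(1)] int[OF IJ(2)]])
    also have "(\<integral>\<theta>. indicator (- I) (Gap (Suc n) \<theta>) *\<^sub>R h (Gap (Suc n) \<theta>) \<partial>angles (Suc n)) = F2 Y"
      unfolding F2_def h_def by (intro Bochner_Integration.integral_cong) (auto simp: scaleR_conv_of_real)
    also have "(\<integral>\<theta>. indicator I (Gap (Suc n) \<theta>) *\<^sub>R h (Gap (Suc n) \<theta>) \<partial>angles (Suc n)) = (\<integral>x. (indicator I x * gap_density n x) *\<^sub>R h x \<partial>lborel)"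
      by (rule integral_Gap_density) (use r a in \<open>auto simp: I_def\<close>)
    also have "\<dots> = (\<integral>x. indicator I x *\<^sub>R (density_ext n (of_real x) / (of_real x - Y)) \<partial>lborel)"
      using r by (intro Bochner_Integration.integral_cong) (auto simp: I_def h_def density_ext_of_real scaleR_conv_of_real split: split_indicator)
    also have "\<dots> = integral I (\<lambda>x. density_ext n (of_real x) / (of_real x - Y))"
    proof -
      have "continuous_on I (\<lambda>x. density_ext n (of_real x) / (of_real x - Y))"
        using r nz by (intro continuous_intros continuous_on_compose2[OF holomorphic_on_imp_continuous_on[OF density_ext_holomorphic[of n]]]) (auto simp: I_def)
      then have "set_integrable lborel I (\<lambda>x. density_ext n (of_real x) / (of_real x - Y))"
        unfolding I_def by (rule borel_integrable_atLeastAtMost')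
      from set_borel_integral_eq_integral(2)[OF this] show ?thesis by (simp add: set_lebesgue_integral_def)
    qed
    also have "\<dots> = contour_integral (linepath (of_real (a - r)) (of_real (a + r))) (\<lambda>u. density_ext n u / (u - Y))"
      using r(1) by (subst contour_integral_linepath_Reals_eq) (auto simp: I_def)
    finally show ?thesis .
  qed
  show thesis
  proof (rule that[of "r / 2" "\<lambda>Y. F1 Y + F2 Y"])
    show "(\<lambda>Y. F1 Y + F2 Y) holomorphic_on ball (of_real a) (r / 2)" using F1(1) F2 by (rule holomorphic_on_add)
  qed (use F1 split r in auto)
qed

section \<open>The second sheet and the radius of convergence\<close>

lemma integral_Gap_reflect:
  fixes f :: "real \<Rightarrow> complex"
  assumes f: "f \<in> borel_measurable borel"
  shows "(\<integral>\<theta>. f (2 * real d - Gap d \<theta>) \<partial>angles d) = (\<integral>\<theta>. f (Gap d \<theta>) \<partial>angles d)"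
proof -
  have "distr (angles d) borel (\<lambda>\<theta>. 2 * real d - Gap d \<theta>) = distr (angles d) borel (Gap d)"
  proof (rule measure_eqI)
    fix A assume "A \<in> sets (distr (angles d) borel (\<lambda>\<theta>. 2 * real d - Gap d \<theta>))"
    then have [measurable]: "A \<in> sets borel" by simp
    have "emeasure (distr (angles d) borel (\<lambda>\<theta>. 2 * real d - Gap d \<theta>)) A =
        (\<integral>\<^sup>+x. indicator A x \<partial>distr (angles d) borel (\<lambda>\<theta>. 2 * real d - Gap d \<theta>))"
      by simp
    also have "\<dots> = (\<integral>\<^sup>+\<theta>. indicator A (2 * real d - Gap d \<theta>) \<partial>angles d)" by (rule nn_integral_distr) auto
    also have "\<dots> = (\<integral>\<^sup>+\<theta>. indicator A (Gap d \<theta>) \<partial>angles d)" by (rule nn_integral_Gap_reflect) auto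
    also have "\<dots> = (\<integral>\<^sup>+x. indicator A x \<partial>distr (angles d) borel (Gap d))" by (rule nn_integral_distr[symmetric]) auto
    also have "\<dots> = emeasure (distr (angles d) borel (Gap d)) A" by simp
    finally show "emeasure (distr (angles d) borel (\<lambda>\<theta>. 2 * real d - Gap d \<theta>)) A = emeasure (distr (angles d) borel (Gap d)) A" .
  qed simp
  then have "(\<integral>x. f x \<partial>distr (angles d) borel (\<lambda>\<theta>. 2 * real d - Gap d \<theta>)) = (\<integral>x. f x \<partial>distr (angles d) borel (Gap d))" by simp
  moreover have "(\<integral>x. f x \<partial>distr (angles d) borel (\<lambda>\<theta>. 2 * real d - Gap d \<theta>)) = (\<integral>\<theta>. f (2 * real d - Gap d \<theta>) \<partial>angles d)"
    by (rule integral_distr) (use f in auto)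
  moreover have "(\<integral>x. f x \<partial>distr (angles d) borel (Gap d)) = (\<integral>\<theta>. f (Gap d \<theta>) \<partial>angles d)"
    by (rule integral_distr) (use f in auto)
  ultimately show ?thesis by simp
qed

text \<open>
  The spectral variable: \<open>w (step_sum d \<theta>)\<^sup>2 = 1\<close> exactly if \<open>d - Gap d \<theta> = \<plusminus> energy w\<close>.
\<close>

definition energy :: "complex \<Rightarrow> complex" where
  "energy w = 1 / (2 * csqrt w)"

text \<open>
  Where both \<^const>\<open>Green\<close> and the principal branch in \<^const>\<open>energy\<close> are available.
\<close>

definition slit_domain :: "nat \<Rightarrow> complex set" where
  "slit_domain d = cut_plane d - \<real>\<^sub>\<le>\<^sub>0"

lemma open_slit_domain: "open (slit_domain d)"
  unfolding slit_domain_def by (intro open_Diff open_cut_plane closed_nonpos_Reals_complex)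

lemma Re_csqrt_pos: "w \<notin> \<real>\<^sub>\<le>\<^sub>0 \<Longrightarrow> 0 < Re (csqrt w)"
proof -
  assume w: "w \<notin> \<real>\<^sub>\<le>\<^sub>0"
  have "Re (csqrt w) \<noteq> 0"
  proof
    assume "Re (csqrt w) = 0"
    then obtain r :: real where r: "csqrt w = \<i> * of_real r" by (metis complex_eq mult_zero_left add_0 of_real_0)
    have "w = (csqrt w)\<^sup>2" by (simp del: csqrt.simps)
    also have "\<dots> = of_real (- (r\<^sup>2))" unfolding r by (simp add: power_mult_distrib)
    finally have "w \<in> \<real>\<^sub>\<le>\<^sub>0" using nonpos_Reals_of_real_iff[of "- (r\<^sup>2)"] by simp
    then show False using w by simp
  qed
  then show ?thesis using Re_csqrt[of w] by linarith
qed

lemma energy_holomorphic: "energy holomorphic_on - \<real>\<^sub>\<le>\<^sub>0"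
  unfolding energy_def[abs_def]
  by (intro holomorphic_intros) auto

lemma energy_square: "w \<noteq> 0 \<Longrightarrow> (energy w)\<^sup>2 = 1 / (4 * w)"
  by (simp add: energy_def power_divide power_mult_distrib)

lemma energy_Re_pos:
  assumes w: "w \<notin> \<real>\<^sub>\<le>\<^sub>0" shows "0 < Re (energy w)"
proof -
  have r: "0 < Re (2 * csqrt w)" using Re_csqrt_pos[OF w] by (simp del: csqrt.simps)
  have "Re (energy w) = Re (2 * csqrt w) / ((Re (2 * csqrt w))\<^sup>2 + (Im (2 * csqrt w))\<^sup>2)"
    unfolding energy_def inverse_eq_divide[symmetric] by (rule inverse_complex.simps)
  also have "\<dots> > 0" using r by (intro divide_pos_pos add_pos_nonneg) auto
  finally show ?thesis .
qed

lemma energy_Im_sign: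
  assumes w: "w \<notin> \<real>\<^sub>\<le>\<^sub>0" shows "Im w > 0 \<Longrightarrow> Im (energy w) < 0" "Im w < 0 \<Longrightarrow> Im (energy w) > 0" "Im (energy w) = 0 \<Longrightarrow> Im w = 0"
proof -
  have e0: "energy w \<noteq> 0" using energy_Re_pos[OF w] by auto
  have "w = 1 / (4 * (energy w)\<^sup>2)" using w by (subst energy_square) auto
  also have "\<dots> = cnj (4 * (energy w)\<^sup>2) / of_real ((norm (4 * (energy w)\<^sup>2))\<^sup>2)"
    using e0 complex_norm_square[of "4 * (energy w)\<^sup>2"] by (simp add: divide_simps)
  finally have "Im w = Im (cnj (4 * (energy w)\<^sup>2) / of_real ((norm (4 * (energy w)\<^sup>2))\<^sup>2))" by (rule arg_cong)
  then have i: "Im w = - (8 * Re (energy w) * Im (energy w)) / (norm (4 * (energy w)\<^sup>2))\<^sup>2"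
    by (simp add: Im_divide_of_real power2_eq_square)
  have n: "(norm (4 * (energy w)\<^sup>2))\<^sup>2 > 0" using e0 by simp
  have r: "Re (energy w) > 0" by (rule energy_Re_pos[OF w])
  define N where "N = (norm (4 * (energy w)\<^sup>2))\<^sup>2"
  have k: "Im (energy w) = - (Im w * N) / (8 * Re (energy w))"
    using i n r unfolding N_def[symmetric] by (simp add: field_simps)
  show "Im (energy w) < 0" if "Im w > 0"
    using that n r unfolding N_def[symmetric] by (subst k, intro divide_neg_pos) auto
  show "Im (energy w) > 0" if "Im w < 0"
    using that n r unfolding N_def[symmetric] by (subst k, intro divide_pos_pos) (auto simp: mult_neg_pos)
  show "Im w = 0" if "Im (energy w) = 0" using that i by simp
qed

lemma energy_gt:
  assumes d: "d \<ge> 1" and w: "w \<in> slit_domain d" and im: "Im (energy w) = 0"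
  shows "Re (energy w) > real d"
proof -
  have w': "w \<notin> \<real>\<^sub>\<le>\<^sub>0" "w \<in> cut_plane d" using w by (auto simp: slit_domain_def)
  define x where "x = Re (energy w)"
  have x: "x > 0" unfolding x_def by (rule energy_Re_pos[OF w'(1)])
  have ex: "energy w = of_real x" using im by (simp add: x_def complex_eq_iff)
  have "Im w = 0" using energy_Im_sign(3)[OF w'(1) im] .
  then have wr: "w = of_real (Re w)" "Re w < crit d" "Re w > 0" using w' by (auto simp: cut_plane_def complex_eq_iff complex_nonpos_Reals_iff)
  have "w \<noteq> 0" using w' by auto
  from energy_square[OF this] have "complex_of_real (x\<^sup>2) = 1 / (4 * w)" by (simp add: ex)
  also have "\<dots> = of_real (1 / (4 * Re w))" by (subst wr(1)) simp
  finally have "complex_of_real (x\<^sup>2) = of_real (1 / (4 * Re w))" .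
  then have "x\<^sup>2 = 1 / (4 * Re w)" by (simp only: of_real_eq_iff)
  also have "\<dots> > 1 / (4 * crit d)" using wr crit_pos[OF d] by (intro divide_strict_left_mono) auto
  also have "1 / (4 * crit d) = (real d)\<^sup>2" using d by (simp add: crit_def power2_eq_square)
  finally show ?thesis using x power_less_imp_less_base[of "real d" 2 x] by (simp add: x_def)
qed

text \<open>
  Partial fractions in \<open>step_sum\<close>; by the reflection symmetry of the gap both fractions have the same
  mean.
\<close>

lemma Green_resolvent:
  assumes d: "d \<ge> 1" and w: "w \<in> slit_domain d"
  shows "Green d w = energy w * resolvent d (of_real d - energy w)"
proof -
  define E where "E = energy w"
  have w': "w \<notin> \<real>\<^sub>\<le>\<^sub>0" "w \<noteq> 0" using w by (auto simp: slit_domain_def)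
  have E0: "Re E > 0" unfolding E_def by (rule energy_Re_pos[OF w'(1)])
  then have E: "E \<noteq> 0" by auto
  have E2: "w = 1 / (4 * E\<^sup>2)" unfolding E_def using w' by (subst energy_square) auto
  define \<delta> where "\<delta> = (if Im E = 0 then Re E - real d else \<bar>Im E\<bar>)"
  have \<delta>: "\<delta> > 0" using energy_gt[OF d w] by (auto simp: \<delta>_def E_def)
  have sep: "\<delta> \<le> norm (E - of_real x)" if "\<bar>x\<bar> \<le> real d" for x
  proof (cases "Im E = 0")
    case True
    then show ?thesis using that complex_Re_le_cmod[of "E - of_real x"] by (auto simp: \<delta>_def abs_le_iff)
  next
    case False
    then show ?thesis using abs_Im_le_cmod[of "E - of_real x"] by (simp add: \<delta>_def)
  qed
  define g where "g = (\<lambda>u. E / (E - complex_of_real (real d - u)))"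
  have gm [measurable]: "g \<in> borel_measurable borel" unfolding g_def by measurable
  have gb: "norm (g u) \<le> norm E / \<delta>" if "0 \<le> u" "u \<le> 2 * real d" for u
    unfolding g_def norm_divide using sep[of "real d - u"] that \<delta> by (intro divide_left_mono mult_pos_pos) (auto simp: abs_le_iff)
  have int1: "integrable (angles d) (\<lambda>\<theta>. g (Gap d \<theta>))"
    by (rule anglesP.integrable_const_bound[where B = "norm E / \<delta>"]) (use gb Gap_bounds in auto)
  have int2: "integrable (angles d) (\<lambda>\<theta>. g (2 * real d - Gap d \<theta>))"
    by (rule anglesP.integrable_const_bound[where B = "norm E / \<delta>"]) (use gb Gap_bounds in auto)
  have "Green d w = (\<integral>\<theta>. (g (Gap d \<theta>) + g (2 * real d - Gap d \<theta>)) / 2 \<partial>angles d)"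
    unfolding Green_def
  proof (intro Bochner_Integration.integral_cong refl)
    fix \<theta>
    define x where "x = real d - Gap d \<theta>"
    have x: "\<bar>x\<bar> \<le> real d" using Gap_bounds[of d \<theta>] by (auto simp: x_def abs_le_iff)
    have ne1: "E - of_real x \<noteq> 0" using sep[OF x] \<delta> by auto
    have ne2: "E + of_real x \<noteq> 0" using sep[of "- x"] x \<delta> by auto
    have "1 / (1 - w * of_real ((step_sum d \<theta>)\<^sup>2)) = E\<^sup>2 / ((E - of_real x) * (E + of_real x))"
    proof -
      have "1 - w * of_real ((step_sum d \<theta>)\<^sup>2) = ((E - of_real x) * (E + of_real x)) / E\<^sup>2"
        using E unfolding E2 step_sum_def x_def[symmetric] by (simp add: field_simps power2_eq_square)
      then show ?thesis by simp
    qed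
    also have "\<dots> = (E / (E - of_real x) + E / (E + of_real x)) / 2"
    proof -
      have "E / (E - of_real x) + E / (E + of_real x) = (E * (E + of_real x) + E * (E - of_real x)) / ((E - of_real x) * (E + of_real x))"
        using ne1 ne2 by (rule add_frac_eq)
      also have "E * (E + of_real x) + E * (E - of_real x) = 2 * E\<^sup>2" by (simp add: power2_eq_square algebra_simps)
      finally show ?thesis by simp
    qed
    also have "E / (E + of_real x) = g (2 * real d - Gap d \<theta>)" by (simp add: g_def x_def algebra_simps)
    also have "E / (E - of_real x) = g (Gap d \<theta>)" by (simp add: g_def x_def)
    finally show "1 / (1 - w * of_real ((step_sum d \<theta>)\<^sup>2)) = (g (Gap d \<theta>) + g (2 * real d - Gap d \<theta>)) / 2" .
  qed
  also have "\<dots> = ((\<integral>\<theta>. g (Gap d \<theta>) \<partial>angles d) + (\<integral>\<theta>. g (2 * real d - Gap d \<theta>) \<partial>angles d)) / 2"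
    using int1 int2 by simp
  also have "\<dots> = (\<integral>\<theta>. g (Gap d \<theta>) \<partial>angles d)" by (simp add: integral_Gap_reflect)
  also have "\<dots> = (\<integral>\<theta>. E * (1 / (of_real (Gap d \<theta>) - (of_real d - E))) \<partial>angles d)"
    unfolding g_def by (intro Bochner_Integration.integral_cong) (auto simp: algebra_simps)
  also have "\<dots> = E * resolvent d (of_real d - E)" unfolding resolvent_def by (rule integral_mult_right_zero)
  finally show ?thesis by (simp add: E_def)
qed

lemma csqrt_uminus: "Im y > 0 \<Longrightarrow> csqrt (- y) = - \<i> * csqrt y"
proof (rule csqrt_unique)
  assume y: "Im y > 0"
  show "(- \<i> * csqrt y)\<^sup>2 = - y" by (simp add: power_mult_distrib del: csqrt.simps)
  have "Im y = 2 * Re (csqrt y) * Im (csqrt y)" by (metis Im_power2 power2_csqrt)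
  then have "Im (csqrt y) > 0" using y Re_csqrt[of y] by (metis mult_less_0_iff not_less_iff_gr_or_eq zero_less_mult_iff zero_less_numeral order_less_le)
  then show "0 < Re (- \<i> * csqrt y) \<or> Re (- \<i> * csqrt y) = 0 \<and> 0 \<le> Im (- \<i> * csqrt y)"
    by (simp del: csqrt.simps)
qed

text \<open>
  The constant factor \<open>2 \<pi> \<i> \<pi>\<^bsup>-(n+1)\<^esup>\<close> of the jump across the cut, with the power of \<open>- \<i>\<close> that
  arises when \<open>csqrt (- y)\<close> is replaced by \<open>- \<i> csqrt y\<close>.
\<close>

definition jump_const :: "nat \<Rightarrow> complex" where
  "jump_const n = 2 * of_real pi * \<i> * of_real ((1 / pi) ^ Suc n) * (- \<i>) ^ Suc n"

text \<open>
  Below the cut this is the continuation of \<^const>\<open>Green\<close> from above: \<^const>\<open>Green\<close> plus the residue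
  term \<open>2 \<pi> \<i> energy w * density_ext n (d - energy w)\<close>. The square root is taken of \<open>energy w - d\<close>
  instead of \<open>d - energy w\<close>, so that the formula is holomorphic on all of \<^const>\<open>slit_domain\<close>, in
  particular near the positive real axis close to \<open>0\<close>.
\<close>

definition second_sheet :: "nat \<Rightarrow> complex \<Rightarrow> complex" where
  "second_sheet n w = Green (Suc n) w - jump_const n * (energy w / (energy w - of_real (Suc n)) *
     (csqrt (energy w - of_real (Suc n)) ^ Suc n * Phi n (- (energy w - of_real (Suc n)))))"

lemma jump_const_nonzero: "jump_const n \<noteq> 0"
  by (simp add: jump_const_def)

lemma second_sheet_holomorphic: "second_sheet n holomorphic_on slit_domain (Suc n)"
proof -
  have sub: "energy w - of_real (Suc n) \<notin> \<real>\<^sub>\<le>\<^sub>0" if "w \<in> slit_domain (Suc n)" for w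
    using energy_gt[of "Suc n" w] that by (auto simp: complex_nonpos_Reals_iff)
  have sub0: "energy w - of_real (Suc n) \<noteq> 0" if "w \<in> slit_domain (Suc n)" for w
    using sub[OF that] by auto
  have eh: "energy holomorphic_on slit_domain (Suc n)"
    by (rule holomorphic_on_subset[OF energy_holomorphic]) (auto simp: slit_domain_def)
  have p: "(\<lambda>w. Phi n (- (energy w - of_real (Suc n)))) holomorphic_on slit_domain (Suc n)"
  proof (rule holomorphic_on_compose_gen[OF _ Phi_holomorphic, unfolded o_def])
    show "(\<lambda>w. - (energy w - of_real (Suc n))) holomorphic_on slit_domain (Suc n)" by (intro holomorphic_intros eh)
    show "(\<lambda>w. - (energy w - of_real (Suc n))) ` slit_domain (Suc n) \<subseteq> slit2"
      using energy_gt[of "Suc n"] by (force simp: slit2_def)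
  qed
  have "Green (Suc n) holomorphic_on slit_domain (Suc n)"
    by (rule holomorphic_on_subset[OF Green_holomorphic]) (auto simp: slit_domain_def)
  then show ?thesis
    unfolding second_sheet_def[abs_def] using sub sub0 p eh
    by (intro holomorphic_intros) auto
qed

lemma second_sheet_density:
  assumes w: "Im w < 0"
  shows "second_sheet n w = Green (Suc n) w + energy w * (2 * of_real pi * \<i> * density_ext n (of_real (Suc n) - energy w))"
proof -
  have w': "w \<notin> \<real>\<^sub>\<le>\<^sub>0" using w by (auto simp: complex_nonpos_Reals_iff)
  define y where "y = energy w - of_real (Suc n)"
  have y: "Im y > 0" using energy_Im_sign(2)[OF w' w] by (simp add: y_def)
  then have "y \<noteq> 0" by auto
  have "of_real (Suc n) - energy w = - y" by (simp add: y_def)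
  then have dn: "density_ext n (of_real (Suc n) - energy w) =
      of_real ((1 / pi) ^ Suc n) * ((- \<i>) ^ Suc n * csqrt y ^ Suc n) / (- y) * Phi n (- y)"
    unfolding density_ext_def csqrt_uminus[OF y] power_mult_distrib[symmetric] by (simp only:) (simp only: csqrt_uminus[OF y])
  show ?thesis
    unfolding second_sheet_def jump_const_def dn y_def[symmetric]
    using \<open>y \<noteq> 0\<close> by (simp add: field_simps del: of_nat_Suc power_Suc)
qed

text \<open>
  The point of the cut whose energy is \<open>d - a\<close>; there the gap resolvent is evaluated at \<open>a\<close>.
\<close>

definition cut_point :: "nat \<Rightarrow> real \<Rightarrow> real" where
  "cut_point d a = 1 / (2 * (real d - a))\<^sup>2"

lemma energy_cut_point: "a < real d \<Longrightarrow> energy (of_real (cut_point d a)) = of_real (real d - a)"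
proof -
  assume a: "a < real d"
  have "sqrt (cut_point d a) = 1 / (2 * (real d - a))"
    unfolding cut_point_def real_sqrt_divide real_sqrt_abs using a by simp
  moreover have "0 \<le> cut_point d a" by (simp add: cut_point_def)
  ultimately have c: "csqrt (of_real (cut_point d a)) = of_real (1 / (2 * (real d - a)))"
    by (simp only: csqrt_of_real)
  have "energy (of_real (cut_point d a)) = of_real (1 / (2 * (1 / (2 * (real d - a)))))"
    unfolding energy_def c by (simp only: of_real_divide of_real_mult of_real_1 of_real_numeral)
  also have "1 / (2 * (1 / (2 * (real d - a)))) = real d - a" using a by simp
  finally show ?thesis .
qed

lemma Green_continuation:
  assumes a: "0 < a" "a < 1"
  obtains F \<delta> where "\<delta> > 0" "F holomorphic_on ball (of_real (cut_point (Suc n) a)) \<delta>"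
    "\<And>w. w \<in> ball (of_real (cut_point (Suc n) a)) \<delta> \<Longrightarrow> Im w > 0 \<Longrightarrow> F w = Green (Suc n) w"
    "\<And>w. w \<in> ball (of_real (cut_point (Suc n) a)) \<delta> \<Longrightarrow> Im w < 0 \<Longrightarrow> F w = second_sheet n w"
proof -
  obtain R e where R: "e > 0" "R holomorphic_on ball (of_real a) e"
    "\<And>Y. Y \<in> ball (of_real a) e \<Longrightarrow> Im Y > 0 \<Longrightarrow> R Y = resolvent (Suc n) Y"
    "\<And>Y. Y \<in> ball (of_real a) e \<Longrightarrow> Im Y < 0 \<Longrightarrow> R Y = resolvent (Suc n) Y + 2 * of_real pi * \<i> * density_ext n Y"
    by (rule resolvent_continuation[OF a, of n]) (rule that)
  define x0 where "x0 = complex_of_real (cut_point (Suc n) a)"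
  define Y where "Y = (\<lambda>w. of_real (Suc n) - energy w)"
  have x0: "x0 \<in> - \<real>\<^sub>\<le>\<^sub>0" using a by (auto simp: x0_def cut_point_def complex_nonpos_Reals_iff)
  have Yx0: "Y x0 = of_real a" using a by (simp add: Y_def x0_def energy_cut_point)
  have Yh: "Y holomorphic_on - \<real>\<^sub>\<le>\<^sub>0" unfolding Y_def by (intro holomorphic_intros energy_holomorphic)
  have op: "open (- \<real>\<^sub>\<le>\<^sub>0 :: complex set)" by (rule open_Compl) (rule closed_nonpos_Reals_complex)
  have "open (- \<real>\<^sub>\<le>\<^sub>0 \<inter> Y -` ball (of_real a) e)"
    by (rule continuous_open_preimage[OF holomorphic_on_imp_continuous_on[OF Yh] op]) simp
  moreover have "x0 \<in> - \<real>\<^sub>\<le>\<^sub>0 \<inter> Y -` ball (of_real a) e" using x0 Yx0 R(1) by simp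
  ultimately obtain \<delta> where \<delta>: "\<delta> > 0" "ball x0 \<delta> \<subseteq> - \<real>\<^sub>\<le>\<^sub>0 \<inter> Y -` ball (of_real a) e"
    using open_contains_ball by blast
  have in_dom: "w \<in> slit_domain (Suc n)" if "Im w \<noteq> 0" for w
    using that by (auto simp: slit_domain_def cut_plane_def complex_nonpos_Reals_iff)
  have nn: "w \<notin> \<real>\<^sub>\<le>\<^sub>0" if "Im w \<noteq> 0" for w using that by (auto simp: complex_nonpos_Reals_iff)
  show thesis
  proof (rule that[of \<delta> "\<lambda>w. energy w * R (Y w)", folded x0_def])
    show "(\<lambda>w. energy w * R (Y w)) holomorphic_on ball x0 \<delta>"
      using \<delta>(2)
      by (intro holomorphic_intros holomorphic_on_subset[OF energy_holomorphic]
          holomorphic_on_compose_gen[OF holomorphic_on_subset[OF Yh] R(2), unfolded o_def]) auto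
    show "energy w * R (Y w) = Green (Suc n) w" if w: "w \<in> ball x0 \<delta>" "Im w > 0" for w
    proof -
      have "Im (Y w) > 0" using energy_Im_sign(1)[OF nn w(2)] w by (simp add: Y_def)
      then show ?thesis using R(3)[of "Y w"] w \<delta>(2) Green_resolvent[OF _ in_dom[of w]] by (auto simp: Y_def)
    qed
    show "energy w * R (Y w) = second_sheet n w" if w: "w \<in> ball x0 \<delta>" "Im w < 0" for w
    proof -
      have "Im (Y w) < 0" using energy_Im_sign(2)[OF nn w(2)] w by (simp add: Y_def)
      moreover have "Y w \<in> ball (of_real a) e" using w(1) \<delta>(2) by auto
      ultimately have "R (Y w) = resolvent (Suc n) (Y w) + 2 * of_real pi * \<i> * density_ext n (Y w)" by (intro R(4))
      moreover have "Green (Suc n) w = energy w * resolvent (Suc n) (Y w)"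
        unfolding Y_def using w(2) by (subst Green_resolvent[OF _ in_dom]) auto
      ultimately show ?thesis unfolding second_sheet_density[OF w(2)] Y_def by (simp add: distrib_left)
    qed
  qed (use \<delta> in auto)
qed

lemma cut_plane_scaleR:
  assumes d: "d \<ge> 1" and w: "w \<in> cut_plane d" and t: "0 \<le> t" "t \<le> 1"
  shows "t *\<^sub>R w \<in> cut_plane d"
proof -
  have "t * Re w < crit d" if "Re w < crit d"
  proof (cases "Re w \<le> 0")
    case True
    then have "t * Re w \<le> 0" using t by (simp add: mult_le_0_iff)
    then show ?thesis using crit_pos[OF d] by linarith
  next
    case False
    then have "t * Re w \<le> 1 * Re w" using t by (intro mult_right_mono) auto
    then show ?thesis using that by linarith
  qed
  then show ?thesis using w crit_pos[OF d] by (auto simp: cut_plane_def)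
qed

lemma connected_cut_plane:
  assumes d: "d \<ge> 1" shows "connected (cut_plane d)"
proof (rule starlike_imp_connected)
  show "starlike (cut_plane d)"
    unfolding starlike_def
  proof (intro bexI[of _ 0] ballI subsetI)
    show "0 \<in> cut_plane d" using crit_pos[OF d] by (simp add: cut_plane_def)
    show "z \<in> cut_plane d" if "w \<in> cut_plane d" "z \<in> closed_segment 0 w" for w z
      using that cut_plane_scaleR[OF d] by (auto simp: in_segment)
  qed
qed

lemma connected_ball_cut_plane: "d \<ge> 1 \<Longrightarrow> R > 0 \<Longrightarrow> connected (ball 0 R \<inter> cut_plane d)"
proof (rule starlike_imp_connected)
  assume d: "d \<ge> 1" and R: "R > 0"
  show "starlike (ball 0 R \<inter> cut_plane d)"
    unfolding starlike_def
  proof (intro bexI[of _ 0] ballI subsetI)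
    show "0 \<in> ball 0 R \<inter> cut_plane d" using crit_pos[OF d] R by (simp add: cut_plane_def)
    fix w z assume w: "w \<in> ball 0 R \<inter> cut_plane d" and "z \<in> closed_segment 0 w"
    then obtain t where t: "0 \<le> t" "t \<le> 1" "z = t *\<^sub>R w" by (auto simp: in_segment)
    have "norm z \<le> 1 * norm w" unfolding t(3) norm_scaleR using t by (intro mult_right_mono) auto
    moreover have "z \<in> cut_plane d" unfolding t(3) using w t by (intro cut_plane_scaleR[OF d]) auto
    ultimately show "z \<in> ball 0 R \<inter> cut_plane d" using w by auto
  qed
qed

text \<open>
  Suppose that \<open>B\<close> is holomorphic on a larger disc. Around a point of the cut inside this disc, \<open>1 - B\<close>
  inverts \<^const>\<open>Green\<close> on both sides, and by continuation from above it inverts \<^const>\<open>second_sheet\<close> below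
  the cut. So the two agree there and their difference, a nonzero multiple of \<open>Phi\<close>, vanishes; but
  \<open>Phi\<close> is positive at the gap of the chosen point.
\<close>

lemma radius_B:
  assumes d: "d \<ge> 1" shows "fps_conv_radius (B_series d) = ereal (crit d)"
proof (rule ccontr)
  assume "fps_conv_radius (B_series d) \<noteq> ereal (crit d)"
  then have "ereal (crit d) < fps_conv_radius (B_series d)" using radius_B_ge[OF d] by simp
  then obtain R where R: "ereal (crit d) < ereal R" "ereal R < fps_conv_radius (B_series d)"
    using ereal_dense2 by blast
  then have R': "crit d < R" "R > 0" using crit_pos[OF d] by auto
  obtain n where n: "d = Suc n" using d by (cases d) auto
  define b where "b = eval_fps (B_series d)"
  have bh: "b holomorphic_on ball 0 R"
    unfolding b_def using R(2) by (intro holomorphic_on_eval_fps ball_eball_mono) simp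
  have bG: "(1 - b w) * Green d w = 1" if w: "w \<in> ball 0 R \<inter> cut_plane d" for w
  proof (rule analytic_continuation_open[of "ball 0 (crit d)" "ball 0 R \<inter> cut_plane d" "\<lambda>w. (1 - b w) * Green d w" "\<lambda>_. 1"])
    show "connected (ball 0 R \<inter> cut_plane d)" using d R' by (intro connected_ball_cut_plane)
    show "ball 0 (crit d) \<subseteq> ball 0 R \<inter> cut_plane d" using ball_subset_cut_plane[OF d] R' by auto
    show "(\<lambda>w. (1 - b w) * Green d w) holomorphic_on ball 0 R \<inter> cut_plane d"
      by (intro holomorphic_intros holomorphic_on_subset[OF bh] holomorphic_on_subset[OF Green_holomorphic]) auto
    show "(1 - b z) * Green d z = 1" if "z \<in> ball 0 (crit d)" for z
      using that eval_B[OF d radius_B_ge[OF d], of z] Green_nonzero[OF d, of z] ball_subset_cut_plane[OF d]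
      by (auto simp: b_def)
  qed (use w crit_pos[OF d] in \<open>auto intro: open_cut_plane\<close>)
  have "((\<lambda>a. cut_point d a) \<longlongrightarrow> 1 / (2 * (real d - 0))\<^sup>2) (at_right 0)"
    unfolding cut_point_def using d by (intro tendsto_intros) auto
  then have "\<forall>\<^sub>F a in at_right 0. cut_point d a < R"
    using R'(1) by (intro order_tendstoD(2)) (auto simp: crit_def)
  moreover have "\<forall>\<^sub>F a in at_right (0::real). 0 < a \<and> a < 1"
    using eventually_at_right_field[of "\<lambda>a. 0 < a \<and> a < 1" 0] by (auto intro: exI[of _ 1])
  ultimately have "\<forall>\<^sub>F a in at_right 0. cut_point d a < R \<and> 0 < a \<and> a < 1" by eventually_elim simp
  then obtain a where a: "cut_point d a < R" "0 < a" "a < 1"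
    using eventually_happens[of _ "at_right (0::real)"] by (auto simp: trivial_limit_at_right_real)
  define x0 where "x0 = complex_of_real (cut_point d a)"
  obtain F \<delta> where F: "\<delta> > 0" "F holomorphic_on ball x0 \<delta>"
    "\<And>w. w \<in> ball x0 \<delta> \<Longrightarrow> Im w > 0 \<Longrightarrow> F w = Green d w"
    "\<And>w. w \<in> ball x0 \<delta> \<Longrightarrow> Im w < 0 \<Longrightarrow> F w = second_sheet n w"
    by (rule Green_continuation[OF a(2,3), of n, folded n, folded x0_def]) (rule that)
  have "norm x0 = \<bar>cut_point d a\<bar>" unfolding x0_def by (rule norm_of_real)
  moreover have "0 \<le> cut_point d a" by (simp add: cut_point_def)
  ultimately have x0R: "x0 \<in> ball 0 R" using a by (simp only: mem_ball_0 abs_of_nonneg)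
  have "open (ball x0 \<delta> \<inter> ball 0 R)" "x0 \<in> ball x0 \<delta> \<inter> ball 0 R" using x0R F(1) by auto
  then obtain \<epsilon> where \<epsilon>: "\<epsilon> > 0" "ball x0 \<epsilon> \<subseteq> ball x0 \<delta> \<inter> ball 0 R" by (rule openE)
  have off: "w \<in> cut_plane d" if "Im w \<noteq> 0" for w using that by (simp add: cut_plane_def)
  have nearby: "w \<in> ball x0 \<delta>" "w \<in> ball 0 R" if "w \<in> ball x0 \<epsilon>" for w using \<epsilon>(2) that by blast+
  have bF: "(1 - b w) * F w = 1" if w: "w \<in> ball x0 \<epsilon>" for w
  proof (rule analytic_continuation_open[of "ball x0 \<epsilon> \<inter> {z. Im z > 0}" "ball x0 \<epsilon>" "\<lambda>w. (1 - b w) * F w" "\<lambda>_. 1"])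
    have "x0 + \<i> * of_real (\<epsilon> / 2) \<in> ball x0 \<epsilon> \<inter> {z. Im z > 0}" using \<epsilon>(1) by (simp add: x0_def dist_norm norm_mult)
    then show "ball x0 \<epsilon> \<inter> {z. Im z > 0} \<noteq> {}" by blast
    show "(\<lambda>w. (1 - b w) * F w) holomorphic_on ball x0 \<epsilon>"
      using nearby by (intro holomorphic_intros holomorphic_on_subset[OF bh] holomorphic_on_subset[OF F(2)] subsetI)
    show "(1 - b z) * F z = 1" if "z \<in> ball x0 \<epsilon> \<inter> {z. Im z > 0}" for z
      using that nearby[of z] bG[of z] F(3)[of z] off[of z] by simp
  qed (use w in \<open>auto intro: open_halfspace_Im_gt\<close>)
  (* below the cut the difference of the two sheets has to vanish *)
  have P0: "Phi n (of_real d - energy w) = 0" if w: "w \<in> ball x0 \<epsilon>" "Im w < 0" for w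
  proof -
    have nn: "w \<notin> \<real>\<^sub>\<le>\<^sub>0" using w(2) by (auto simp: complex_nonpos_Reals_iff)
    have "(1 - b w) * Green d w = 1" "(1 - b w) * second_sheet n w = 1"
      using w nearby[of w] bG[of w] off[of w] bF[of w] F(4)[of w] by simp_all
    then have "Green d w = second_sheet n w" by (metis mult.left_commute mult.right_neutral mult.commute)
    then have "energy w * (2 * of_real pi * \<i> * density_ext n (of_real d - energy w)) = 0"
      unfolding second_sheet_density[OF w(2)] n by simp
    moreover have "energy w \<noteq> 0" using energy_Re_pos[OF nn] by auto
    ultimately have "density_ext n (of_real d - energy w) = 0" by simp
    moreover have "of_real d - energy w \<noteq> 0" using energy_Im_sign(2)[OF nn w(2)] by (auto simp: complex_eq_iff)
    ultimately show ?thesis by (simp add: density_ext_def)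
  qed
  have x0n: "x0 \<notin> \<real>\<^sub>\<le>\<^sub>0" using a d by (auto simp: x0_def cut_point_def complex_nonpos_Reals_iff)
  have ex0: "of_real d - energy x0 = of_real a" using a d by (simp add: x0_def energy_cut_point)
  have c1: "isCont (\<lambda>w. of_real d - energy w) x0"
    using x0n energy_holomorphic holomorphic_on_imp_continuous_on[of energy "- \<real>\<^sub>\<le>\<^sub>0"] closed_nonpos_Reals_complex
    by (intro continuous_intros) (auto simp: continuous_on_eq_continuous_at open_Compl)
  have c2: "isCont (Phi n) (of_real a)"
    using continuous_on_Phi[of n] open_slit2 of_real_slit2[of a] a by (simp add: continuous_on_eq_continuous_at)
  have c3: "isCont (\<lambda>w. Phi n (of_real d - energy w)) x0"
    using isCont_o2[OF c1, of "Phi n"] c2 ex0 by simp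
  have "((\<lambda>t. x0 - \<i> * of_real t) \<longlongrightarrow> x0 - \<i> * of_real 0) (at_right 0)" by (intro tendsto_intros)
  then have "((\<lambda>t. Phi n (of_real d - energy (x0 - \<i> * of_real t))) \<longlongrightarrow> Phi n (of_real d - energy x0)) (at_right 0)"
    using isCont_tendsto_compose[OF c3] by simp
  moreover have "\<forall>\<^sub>F t in at_right 0. Phi n (of_real d - energy (x0 - \<i> * of_real t)) = 0"
  proof -
    have "\<forall>\<^sub>F t in at_right (0::real). 0 < t \<and> t < \<epsilon>"
      using eventually_at_right_field[of "\<lambda>t. 0 < t \<and> t < \<epsilon>" 0] \<epsilon>(1) by auto
    then show ?thesis
    proof eventually_elim
      case (elim t)
      then show ?case by (intro P0) (auto simp: x0_def dist_norm norm_mult)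
    qed
  qed
  then have "((\<lambda>t. Phi n (of_real d - energy (x0 - \<i> * of_real t))) \<longlongrightarrow> 0) (at_right 0)" by (rule tendsto_eventually)
  ultimately have "Phi n (of_real d - energy x0) = 0"
    by (intro tendsto_unique[OF trivial_limit_at_right_real])
  then have "Phi n (of_real a) = 0" by (simp only: ex0)
  then show False using phi_pos[of a n] a by (simp add: Phi_of_real)
qed

section \<open>Logarithmic growth of the convolution integrals\<close>

lemma sin_ge_half:
  assumes "0 \<le> t" "t \<le> pi/4" shows "t / 2 \<le> sin t"
proof -
  have "(\<lambda>t. sin t - t / 2) 0 \<le> (\<lambda>t. sin t - t / 2) t"
  proof (rule DERIV_nonneg_imp_nondecreasing[of 0 t "\<lambda>t. sin t - t / 2"])
    fix x assume x: "0 \<le> x" "x \<le> t"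
    have "cos (pi/3) \<le> cos x" using x assms by (intro cos_monotone_0_pi_le) auto
    then have "0 \<le> cos x - 1/2" by (simp add: cos_60)
    moreover have "((\<lambda>t. sin t - t / 2) has_real_derivative (cos x - 1/2)) (at x)"
      by (auto intro!: derivative_eq_intros)
    ultimately show "\<exists>y. ((\<lambda>t. sin t - t / 2) has_real_derivative y) (at x) \<and> 0 \<le> y" by blast
  qed fact
  then show ?thesis by simp
qed

lemma cos_quarter:
  assumes "0 \<le> t" "t \<le> pi/4" shows "1 / sqrt 2 \<le> cos t" "1/2 \<le> (cos t)\<^sup>2"
proof -
  have "cos (pi/4) \<le> cos t" using assms by (intro cos_monotone_0_pi_le) auto
  moreover have "1 / sqrt 2 = sqrt 2 / 2" by (simp add: field_simps)
  ultimately show a: "1 / sqrt 2 \<le> cos t" by (simp only: cos_45)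
  have "(1 / sqrt 2)\<^sup>2 \<le> (cos t)\<^sup>2" using a by (intro power_mono) auto
  then show "1/2 \<le> (cos t)\<^sup>2" by (simp add: power_divide)
qed

text \<open>
  What is needed of \<open>v \<mapsto> phi n (- v)\<close>: it decreases, but not faster than \<open>v\<^bsup>-(n+1)/2\<^esup>\<close>.
\<close>

locale scaling_kernel =
  fixes a :: "real \<Rightarrow> real" and p :: nat
  assumes pos: "0 \<le> v \<Longrightarrow> 0 < a v"
    and decr: "0 \<le> v \<Longrightarrow> v \<le> v' \<Longrightarrow> a v' \<le> a v"
    and scaled_incr: "0 \<le> v \<Longrightarrow> v \<le> v' \<Longrightarrow> sqrt v ^ Suc p * a v \<le> sqrt v' ^ Suc p * a v'"
    and cont: "continuous_on {0..} a"

lemma scaling_kernel_phi: "scaling_kernel (\<lambda>v. phi n (- v)) n"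
proof
  show "0 < phi n (- v)" if "0 \<le> v" for v using that by (intro phi_pos) auto
  show "phi n (- v') \<le> phi n (- v)" if "0 \<le> v" "v \<le> v'" for v v' using that by (intro phi_mono) auto
  show "sqrt v ^ Suc n * phi n (- v) \<le> sqrt v' ^ Suc n * phi n (- v')" if "0 \<le> v" "v \<le> v'" for v v'
    using phi_scaled_mono[of v v' 1 n] that by simp
  show "continuous_on {0..} (\<lambda>v. phi n (- v))"
    by (intro continuous_on_compose2[OF continuous_on_phi] continuous_intros) auto
qed

text \<open>
  The recursion for \<open>phi (n+1) (- v)\<close> integrates a product of two such kernels. For large \<open>v\<close> each
  end of \<open>[0, pi/2]\<close> contributes, outside a neighbourhood of width \<open>L / sqrt v\<close>, at least a multiple
  of the integral of \<open>1 / t\<close>, hence an additional logarithm. The neighbourhoods themselves contribute no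
  such logarithm and are negligible.
\<close>

locale kernel_pair = A: scaling_kernel a p + B: scaling_kernel b q for a b p q
begin

definition integrand :: "real \<Rightarrow> real \<Rightarrow> real" where
  "integrand v t = sin t ^ p * a (v * (sin t)\<^sup>2) * (cos t ^ q * b (v * (cos t)\<^sup>2))"

lemma integrand_cont: "0 \<le> v \<Longrightarrow> continuous_on S (integrand v)"
  unfolding integrand_def
  by (intro continuous_intros continuous_on_compose2[OF A.cont] continuous_on_compose2[OF B.cont]) auto

lemma integrand_int: "0 \<le> v \<Longrightarrow> integrand v integrable_on {x..y}"
  by (intro integrable_continuous_interval integrand_cont)

lemma integrand_nonneg: "0 \<le> v \<Longrightarrow> 0 \<le> t \<Longrightarrow> t \<le> pi/2 \<Longrightarrow> 0 \<le> integrand v t"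
  unfolding integrand_def using A.pos[of "v * (sin t)\<^sup>2"] B.pos[of "v * (cos t)\<^sup>2"] sin_pi_half_nonneg[of t] cos_pi_half_nonneg[of t]
  by (intro mult_nonneg_nonneg zero_le_power) auto

lemma near_zero_upper:
  assumes v: "0 < v" and L: "0 < L" and T: "L / sqrt v \<le> pi/4"
  shows "integral {0..L / sqrt v} (integrand v) \<le> sqrt 2 ^ Suc q * b v * (a 0 * (L / sqrt v) ^ Suc p)"
proof -
  define T where "T = L / sqrt v"
  have T0: "0 < T" "T \<le> pi/4" using v L T by (auto simp: T_def)
  have b2: "b (v/2) \<le> sqrt 2 ^ Suc q * b v"
  proof -
    have "sqrt (v/2) ^ Suc q * b (v/2) \<le> sqrt v ^ Suc q * b v"
      using v by (intro B.scaled_incr) auto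
    moreover have "sqrt v = sqrt 2 * sqrt (v/2)" by (simp flip: real_sqrt_mult)
    ultimately have "sqrt (v/2) ^ Suc q * b (v/2) \<le> sqrt (v/2) ^ Suc q * (sqrt 2 ^ Suc q * b v)"
      by (simp add: power_mult_distrib mult_ac)
    then show ?thesis using v by (subst (asm) mult_le_cancel_left_pos) auto
  qed
  have bd: "integrand v t \<le> T ^ p * a 0 * (sqrt 2 ^ Suc q * b v)" if t: "t \<in> {0..T}" for t
  proof -
    have t': "0 \<le> t" "t \<le> pi/4" "t \<le> pi/2" using t T0 by auto
    have s: "0 \<le> sin t" "sin t \<le> T" using sin_pi_half_nonneg t' sin_x_le_x[of t] t by auto
    have c: "0 \<le> cos t" "cos t \<le> 1" using cos_pi_half_nonneg t' by auto
    have "v / 2 \<le> v * (cos t)\<^sup>2" using cos_quarter(2)[OF t'(1,2)] v by simp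
    then have "b (v * (cos t)\<^sup>2) \<le> b (v / 2)" using v by (intro B.decr) auto
    then have b3: "b (v * (cos t)\<^sup>2) \<le> sqrt 2 ^ Suc q * b v" using b2 by linarith
    have "cos t ^ q * b (v * (cos t)\<^sup>2) \<le> 1 * (sqrt 2 ^ Suc q * b v)"
      using c b3 v B.pos[of v] B.pos[of "v * (cos t)\<^sup>2"] by (intro mult_mono power_le_one) auto
    moreover have "sin t ^ p * a (v * (sin t)\<^sup>2) \<le> T ^ p * a 0"
      using s v A.decr[of 0 "v * (sin t)\<^sup>2"] A.pos[of "v * (sin t)\<^sup>2"] T0 by (intro mult_mono power_mono) auto
    moreover have "0 \<le> T ^ p * a 0" "0 \<le> cos t ^ q * b (v * (cos t)\<^sup>2)"
      using c v A.pos[of 0] B.pos[of "v * (cos t)\<^sup>2"] T0 by auto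
    ultimately show ?thesis unfolding integrand_def
      by (metis mult_1 mult_mono)
  qed
  have "integral {0..T} (integrand v) \<le> integral {0..T} (\<lambda>_. T ^ p * a 0 * (sqrt 2 ^ Suc q * b v))"
    using v by (intro integral_le integrand_int bd) auto
  also have "\<dots> = sqrt 2 ^ Suc q * b v * (a 0 * T ^ Suc p)" using T0 by simp
  finally show ?thesis by (simp add: T_def)
qed

text \<open>
  On \<open>[L / sqrt v, pi/4]\<close> the scaled monotonicity bounds the integrand from below by a multiple of \<open>1 / t\<close>.
\<close>

lemma total_lower:
  assumes v: "0 < v" and L: "0 < L" and T: "L / sqrt v \<le> pi/4"
  shows "(1 / sqrt 2) ^ q * b v * ((L/2) ^ Suc p * a (L\<^sup>2 / 4) / sqrt v ^ Suc p * (ln (pi/4) - ln (L / sqrt v)))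
     \<le> integral {0..pi/2} (integrand v)"
proof -
  define T where "T = L / sqrt v"
  have T0: "0 < T" "T \<le> pi/4" using v L T by (auto simp: T_def)
  define k where "k = (1 / sqrt 2) ^ q * b v * ((L/2) ^ Suc p * a (L\<^sup>2 / 4) / sqrt v ^ Suc p)"
  have bd: "k * (1 / t) \<le> integrand v t" if t: "t \<in> {T..pi/4}" for t
  proof -
    have t': "0 < t" "t \<le> pi/4" "t \<le> pi/2" "T \<le> t" using t T0 by auto
    have "T / 2 \<le> sin T" using T0 by (intro sin_ge_half) auto
    also have "sin T \<le> sin t" using t' T0 by (intro sin_monotone_2pi_le) auto
    finally have st: "T / 2 \<le> sin t" .
    then have s0: "0 < sin t" using T0 by linarith
    have sv: "sqrt (v * (sin t)\<^sup>2) = sqrt v * sin t" using s0 v by (simp add: real_sqrt_mult)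
    have L2: "L\<^sup>2 / 4 = v * (T / 2)\<^sup>2" using v by (simp add: T_def power_divide)
    have "v * (T / 2)\<^sup>2 \<le> v * (sin t)\<^sup>2" using st T0 v by (intro mult_left_mono power_mono) auto
    then have "sqrt (L\<^sup>2 / 4) ^ Suc p * a (L\<^sup>2 / 4) \<le> sqrt (v * (sin t)\<^sup>2) ^ Suc p * a (v * (sin t)\<^sup>2)"
      unfolding L2[symmetric] by (intro A.scaled_incr) auto
    moreover have "sqrt (L\<^sup>2 / 4) = L / 2" using L by (simp add: real_sqrt_divide)
    ultimately have "(L/2) ^ Suc p * a (L\<^sup>2 / 4) \<le> sqrt v ^ Suc p * sin t * (sin t ^ p * a (v * (sin t)\<^sup>2))"
      unfolding sv by (simp add: power_mult_distrib mult_ac)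
    then have "(L/2) ^ Suc p * a (L\<^sup>2 / 4) / sqrt v ^ Suc p \<le> sin t * (sin t ^ p * a (v * (sin t)\<^sup>2))"
      using v by (subst pos_divide_le_eq) (auto simp: mult_ac)
    also have "\<dots> \<le> t * (sin t ^ p * a (v * (sin t)\<^sup>2))"
      using s0 v t' sin_x_le_x[of t] A.pos[of "v * (sin t)\<^sup>2"] by (intro mult_right_mono) auto
    finally have 0: "(L/2) ^ Suc p * a (L\<^sup>2 / 4) / sqrt v ^ Suc p \<le> t * (sin t ^ p * a (v * (sin t)\<^sup>2))" .
    have div: "X * (1 / t) \<le> Y" if "X \<le> t * Y" for X Y
      using that t'(1) by (simp add: pos_divide_le_eq mult.commute)
    note 1 = div[OF 0]
    have bb: "b v \<le> b (v * (cos t)\<^sup>2)" using v by (intro B.decr) (auto simp: mult_le_cancel_left1 abs_square_le_1)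
    have 2: "(1 / sqrt 2) ^ q * b v \<le> cos t ^ q * b (v * (cos t)\<^sup>2)"
    proof (rule mult_mono)
      show "(1 / sqrt 2) ^ q \<le> cos t ^ q" using cos_quarter(1)[of t] t' by (intro power_mono) auto
      show "0 \<le> cos t ^ q" using cos_pi_half_nonneg[of t] t' by simp
    qed (use v B.pos[of v] bb in auto)
    have "k * (1/t) = ((L/2) ^ Suc p * a (L\<^sup>2 / 4) / sqrt v ^ Suc p * (1 / t)) * ((1 / sqrt 2) ^ q * b v)"
      by (simp add: k_def)
    also have "\<dots> \<le> integrand v t" unfolding integrand_def
      using s0 v A.pos[of "v * (sin t)\<^sup>2"] B.pos[of v] by (intro mult_mono[OF 1 2]) auto
    finally show ?thesis .
  qed
  have I: "((\<lambda>t. k * (1 / t)) has_integral (k * ln (pi/4) - k * ln T)) {T..pi/4}"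
    using T0 by (intro fundamental_theorem_of_calculus)
      (auto intro!: derivative_eq_intros simp: has_real_derivative_iff_has_vector_derivative[symmetric])
  have "k * ln (pi/4) - k * ln T = integral {T..pi/4} (\<lambda>t. k * (1 / t))"
    using I by (simp add: integral_unique)
  also have "\<dots> \<le> integral {T..pi/4} (integrand v)"
    using v I by (intro integral_le integrand_int bd) auto
  also have "\<dots> \<le> integral {0..pi/2} (integrand v)"
    using v T0 integrand_nonneg[of v] by (intro integral_subset_le integrand_int) auto
  finally show ?thesis by (simp only: k_def T_def right_diff_distrib mult.assoc)
qed

lemma near_zero_negligible:
  assumes L: "0 < L" and e: "0 < e"
  shows "\<forall>\<^sub>F v in at_top. integral {0..L / sqrt v} (integrand v) \<le> e * integral {0..pi/2} (integrand v)"
proof -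
  define c where "c = (L/2) ^ Suc p * a (L\<^sup>2 / 4) * (1 / sqrt 2) ^ q"
  have c: "c > 0" using L A.pos[of "L\<^sup>2 / 4"] by (simp add: c_def)
  define K where "K = sqrt 2 ^ Suc q * a 0 * L ^ Suc p / (e * c)"
  have lim: "filterlim (\<lambda>v. ln (pi/4) - ln (L / sqrt v)) at_top at_top"
    using L by real_asymp
  have "\<forall>\<^sub>F v in at_top. K \<le> ln (pi/4) - ln (L / sqrt v)"
    using lim by (simp add: filterlim_at_top)
  moreover have "\<forall>\<^sub>F v in at_top. L / sqrt v \<le> pi/4"
  proof -
    have "((\<lambda>v. L / sqrt v) \<longlongrightarrow> 0) at_top" by real_asymp
    then have "\<forall>\<^sub>F v in at_top. L / sqrt v < pi/4" by (rule order_tendstoD) simp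
    then show ?thesis by eventually_elim simp
  qed
  moreover have "\<forall>\<^sub>F v in at_top. v > (0::real)" by (rule eventually_gt_at_top)
  ultimately show ?thesis
  proof eventually_elim
    case (elim v)
    define M where "M = ln (pi/4) - ln (L / sqrt v)"
    have b: "b v > 0" using elim by (intro B.pos) auto
    have sv: "sqrt v ^ Suc p > 0" using elim by simp
    have "integral {0..L / sqrt v} (integrand v) \<le> sqrt 2 ^ Suc q * b v * (a 0 * (L / sqrt v) ^ Suc p)"
      using elim L by (intro near_zero_upper) auto
    also have "\<dots> = K * (e * c) * (b v / sqrt v ^ Suc p)"
      using e c by (simp add: K_def power_divide)
    also have "\<dots> \<le> M * (e * c) * (b v / sqrt v ^ Suc p)"
      using elim e c b sv by (intro mult_right_mono) (auto simp: M_def)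
    also have "\<dots> = e * ((1 / sqrt 2) ^ q * b v * ((L/2) ^ Suc p * a (L\<^sup>2 / 4) / sqrt v ^ Suc p * M))"
      by (simp add: c_def)
    also have "\<dots> \<le> e * integral {0..pi/2} (integrand v)"
      unfolding M_def using elim L e by (intro mult_left_mono total_lower) auto
    finally show ?case .
  qed
qed

text \<open>
  The lower bound with \<open>L = 1\<close>: the power of \<open>v\<close> is compensated and a logarithm remains.
\<close>

lemma total_diverges:
  "filterlim (\<lambda>v. sqrt v ^ (Suc p + Suc q) * integral {0..pi/2} (integrand v)) at_top at_top"
proof -
  define c where "c = (1/2) ^ Suc p * a (1/4) * (1 / sqrt 2) ^ q * b 1"
  have c: "c > 0" using A.pos[of "1 / 4"] B.pos[of 1] by (simp add: c_def)
  have "filterlim (\<lambda>v. c * (ln (pi/4) - ln (1 / sqrt v))) at_top at_top"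
    using c by real_asymp
  then show ?thesis
  proof (rule filterlim_at_top_mono)
    have "((\<lambda>v. 1 / sqrt v) \<longlongrightarrow> 0) at_top" by real_asymp
    then have "\<forall>\<^sub>F v in at_top. 1 / sqrt v < pi/4" by (rule order_tendstoD) simp
    moreover have "\<forall>\<^sub>F v in at_top. v \<ge> (1::real)" by (rule eventually_ge_at_top)
    ultimately show "\<forall>\<^sub>F v in at_top. c * (ln (pi/4) - ln (1 / sqrt v)) \<le> sqrt v ^ (Suc p + Suc q) * integral {0..pi/2} (integrand v)"
    proof eventually_elim
      case (elim v)
      define M where "M = ln (pi/4) - ln (1 / sqrt v)"
      have M: "M \<ge> 0" using elim by (simp add: M_def)
      have sv: "sqrt v ^ Suc p > 0" using elim by simp
      have "sqrt 1 ^ Suc q * b 1 \<le> sqrt v ^ Suc q * b v" using elim by (intro B.scaled_incr) auto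
      then have "b 1 * ((1/2) ^ Suc p * a (1/4) * (1 / sqrt 2) ^ q * M)
          \<le> (sqrt v ^ Suc q * b v) * ((1/2) ^ Suc p * a (1/4) * (1 / sqrt 2) ^ q * M)"
        using M A.pos[of "1/4"] by (intro mult_right_mono) auto
      also have "\<dots> = sqrt v ^ (Suc p + Suc q) * ((1 / sqrt 2) ^ q * b v * ((1/2) ^ Suc p * a (1\<^sup>2 / 4) / sqrt v ^ Suc p * M))"
        using sv unfolding power_add by (simp add: field_simps)
      also have "\<dots> \<le> sqrt v ^ (Suc p + Suc q) * integral {0..pi/2} (integrand v)"
        unfolding M_def using elim by (intro mult_left_mono total_lower) auto
      finally show ?case by (simp add: c_def M_def mult_ac)
    qed
  qed
qed

end

section \<open>The kernels along complex directions\<close>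

text \<open>
  If \<open>Phi n (- v)\<close> were homogeneous of degree \<open>- (n+1)/2\<close>, then \<open>scaled_Phi n l v\<close> would not depend on \<open>l\<close>.
  Up to logarithms it is, and so \<open>scaled_Phi n l v\<close> is for large \<open>v\<close> relatively close to its value
  \<open>phi n (- v)\<close> at \<open>l = 1\<close>.
\<close>

definition scaled_Phi :: "nat \<Rightarrow> complex \<Rightarrow> real \<Rightarrow> complex" where
  "scaled_Phi n l v = csqrt l ^ Suc n * Phi n (- l * of_real v)"

lemma slit2_ball:
  assumes "l \<in> cball 1 (1/2)" "0 \<le> v" shows "- l * of_real v \<in> slit2"
proof -
  have "\<bar>Re (1 - l)\<bar> \<le> 1/2" using assms abs_Re_le_cmod[of "1 - l"] by (simp add: dist_norm)
  then have "Re (1 - l) \<le> 1/2" by linarith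
  then have "Re l \<ge> 0" by simp
  then have "0 \<le> Re l * v" using assms by simp
  then show ?thesis by (simp add: slit2_def)
qed

lemma integral_reflect_end:
  fixes f :: "real \<Rightarrow> real"
  shows "integral {c - T..c} f = integral {0..T} (\<lambda>t. f (c - t))"
proof -
  have "integral {c - T..c} f = integral {(c - T) - c..c - c} (\<lambda>x. f (x + c))"
    by (rule integral_shift_real_ivl[symmetric])
  also have "\<dots> = integral {-T..-0} (\<lambda>x. (\<lambda>t. f (c - t)) (-x))" by (simp add: add.commute)
  also have "\<dots> = integral {0..T} (\<lambda>t. f (c - t))" by (rule Henstock_Kurzweil_Integration.integral_reflect_real[where f = "\<lambda>t. f (c - t)"])
  finally show ?thesis .
qed

text \<open>
  The ratio \<open>x\<close> of \<open>scaled_Phi 0 l v\<close> and \<open>phi 0 (- v)\<close> satisfies \<open>x\<^sup>2 - 1 = 2 (l - 1) / (2 + l v)\<close> and has nonnegative real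
  part, so that \<open>\<bar>x - 1\<bar> \<le> \<bar>x\<^sup>2 - 1\<bar>\<close>.
\<close>

lemma scaled_Phi_0_close:
  assumes l: "l \<in> cball 1 (1/2)" and v: "0 \<le> v"
  shows "norm (scaled_Phi 0 l v - of_real (phi 0 (- v))) \<le> 1 / (2 + v / 2) * phi 0 (- v)"
proof -
  define u where "u = phi 0 (- v)"
  have u: "u = 1 / sqrt (2 + v)" "u > 0" using v by (auto simp: u_def phi_0)
  define s where "s = csqrt (2 + l * of_real v)"
  have nl: "norm (l - 1) \<le> 1/2" using l by (simp add: dist_norm norm_minus_commute)
  have "\<bar>Re (l - 1)\<bar> \<le> 1/2" using abs_Re_le_cmod[of "l - 1"] nl by linarith
  then have rl: "Re l \<ge> 1/2" by (simp add: abs_if split: if_splits)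
  have r2: "Re (2 + l * of_real v) \<ge> 2 + v/2" using rl v mult_right_mono[of "1/2" "Re l" v] by simp
  have ne: "2 + l * of_real v \<noteq> 0"
  proof
    assume "2 + l * of_real v = 0"
    then have "Re (2 + l * of_real v) = 0" by simp
    then show False using r2 v by linarith
  qed
  then have s0: "s \<noteq> 0" by (simp add: s_def)
  have z: "scaled_Phi 0 l v = csqrt l / s" by (simp add: scaled_Phi_def Phi.simps(1) s_def)
  define x where "x = csqrt l / s / of_real u"
  have x2: "x\<^sup>2 = l * (2 + of_real v) / (2 + l * of_real v)"
  proof -
    have "(complex_of_real u)\<^sup>2 = of_real (1 / (2 + v))"
      using v by (simp add: u power_divide flip: of_real_power)
    then show ?thesis by (simp add: x_def s_def power_divide power_mult_distrib)
  qed
  have x21: "x\<^sup>2 - 1 = 2 * (l - 1) / (2 + l * of_real v)"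
    unfolding x2 using ne by (simp add: field_simps)
  have quarter: "\<bar>Im (csqrt w)\<bar> \<le> Re (csqrt w)" if "Re w \<ge> 0" for w
  proof -
    have "Re w = (Re (csqrt w))\<^sup>2 - (Im (csqrt w))\<^sup>2"
      by (metis Re_power2 power2_csqrt)
    then have "(Im (csqrt w))\<^sup>2 \<le> (Re (csqrt w))\<^sup>2" using that by linarith
    then show ?thesis using Re_csqrt[of w] abs_le_square_iff[of "Im (csqrt w)" "Re (csqrt w)"] by (simp del: csqrt.simps)
  qed
  have Rx: "0 \<le> Re x"
  proof -
    have q: "\<bar>Im (csqrt l)\<bar> \<le> Re (csqrt l)" "\<bar>Im s\<bar> \<le> Re s"
      using quarter[of l] quarter[of "2 + l * of_real v"] rl r2 v by (auto simp: s_def)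
    have "\<bar>Im (csqrt l) * Im s\<bar> \<le> Re (csqrt l) * Re s"
      unfolding abs_mult using q by (intro mult_mono) (auto simp del: csqrt.simps intro: Re_csqrt abs_ge_zero[THEN order_trans])
    then have "0 \<le> Re (csqrt l) * Re s + Im (csqrt l) * Im s" by linarith
    then have "0 \<le> Re (csqrt l / s)" by (simp add: Re_divide)
    then show ?thesis unfolding x_def using u(2) by (simp only: Re_divide_of_real divide_nonneg_pos)
  qed
  have "norm (x - 1) \<le> norm (x - 1) * norm (x + 1)"
  proof -
    have "1 \<le> Re (x + 1)" using Rx by simp
    also have "\<dots> \<le> norm (x + 1)" by (rule complex_Re_le_cmod)
    finally show ?thesis by (simp add: mult_le_cancel_left1)
  qed
  also have "\<dots> = norm (x\<^sup>2 - 1)" by (simp add: norm_mult[symmetric] power2_eq_square algebra_simps)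
  also have "\<dots> = 2 * norm (l - 1) / norm (2 + l * of_real v)" by (simp only: x21 norm_divide norm_mult norm_numeral)
  also have "\<dots> \<le> 1 / (2 + v / 2)"
    using nl r2 complex_Re_le_cmod[of "2 + l * of_real v"] v by (intro frac_le) auto
  finally have 1: "norm (x - 1) \<le> 1 / (2 + v / 2)" .
  have "scaled_Phi 0 l v - of_real u = (x - 1) * of_real u"
    using u(2) by (simp add: z x_def field_simps)
  then have "norm (scaled_Phi 0 l v - of_real u) = norm (x - 1) * u"
    using u(2) by (simp add: norm_mult)
  also have "\<dots> \<le> 1 / (2 + v / 2) * u" using 1 u(2) by (intro mult_right_mono) auto
  finally show ?thesis by (simp add: u_def)
qed

lemma product_relative_error:
  fixes x y :: complex and a b :: real
  assumes "norm (x - of_real a) \<le> e * a" "norm (y - of_real b) \<le> f * b" "0 \<le> a" "0 \<le> b" "0 \<le> e" "0 \<le> f"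
  shows "norm (x * y - of_real (a * b)) \<le> ((1 + e) * (1 + f) - 1) * (a * b)"
proof -
  have "x * y - of_real (a * b) = (x - of_real a) * (y - of_real b) + of_real a * (y - of_real b) + (x - of_real a) * of_real b"
    by (simp add: algebra_simps)
  also have "norm \<dots> \<le> norm (x - of_real a) * norm (y - of_real b) + a * norm (y - of_real b) + norm (x - of_real a) * b"
    using assms by (intro order_trans[OF norm_triangle_ineq] add_mono order_trans[OF norm_triangle_ineq]) (auto simp: norm_mult)
  also have "\<dots> \<le> (e * a) * (f * b) + a * (f * b) + (e * a) * b"
    using assms by (intro add_mono mult_mono) auto
  finally show ?thesis by (simp add: algebra_simps)
qed

lemma scaled_Phi_Suc:
  "scaled_Phi (Suc n) l v = 2 * integral {0..pi/2}
     (\<lambda>t. of_real (cos t ^ n) * (scaled_Phi 0 l (v * (sin t)\<^sup>2) * scaled_Phi n l (v * (cos t)\<^sup>2)))"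
proof -
  have "scaled_Phi (Suc n) l v = 2 * (csqrt l ^ Suc (Suc n) * integral {0..pi/2} (\<lambda>t. of_real (cos t ^ n) *
     (Phi 0 (- l * of_real v * of_real ((sin t)\<^sup>2)) * Phi n (- l * of_real v * of_real ((cos t)\<^sup>2)))))"
    unfolding scaled_Phi_def Phi.simps(2) by (simp only: mult.left_commute)
  also have "\<dots> = 2 * integral {0..pi/2} (\<lambda>t. csqrt l ^ Suc (Suc n) * (of_real (cos t ^ n) *
     (Phi 0 (- l * of_real v * of_real ((sin t)\<^sup>2)) * Phi n (- l * of_real v * of_real ((cos t)\<^sup>2)))))"
    by simp
  finally show ?thesis by (simp add: scaled_Phi_def mult_ac)
qed

lemma scaled_Phi_continuous:
  assumes "l \<in> cball 1 (1/2)" "0 \<le> v"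
  shows "continuous_on S (\<lambda>t. of_real (cos t ^ n) * (scaled_Phi 0 l (v * (sin t)\<^sup>2) * scaled_Phi n l (v * (cos t)\<^sup>2)))"
  unfolding scaled_Phi_def
  by (intro continuous_intros continuous_on_compose2[OF continuous_on_Phi])
     (use assms in \<open>auto intro!: slit2_ball[unfolded mult_minus_left] simp del: of_real_mult\<close>)

context fixes n :: nat
begin

interpretation K0: scaling_kernel "\<lambda>v. phi 0 (- v)" 0 by (rule scaling_kernel_phi)
interpretation Kn: scaling_kernel "\<lambda>v. phi n (- v)" n by (rule scaling_kernel_phi)
interpretation P: kernel_pair "\<lambda>v. phi 0 (- v)" "\<lambda>v. phi n (- v)" 0 n ..
interpretation Q: kernel_pair "\<lambda>v. phi n (- v)" "\<lambda>v. phi 0 (- v)" n 0 ..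

lemma phi_Suc_integrand: "0 \<le> v \<Longrightarrow> phi (Suc n) (- v) = 2 * integral {0..pi/2} (P.integrand v)"
  by (subst phi_Suc) (auto simp: P.integrand_def mult_ac intro!: integral_cong)

lemma integrand_swap: "P.integrand v (pi/2 - t) = Q.integrand v t"
  by (simp add: P.integrand_def Q.integrand_def sin_diff cos_diff mult_ac)

lemma phi_growth_Suc: "filterlim (\<lambda>v. sqrt v ^ Suc (Suc n) * phi (Suc n) (- v)) at_top at_top"
proof (rule filterlim_at_top_mono[OF P.total_diverges])
  show "\<forall>\<^sub>F v in at_top. sqrt v ^ (Suc 0 + Suc n) * integral {0..pi/2} (P.integrand v) \<le> sqrt v ^ Suc (Suc n) * phi (Suc n) (- v)"
    using eventually_ge_at_top[of 0]
  proof eventually_elim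
    case (elim v)
    then have "phi (Suc n) (- v) > 0" by (intro phi_pos) auto
    then show ?case using elim by (auto simp: phi_Suc_integrand intro!: mult_left_mono)
  qed
qed

text \<open>
  Relative errors multiply. On \<open>[T, pi/2 - T]\<close> both arguments are large and the asymptotic errors
  \<open>e0\<close>, \<open>en\<close> apply; on the two end intervals only the crude errors \<open>c0\<close>, \<open>cn\<close> are available.
\<close>

lemma scaled_Phi_Suc_close:
  assumes l: "l \<in> cball 1 (1/2)" and v: "0 \<le> v"
    and T: "0 \<le> T" "T \<le> pi/4"
    and e: "0 \<le> e0" "0 \<le> en" "0 \<le> c0" "0 \<le> cn"
    and bound0: "\<And>v. 0 \<le> v \<Longrightarrow> norm (scaled_Phi 0 l v - of_real (phi 0 (- v))) \<le> c0 * phi 0 (- v)"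
    and boundn: "\<And>v. 0 \<le> v \<Longrightarrow> norm (scaled_Phi n l v - of_real (phi n (- v))) \<le> cn * phi n (- v)"
    and close0: "\<And>u. v * (T / 2)\<^sup>2 \<le> u \<Longrightarrow> norm (scaled_Phi 0 l u - of_real (phi 0 (- u))) \<le> e0 * phi 0 (- u)"
    and closen: "\<And>u. v * (T / 2)\<^sup>2 \<le> u \<Longrightarrow> norm (scaled_Phi n l u - of_real (phi n (- u))) \<le> en * phi n (- u)"
  shows "norm (scaled_Phi (Suc n) l v - of_real (phi (Suc n) (- v))) \<le> 2 *
    (((1 + c0) * (1 + cn) - 1) * integral {0..T} (P.integrand v) +
     ((1 + e0) * (1 + en) - 1) * integral {0..pi/2} (P.integrand v) +
     ((1 + c0) * (1 + cn) - 1) * integral {0..T} (Q.integrand v))"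
proof -
  define C where "C = (1 + c0) * (1 + cn) - 1"
  define E where "E = (1 + e0) * (1 + en) - 1"
  define F where "F = (\<lambda>t. of_real (cos t ^ n) * (scaled_Phi 0 l (v * (sin t)\<^sup>2) * scaled_Phi n l (v * (cos t)\<^sup>2)))"
  define D where "D = (\<lambda>t. F t - of_real (P.integrand v t))"
  note v0 = v
  have Fi: "F integrable_on {x..y}" for x y
    unfolding F_def by (intro integrable_continuous_interval scaled_Phi_continuous l v0)
  have wi: "(\<lambda>t. complex_of_real (P.integrand v t)) integrable_on {x..y}" for x y
    by (intro integrable_continuous_interval continuous_intros P.integrand_cont v0)
  have Di: "D integrable_on {x..y}" for x y
    unfolding D_def by (intro integrable_diff Fi wi)
  have "E \<ge> 0"
  proof -
    have "1 * 1 \<le> (1 + e0) * (1 + en)" using e by (intro mult_mono) auto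
    then show ?thesis by (simp add: E_def)
  qed
  have Deq: "D t = of_real (cos t ^ n) * (scaled_Phi 0 l (v * (sin t)\<^sup>2) * scaled_Phi n l (v * (cos t)\<^sup>2)
     - of_real (phi 0 (- (v * (sin t)\<^sup>2)) * phi n (- (v * (cos t)\<^sup>2))))" for t
    by (simp add: D_def F_def P.integrand_def algebra_simps)
  have "norm (D t) \<le> K * P.integrand v t"
    if "norm (scaled_Phi 0 l (v * (sin t)\<^sup>2) * scaled_Phi n l (v * (cos t)\<^sup>2)
     - of_real (phi 0 (- (v * (sin t)\<^sup>2)) * phi n (- (v * (cos t)\<^sup>2)))) \<le> K * (phi 0 (- (v * (sin t)\<^sup>2)) * phi n (- (v * (cos t)\<^sup>2)))"
      and t: "0 \<le> t" "t \<le> pi/2" for K t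
  proof -
    have c: "0 \<le> cos t ^ n" using t cos_pi_half_nonneg by simp
    have "norm (D t) = cos t ^ n * norm (scaled_Phi 0 l (v * (sin t)\<^sup>2) * scaled_Phi n l (v * (cos t)\<^sup>2)
     - of_real (phi 0 (- (v * (sin t)\<^sup>2)) * phi n (- (v * (cos t)\<^sup>2))))"
      unfolding Deq norm_mult norm_of_real using c by (simp only: abs_of_nonneg)
    also have "\<dots> \<le> cos t ^ n * (K * (phi 0 (- (v * (sin t)\<^sup>2)) * phi n (- (v * (cos t)\<^sup>2))))"
      using that c by (intro mult_left_mono)
    finally show ?thesis by (simp add: P.integrand_def mult_ac)
  qed
  note Dle = this
  have pos: "0 \<le> phi 0 (- (v * s))" "0 \<le> phi n (- (v * s))" if "0 \<le> s" for s
  proof -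
    have "0 \<le> v * s" using that v by simp
    then have "- (v * s) < 2" by linarith
    then show "0 \<le> phi 0 (- (v * s))" "0 \<le> phi n (- (v * s))" using phi_pos less_imp_le by blast+
  qed
  have D1: "norm (D t) \<le> C * P.integrand v t" if "0 \<le> t" "t \<le> pi/2" for t
    unfolding C_def using that v e pos
    by (intro Dle product_relative_error bound0 boundn) auto
  have D2: "norm (D t) \<le> E * P.integrand v t" if t: "T \<le> t" "t \<le> pi/2 - T" for t
  proof -
    have ge: "v * (T / 2)\<^sup>2 \<le> v * s\<^sup>2" if "T / 2 \<le> s" for s
      using that T v by (intro mult_left_mono power_mono) auto
    have sT: "T / 2 \<le> sin T" using T by (intro sin_ge_half) auto
    have 1: "T / 2 \<le> sin t" using sT sin_monotone_2pi_le[of T t] t T by auto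
    have "sin T \<le> sin (pi/2 - t)" using t T by (intro sin_monotone_2pi_le) auto
    then have 2: "T / 2 \<le> cos t" using sT by (simp add: sin_diff)
    show ?thesis
      unfolding E_def using t T e pos
      by (intro Dle product_relative_error close0 closen ge 1 2) auto
  qed
  have i1: "norm (integral {0..T} D) \<le> C * integral {0..T} (P.integrand v)"
  proof -
    have "norm (integral {0..T} D) \<le> integral {0..T} (\<lambda>t. C * P.integrand v t)"
      using T D1 by (intro Henstock_Kurzweil_Integration.integral_norm_bound_integral Di integrable_on_mult_right P.integrand_int v0) auto
    then show ?thesis by simp
  qed
  have i2: "norm (integral {T..pi/2 - T} D) \<le> E * integral {0..pi/2} (P.integrand v)"
  proof -
    have "norm (integral {T..pi/2 - T} D) \<le> integral {T..pi/2 - T} (\<lambda>t. E * P.integrand v t)"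
      using T D2 by (intro Henstock_Kurzweil_Integration.integral_norm_bound_integral Di integrable_on_mult_right P.integrand_int v0) auto
    also have "\<dots> = E * integral {T..pi/2 - T} (P.integrand v)" by simp
    also have "\<dots> \<le> E * integral {0..pi/2} (P.integrand v)"
      using T P.integrand_nonneg[OF v0] \<open>E \<ge> 0\<close> by (intro mult_left_mono integral_subset_le P.integrand_int v0) auto
    finally show ?thesis .
  qed
  have i3: "norm (integral {pi/2 - T..pi/2} D) \<le> C * integral {0..T} (Q.integrand v)"
  proof -
    have "norm (integral {pi/2 - T..pi/2} D) \<le> integral {pi/2 - T..pi/2} (\<lambda>t. C * P.integrand v t)"
      using T D1 by (intro Henstock_Kurzweil_Integration.integral_norm_bound_integral Di integrable_on_mult_right P.integrand_int v0) auto
    also have "\<dots> = C * integral {pi/2 - T..pi/2} (P.integrand v)" by simp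
    also have "integral {pi/2 - T..pi/2} (P.integrand v) = integral {0..T} (Q.integrand v)"
      by (simp only: integral_reflect_end integrand_swap)
    finally show ?thesis .
  qed
  have split: "integral {0..pi/2} D = integral {0..T} D + (integral {T..pi/2 - T} D + integral {pi/2 - T..pi/2} D)"
    using T by (simp add: Henstock_Kurzweil_Integration.integral_combine Di)
  have "scaled_Phi (Suc n) l v - of_real (phi (Suc n) (- v)) = 2 * integral {0..pi/2} D"
  proof -
    have "of_real (phi (Suc n) (- v)) = 2 * integral {0..pi/2} (\<lambda>t. complex_of_real (P.integrand v t))"
      by (simp add: phi_Suc_integrand v0 HK_integral_of_real P.integrand_int)
    moreover have "scaled_Phi (Suc n) l v = 2 * integral {0..pi/2} F"
      unfolding F_def by (rule scaled_Phi_Suc)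
    ultimately show ?thesis unfolding D_def by (simp add: integral_diff Fi wi)
  qed
  then have "norm (scaled_Phi (Suc n) l v - of_real (phi (Suc n) (- v))) = 2 * norm (integral {0..pi/2} D)"
    by (simp add: norm_mult)
  also have "\<dots> \<le> 2 * (C * integral {0..T} (P.integrand v) + E * integral {0..pi/2} (P.integrand v) + C * integral {0..T} (Q.integrand v))"
    unfolding split using i1 i2 i3
    by (intro mult_left_mono order_trans[OF norm_triangle_ineq] order_trans[OF add_mono[OF order_refl norm_triangle_ineq]]) auto
  finally show ?thesis by (simp add: C_def E_def)
qed

lemma ends_negligible:
  assumes L: "0 < L" and e: "0 < e"
  shows "\<forall>\<^sub>F v in at_top. integral {0..L / sqrt v} (P.integrand v) \<le> e * integral {0..pi/2} (P.integrand v)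
     \<and> integral {0..L / sqrt v} (Q.integrand v) \<le> e * integral {0..pi/2} (P.integrand v)"
proof -
  have "integral {0..pi/2} (P.integrand v) = integral {0..pi/2} (Q.integrand v)" for v
    using integral_reflect_end[of "pi/2" "pi/2" "P.integrand v"] by (simp add: integrand_swap)
  then show ?thesis
    using P.near_zero_negligible[OF L e] Q.near_zero_negligible[OF L e] by (auto elim: eventually_elim2)
qed

lemma scaled_Phi_Suc_bounded:
  assumes "0 \<le> c0" "0 \<le> cn" "l \<in> cball 1 (1/2)" "0 \<le> v"
    and "\<And>v. 0 \<le> v \<Longrightarrow> norm (scaled_Phi 0 l v - of_real (phi 0 (- v))) \<le> c0 * phi 0 (- v)"
    and "\<And>v. 0 \<le> v \<Longrightarrow> norm (scaled_Phi n l v - of_real (phi n (- v))) \<le> cn * phi n (- v)"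
  shows "norm (scaled_Phi (Suc n) l v - of_real (phi (Suc n) (- v))) \<le> ((1 + c0) * (1 + cn) - 1) * phi (Suc n) (- v)"
  using scaled_Phi_Suc_close[of l v 0 c0 cn c0 cn] assms by (simp add: phi_Suc_integrand)

lemma scaled_Phi_Suc_asymp:
  assumes c: "0 \<le> c0" "0 \<le> cn"
    and b0: "\<And>l v. l \<in> cball 1 (1/2) \<Longrightarrow> 0 \<le> v \<Longrightarrow> norm (scaled_Phi 0 l v - of_real (phi 0 (- v))) \<le> c0 * phi 0 (- v)"
    and bn: "\<And>l v. l \<in> cball 1 (1/2) \<Longrightarrow> 0 \<le> v \<Longrightarrow> norm (scaled_Phi n l v - of_real (phi n (- v))) \<le> cn * phi n (- v)"
    and l0: "\<And>e. e > 0 \<Longrightarrow> \<forall>\<^sub>F v in at_top. \<forall>l\<in>cball 1 (1/2). norm (scaled_Phi 0 l v - of_real (phi 0 (- v))) \<le> e * phi 0 (- v)"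
    and ln: "\<And>e. e > 0 \<Longrightarrow> \<forall>\<^sub>F v in at_top. \<forall>l\<in>cball 1 (1/2). norm (scaled_Phi n l v - of_real (phi n (- v))) \<le> e * phi n (- v)"
    and e: "0 < e"
  shows "\<forall>\<^sub>F v in at_top. \<forall>l\<in>cball 1 (1/2). norm (scaled_Phi (Suc n) l v - of_real (phi (Suc n) (- v))) \<le> e * phi (Suc n) (- v)"
proof -
  define C where "C = (1 + c0) * (1 + cn) - 1"
  have C: "C \<ge> 0"
  proof -
    have "1 * 1 \<le> (1 + c0) * (1 + cn)" using c by (intro mult_mono) auto
    then show ?thesis by (simp add: C_def)
  qed
  define \<delta> where "\<delta> = min 1 (e / 6)"
  have d: "\<delta> > 0" "\<delta> \<le> 1" "\<delta> \<le> e / 6" using e by (auto simp: \<delta>_def)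
  have d2: "(1 + \<delta>) * (1 + \<delta>) - 1 \<le> e / 2"
  proof -
    have "\<delta> * \<delta> \<le> 1 * \<delta>" using d by (intro mult_right_mono) auto
    moreover have "(1 + \<delta>) * (1 + \<delta>) - 1 = 2 * \<delta> + \<delta> * \<delta>" by (simp add: algebra_simps)
    ultimately show ?thesis using d by linarith
  qed
  obtain V0 where V0: "\<And>v l. V0 \<le> v \<Longrightarrow> l \<in> cball 1 (1/2) \<Longrightarrow> norm (scaled_Phi 0 l v - of_real (phi 0 (- v))) \<le> \<delta> * phi 0 (- v)"
    using l0[OF d(1)] unfolding eventually_at_top_linorder by blast
  obtain Vn where Vn: "\<And>v l. Vn \<le> v \<Longrightarrow> l \<in> cball 1 (1/2) \<Longrightarrow> norm (scaled_Phi n l v - of_real (phi n (- v))) \<le> \<delta> * phi n (- v)"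
    using ln[OF d(1)] unfolding eventually_at_top_linorder by blast
  define V where "V = max 1 (max V0 Vn)"
  (* with T = L / sqrt v, the arguments in the middle part are at least v (T/2)^2 = V *)
  define L where "L = 2 * sqrt V"
  have L: "L > 0" "L\<^sup>2 / 4 = V" by (auto simp: L_def V_def power_mult_distrib)
  define \<epsilon> where "\<epsilon> = e / (4 * (C + 1))"
  have eps: "\<epsilon> > 0" "C * \<epsilon> \<le> e / 4" using e C by (auto simp: \<epsilon>_def field_simps)
  have "((\<lambda>v. L / sqrt v) \<longlongrightarrow> 0) at_top" by real_asymp
  then have "\<forall>\<^sub>F v in at_top. L / sqrt v < pi/4" by (rule order_tendstoD) simp
  moreover have "\<forall>\<^sub>F v in at_top. v > (0::real)" by (rule eventually_gt_at_top)
  ultimately show ?thesis using ends_negligible[OF L(1) eps(1)]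
  proof eventually_elim
    case (elim v)
    define N where "N = integral {0..pi/2} (P.integrand v)"
    have N: "N \<ge> 0" unfolding N_def using elim by (intro integral_nonneg P.integrand_int P.integrand_nonneg) auto
    have LV: "v * (L / sqrt v / 2)\<^sup>2 = V" using elim L by (simp add: power_divide)
    show ?case
    proof
      fix l :: complex assume l: "l \<in> cball 1 (1/2)"
      have "norm (scaled_Phi (Suc n) l v - of_real (phi (Suc n) (- v))) \<le> 2 *
        (C * integral {0..L / sqrt v} (P.integrand v) + ((1 + \<delta>) * (1 + \<delta>) - 1) * N + C * integral {0..L / sqrt v} (Q.integrand v))"
        unfolding C_def N_def
        using elim L(1) d c
        by (intro scaled_Phi_Suc_close l b0 bn V0 Vn; simp only: LV; simp add: V_def)
      also have "\<dots> \<le> 2 * (C * (\<epsilon> * N) + (e / 2) * N + C * (\<epsilon> * N))"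
        using elim C N d2 by (intro mult_left_mono add_mono mult_right_mono) (auto simp: N_def)
      also have "\<dots> = 2 * (C * \<epsilon> + e / 2 + C * \<epsilon>) * N" by (simp add: algebra_simps)
      also have "\<dots> \<le> 2 * (e / 4 + e / 2 + e / 4) * N"
        using eps N by (intro mult_right_mono mult_left_mono add_mono) auto
      also have "\<dots> = e * phi (Suc n) (- v)" using elim by (simp add: phi_Suc_integrand N_def)
      finally show "norm (scaled_Phi (Suc n) l v - of_real (phi (Suc n) (- v))) \<le> e * phi (Suc n) (- v)" .
    qed
  qed
qed

end

text \<open>
  Both claims are proved together, as the crude bound for all \<open>v\<close> enters the induction step for the
  asymptotic one.
\<close>

lemma scaled_Phi_bounded_asymp:
  "(\<exists>C\<ge>0. \<forall>l\<in>cball 1 (1/2). \<forall>v\<ge>0. norm (scaled_Phi n l v - of_real (phi n (- v))) \<le> C * phi n (- v)) \<and>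
   (\<forall>e>0. \<forall>\<^sub>F v in at_top. \<forall>l\<in>cball 1 (1/2). norm (scaled_Phi n l v - of_real (phi n (- v))) \<le> e * phi n (- v))"
proof (induction n)
  case 0
  have 1: "norm (scaled_Phi 0 l v - of_real (phi 0 (- v))) \<le> e * phi 0 (- v)"
    if "l \<in> cball 1 (1/2)" "0 \<le> v" "1 / (2 + v / 2) \<le> e" for l v e
    using scaled_Phi_0_close[OF that(1,2)] mult_right_mono[OF that(3), of "phi 0 (- v)"] phi_pos[of "- v" 0] that
    by linarith
  have 2: "1 / (2 + v / 2) \<le> 1" if "0 \<le> v" for v :: real using that by simp
  have "\<forall>\<^sub>F v in at_top. \<forall>l\<in>cball 1 (1/2). norm (scaled_Phi 0 l v - of_real (phi 0 (- v))) \<le> e * phi 0 (- v)"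
    if e: "e > 0" for e :: real
  proof -
    have "((\<lambda>v::real. 1 / (2 + v / 2)) \<longlongrightarrow> 0) at_top" by real_asymp
    then have "\<forall>\<^sub>F v::real in at_top. 1 / (2 + v / 2) < e" by (rule order_tendstoD) (use e in simp)
    with eventually_ge_at_top[of 0] show ?thesis
      by eventually_elim (auto intro: 1)
  qed
  moreover have "\<exists>C\<ge>0. \<forall>l\<in>cball 1 (1/2). \<forall>v\<ge>0. norm (scaled_Phi 0 l v - of_real (phi 0 (- v))) \<le> C * phi 0 (- v)"
    by (rule exI[of _ 1]) (intro conjI ballI allI impI 1 2; simp)
  ultimately show ?case by blast
next
  case (Suc n)
  obtain cn where cn: "cn \<ge> 0" "\<And>l v. l \<in> cball 1 (1/2) \<Longrightarrow> 0 \<le> v \<Longrightarrow> norm (scaled_Phi n l v - of_real (phi n (- v))) \<le> cn * phi n (- v)"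
    using Suc by blast
  have 0: "norm (scaled_Phi 0 l v - of_real (phi 0 (- v))) \<le> 1 * phi 0 (- v)"
    if "l \<in> cball 1 (1/2)" "0 \<le> v" for l v
  proof -
    have "1 / (2 + v / 2) * phi 0 (- v) \<le> 1 * phi 0 (- v)"
      using that phi_pos[of "- v" 0] by (intro mult_right_mono) auto
    then show ?thesis using scaled_Phi_0_close[OF that] by linarith
  qed
  have l0: "\<forall>\<^sub>F v in at_top. \<forall>l\<in>cball 1 (1/2). norm (scaled_Phi 0 l v - of_real (phi 0 (- v))) \<le> e * phi 0 (- v)"
    if e: "e > 0" for e :: real
  proof -
    have "((\<lambda>v::real. 1 / (2 + v / 2)) \<longlongrightarrow> 0) at_top" by real_asymp
    then have "\<forall>\<^sub>F v::real in at_top. 1 / (2 + v / 2) < e" by (rule order_tendstoD) (use e in simp)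
    with eventually_ge_at_top[of 0] show ?thesis
    proof eventually_elim
      case (elim v)
      have "1 / (2 + v / 2) * phi 0 (- v) \<le> e * phi 0 (- v)"
        using elim phi_pos[of "- v" 0] by (intro mult_right_mono) auto
      then show ?case using scaled_Phi_0_close elim by (meson order_trans)
    qed
  qed
  have "norm (scaled_Phi (Suc n) l v - of_real (phi (Suc n) (- v))) \<le> ((1 + 1) * (1 + cn) - 1) * phi (Suc n) (- v)"
    if "l \<in> cball 1 (1/2)" "0 \<le> v" for l v
    using that cn 0 by (intro scaled_Phi_Suc_bounded) auto
  moreover have "(1 + 1) * (1 + cn) - 1 \<ge> 0" using cn by simp
  moreover have "\<forall>\<^sub>F v in at_top. \<forall>l\<in>cball 1 (1/2). norm (scaled_Phi (Suc n) l v - of_real (phi (Suc n) (- v))) \<le> e * phi (Suc n) (- v)"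
    if "e > 0" for e :: real
    using scaled_Phi_Suc_asymp[of 1 cn n e] cn 0 l0 Suc that by auto
  ultimately show ?case by blast
qed

section \<open>Slowly varying functions and linear differential equations\<close>

definition euler :: "(complex \<Rightarrow> complex) \<Rightarrow> complex \<Rightarrow> complex" where
  "euler f z = z * deriv f z"

text \<open>
  The differential operator \<open>Q(euler)\<close> applied to \<open>f\<close>.
\<close>

definition euler_poly :: "complex poly \<Rightarrow> (complex \<Rightarrow> complex) \<Rightarrow> complex \<Rightarrow> complex" where
  "euler_poly Q f z = (\<Sum>i\<le>degree Q. coeff Q i * (euler ^^ i) f z)"

text \<open>
  The falling factorial \<open>x (x - 1) \<dots> (x - i + 1)\<close>, which converts \<open>z\<^sup>i (d/dz)\<^sup>i\<close> into a polynomial in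
  the Euler operator.
\<close>

fun falling_poly :: "nat \<Rightarrow> complex poly" where
  "falling_poly 0 = 1"
| "falling_poly (Suc i) = pCons 0 (falling_poly i) - smult (of_nat i) (falling_poly i)"

lemma falling_poly_degree: "degree (falling_poly i) = i \<and> coeff (falling_poly i) i = 1"
proof (induction i)
  case (Suc i)
  then have c: "coeff (falling_poly (Suc i)) (Suc i) = 1"
    by (simp add: coeff_eq_0)
  have "degree (falling_poly (Suc i)) \<le> Suc i"
  proof (rule degree_le, intro allI impI)
    fix j assume "Suc i < j"
    then show "coeff (falling_poly (Suc i)) j = 0" using Suc by (cases j) (auto simp: coeff_eq_0)
  qed
  moreover have "Suc i \<le> degree (falling_poly (Suc i))" using c by (intro le_degree) simp
  ultimately have "degree (falling_poly (Suc i)) = Suc i" by (rule antisym)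
  then show ?case using c by blast
qed simp

lemma falling_poly_combination_nonzero:
  fixes c :: "nat \<Rightarrow> complex"
  assumes "i \<le> r" "c i \<noteq> 0"
  shows "(\<Sum>j\<le>r. smult (c j) (falling_poly j)) \<noteq> 0"
proof -
  define m where "m = Max {j. j \<le> r \<and> c j \<noteq> 0}"
  have fin: "finite {j. j \<le> r \<and> c j \<noteq> 0}" by simp
  have "m \<in> {j. j \<le> r \<and> c j \<noteq> 0}" unfolding m_def by (rule Max_in[OF fin]) (use assms in auto)
  then have m: "m \<le> r" "c m \<noteq> 0" by auto
  have z: "c j = 0" if "m < j" "j \<le> r" for j
  proof (rule ccontr)
    assume "c j \<noteq> 0"
    then have "j \<le> m" unfolding m_def using that by (intro Max_ge fin) auto
    then show False using that by simp
  qed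
  have "coeff (\<Sum>j\<le>r. smult (c j) (falling_poly j)) m = (\<Sum>j\<le>r. c j * coeff (falling_poly j) m)"
    by (simp add: coeff_sum)
  also have "\<dots> = (\<Sum>j\<le>r. if j = m then c m else 0)"
  proof (rule sum.cong)
    fix j assume "j \<in> {..r}"
    then show "c j * coeff (falling_poly j) m = (if j = m then c m else 0)"
      using z[of j] falling_poly_degree[of j] by (cases j m rule: linorder_cases) (auto simp: coeff_eq_0)
  qed simp
  also have "\<dots> = c m" using m by simp
  finally show ?thesis using m by auto
qed

lemma euler_poly_upto:
  assumes "degree Q < K" shows "euler_poly Q f z = (\<Sum>i<K. coeff Q i * (euler ^^ i) f z)"
  unfolding euler_poly_def using assms
  by (intro sum.mono_neutral_left) (auto simp: coeff_eq_0 not_le)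

lemma euler_poly_add: "euler_poly (P + Q) f z = euler_poly P f z + euler_poly Q f z"
proof -
  define K where "K = Suc (max (degree P) (degree Q))"
  have "degree P < K" "degree Q < K" "degree (P + Q) < K"
    using degree_add_le_max[of P Q] by (auto simp: K_def)
  then show ?thesis by (simp add: euler_poly_upto sum.distrib distrib_right)
qed

lemma euler_poly_smult: "euler_poly (smult c P) f z = c * euler_poly P f z"
proof -
  have "degree (smult c P) < Suc (degree P)" using degree_smult_le[of c P] by simp
  then show ?thesis by (simp only: euler_poly_upto[of _ "Suc (degree P)"] lessI coeff_smult sum_distrib_left mult.assoc)
qed

lemma euler_poly_0: "euler_poly 0 f z = 0"
  by (simp add: euler_poly_def)

lemma euler_poly_sum: "euler_poly (\<Sum>i\<in>A. P i) f z = (\<Sum>i\<in>A. euler_poly (P i) f z)"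
  by (induction A rule: infinite_finite_induct) (auto simp: euler_poly_add euler_poly_0)

text \<open>
  The discs of radius \<open>w/4\<close> about \<open>w\<close> cover a sector around the positive real axis near \<open>0\<close>. On each of
  them \<open>h\<close> is almost constant, so that Cauchy's inequality bounds \<open>z h'(z)\<close> by a small multiple of \<open>h\<close>.
\<close>

locale slowly_varying =
  fixes h :: "complex \<Rightarrow> complex" and \<Omega> :: "complex set" and w0 :: real
  assumes open_dom: "open \<Omega>" and hol: "h holomorphic_on \<Omega>" and w0: "w0 > 0"
    and sector: "\<And>w. 0 < w \<Longrightarrow> w < w0 \<Longrightarrow> cball (of_real w) (w / 4) \<subseteq> \<Omega>"
    and slow: "\<And>e. e > 0 \<Longrightarrow> \<forall>\<^sub>F w in at_right 0. \<forall>z\<in>cball (of_real w) (w / 4). norm (h z - h (of_real w)) \<le> e * norm (h (of_real w))"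
    and nonzero: "\<forall>\<^sub>F w in at_right 0. h (of_real w) \<noteq> 0"
    and vanish: "((\<lambda>w. h (of_real w)) \<longlongrightarrow> 0) (at_right 0)"
begin

lemma eventually_small: "0 < c \<Longrightarrow> \<forall>\<^sub>F w in at_right (0::real). 0 < w \<and> w < c"
  using eventually_at_right_field[of "\<lambda>w. 0 < w \<and> w < c" 0] by auto

lemma real_in_dom: "0 < w \<Longrightarrow> w < w0 \<Longrightarrow> of_real w \<in> \<Omega>"
  using sector[of w] by auto

lemma euler_holomorphic: "(euler ^^ j) h holomorphic_on \<Omega>"
  by (induction j) (auto simp: hol euler_def[abs_def] open_dom intro!: holomorphic_intros holomorphic_deriv)

lemma euler_poly_holomorphic: "euler_poly Q h holomorphic_on \<Omega>"
  unfolding euler_poly_def[abs_def] by (intro holomorphic_intros euler_holomorphic)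

lemma euler_estimate:
  assumes f: "f holomorphic_on \<Omega>" and r: "0 < r" "r \<le> 1/4" and w: "0 < w" "w < w0"
    and b: "\<And>z. z \<in> cball (of_real w) (r * w) \<Longrightarrow> norm (f z - c) \<le> B"
    and z: "z \<in> cball (of_real w) (r / 2 * w)"
  shows "norm (euler f z) \<le> 4 / r * B"
proof -
  have sub: "cball z (r / 2 * w) \<subseteq> cball (of_real w) (r * w)"
  proof
    fix y assume y: "y \<in> cball z (r / 2 * w)"
    have "dist (of_real w) y \<le> dist (of_real w) z + dist z y" by (rule dist_triangle)
    also have "\<dots> \<le> r / 2 * w + r / 2 * w" using y z by (intro add_mono) auto
    finally show "y \<in> cball (of_real w) (r * w)" by simp
  qed
  have rw: "r * w \<le> w / 4" using r w by simp
  have sub2: "cball (of_real w) (r * w) \<subseteq> \<Omega>" using sector[OF w] subset_cball[OF rw] by blast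
  have "z \<in> cball z (r / 2 * w)" using r w by simp
  then have z\<Omega>: "z \<in> \<Omega>" using sub sub2 by blast
  have hf: "(\<lambda>y. f y - c) holomorphic_on cball z (r / 2 * w)"
    using sub sub2 by (intro holomorphic_intros holomorphic_on_subset[OF f]) auto
  have "norm ((deriv ^^ 1) (\<lambda>y. f y - c) z) \<le> fact 1 * B / (r / 2 * w) ^ 1"
  proof (rule Cauchy_inequality)
    show "(\<lambda>y. f y - c) holomorphic_on ball z (r / 2 * w)" using hf by (rule holomorphic_on_subset) auto
    show "continuous_on (cball z (r / 2 * w)) (\<lambda>y. f y - c)" using hf by (rule holomorphic_on_imp_continuous_on)
    show "norm (f y - c) \<le> B" if "norm (z - y) = r / 2 * w" for y
    proof -
      have "y \<in> cball z (r / 2 * w)" using that by (simp add: dist_norm)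
      then show ?thesis using sub by (intro b) blast
    qed
  qed (use r w in auto)
  moreover have "deriv (\<lambda>y. f y - c) z = deriv f z"
    using f z\<Omega> open_dom by (subst deriv_diff) (auto intro: holomorphic_on_imp_differentiable_at)
  ultimately have d: "norm (deriv f z) \<le> B / (r / 2 * w)" by simp
  have "norm z \<le> norm (of_real w - z) + w"
    using norm_triangle_ineq2[of z "of_real w"] w by (simp add: norm_minus_commute)
  also have "norm (of_real w - z) \<le> r / 2 * w" using z by (simp add: dist_norm)
  also have "r / 2 * w \<le> w" using r w by simp
  finally have nz: "norm z \<le> 2 * w" by simp
  have "norm (euler f z) \<le> (2 * w) * (B / (r / 2 * w))"
    unfolding euler_def norm_mult using nz d w by (intro mult_mono) auto
  also have "\<dots> = 4 / r * B" using w r by (simp add: field_simps)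
  finally show ?thesis .
qed

text \<open>
  Each application of Cauchy's inequality halves the radius of the disc, relative to \<open>w\<close>.
\<close>

lemma euler_iterate_small:
  "\<exists>r>0. r \<le> 1/4 \<and> (\<forall>e>0. \<forall>\<^sub>F w in at_right 0. \<forall>z\<in>cball (of_real w) (r * w). norm ((euler ^^ Suc j) h z) \<le> e * norm (h (of_real w)))"
proof (induction j)
  case 0
  show ?case
  proof (intro exI[of _ "1/8"] conjI allI impI)
    fix e :: real assume e: "e > 0"
    have "\<forall>\<^sub>F w in at_right 0. \<forall>z\<in>cball (of_real w) (w / 4). norm (h z - h (of_real w)) \<le> (e / 16) * norm (h (of_real w))"
      using e by (intro slow) auto
    with eventually_small[OF w0]
    show "\<forall>\<^sub>F w in at_right 0. \<forall>z\<in>cball (of_real w) (1 / 8 * w). norm ((euler ^^ Suc 0) h z) \<le> e * norm (h (of_real w))"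
    proof eventually_elim
      case (elim w)
      show ?case
      proof
        fix z :: complex assume "z \<in> cball (of_real w) (1 / 8 * w)"
        then have "norm (euler h z) \<le> 4 / (1/4) * (e / 16 * norm (h (of_real w)))"
          using elim by (intro euler_estimate[OF hol, of "1/4" w "h (of_real w)"]) auto
        then show "norm ((euler ^^ Suc 0) h z) \<le> e * norm (h (of_real w))" by simp
      qed
    qed
  qed auto
next
  case (Suc j)
  then obtain r where r: "r > 0" "r \<le> 1/4" and IH: "\<And>e. e > 0 \<Longrightarrow> \<forall>\<^sub>F w in at_right 0. \<forall>z\<in>cball (of_real w) (r * w). norm ((euler ^^ Suc j) h z) \<le> e * norm (h (of_real w))"
    by blast
  show ?case
  proof (intro exI[of _ "r / 2"] conjI allI impI)
    fix e :: real assume e: "e > 0"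
    have "\<forall>\<^sub>F w in at_right 0. \<forall>z\<in>cball (of_real w) (r * w). norm ((euler ^^ Suc j) h z) \<le> (e * r / 4) * norm (h (of_real w))"
      using e r by (intro IH) auto
    with eventually_small[OF w0]
    show "\<forall>\<^sub>F w in at_right 0. \<forall>z\<in>cball (of_real w) (r / 2 * w). norm ((euler ^^ Suc (Suc j)) h z) \<le> e * norm (h (of_real w))"
    proof eventually_elim
      case (elim w)
      show ?case
      proof
        fix z :: complex assume "z \<in> cball (of_real w) (r / 2 * w)"
        then have "norm (euler ((euler ^^ Suc j) h) z) \<le> 4 / r * ((e * r / 4) * norm (h (of_real w)))"
          using elim r by (intro euler_estimate[OF euler_holomorphic[of "Suc j"], of r w 0]) auto
        then show "norm ((euler ^^ Suc (Suc j)) h z) \<le> e * norm (h (of_real w))" using r by simp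
      qed
    qed
  qed (use r in auto)
qed

lemma euler_iterate_small_real:
  assumes "e > 0"
  shows "\<forall>\<^sub>F w in at_right 0. norm ((euler ^^ Suc j) h (of_real w)) \<le> e * norm (h (of_real w))"
proof -
  obtain r where r: "r > 0" "\<forall>e>0. \<forall>\<^sub>F w in at_right 0. \<forall>z\<in>cball (of_real w) (r * w). norm ((euler ^^ Suc j) h z) \<le> e * norm (h (of_real w))"
    using euler_iterate_small[of j] by blast
  from r(2) assms have "\<forall>\<^sub>F w in at_right 0. \<forall>z\<in>cball (of_real w) (r * w). norm ((euler ^^ Suc j) h z) \<le> e * norm (h (of_real w))"
    by blast
  with eventually_small[OF w0] show ?thesis
    by eventually_elim (use r(1) in auto)
qed

lemma euler_poly_asymp:
  assumes "e > 0"
  shows "\<forall>\<^sub>F w in at_right 0. norm (euler_poly Q h (of_real w) - coeff Q 0 * h (of_real w)) \<le> e * norm (h (of_real w))"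
proof -
  define M where "M = 1 + (\<Sum>i<degree Q. norm (coeff Q (Suc i)))"
  have M: "M > 0" unfolding M_def by (intro add_pos_nonneg sum_nonneg) auto
  have "\<forall>\<^sub>F w in at_right 0. \<forall>i\<in>{..<degree Q}. norm ((euler ^^ Suc i) h (of_real w)) \<le> (e / M) * norm (h (of_real w))"
    using assms M by (intro eventually_ball_finite ballI euler_iterate_small_real) auto
  then show ?thesis
  proof eventually_elim
    case (elim w)
    have "euler_poly Q h (of_real w) - coeff Q 0 * h (of_real w) = (\<Sum>i<degree Q. coeff Q (Suc i) * (euler ^^ Suc i) h (of_real w))"
      unfolding euler_poly_def lessThan_Suc_atMost[symmetric] sum.lessThan_Suc_shift by simp
    also have "norm \<dots> \<le> (\<Sum>i<degree Q. norm (coeff Q (Suc i)) * ((e / M) * norm (h (of_real w))))"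
      unfolding norm_mult[symmetric]
      by (rule order_trans[OF norm_sum], rule sum_mono, subst norm_mult, rule mult_left_mono) (use elim in auto)
    also have "\<dots> = (\<Sum>i<degree Q. norm (coeff Q (Suc i))) * ((e / M) * norm (h (of_real w)))"
      by (rule sum_distrib_right[symmetric])
    also have "\<dots> \<le> M * ((e / M) * norm (h (of_real w)))"
      using assms M by (intro mult_right_mono) (auto simp: M_def)
    also have "\<dots> = e * norm (h (of_real w))" using M by simp
    finally show ?case .
  qed
qed

lemma euler_poly_vanish: "((\<lambda>w. euler_poly Q h (of_real w)) \<longlongrightarrow> 0) (at_right 0)"
proof (rule Lim_null_comparison)
  show "\<forall>\<^sub>F w in at_right 0. norm (euler_poly Q h (of_real w)) \<le> (norm (coeff Q 0) + 1) * norm (h (of_real w))"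
    using euler_poly_asymp[of 1 Q, OF zero_less_one]
  proof eventually_elim
    case (elim w)
    have "norm (euler_poly Q h (of_real w)) \<le> norm (coeff Q 0 * h (of_real w)) + norm (euler_poly Q h (of_real w) - coeff Q 0 * h (of_real w))"
      using norm_triangle_ineq[of "coeff Q 0 * h (of_real w)" "euler_poly Q h (of_real w) - coeff Q 0 * h (of_real w)"] by simp
    then show ?case using elim by (simp add: norm_mult distrib_right)
  qed
  show "((\<lambda>w. (norm (coeff Q 0) + 1) * norm (h (of_real w))) \<longlongrightarrow> 0) (at_right 0)"
    by (intro tendsto_mult_right_zero tendsto_norm_zero vanish)
qed

lemma euler_poly_pCons_0:
  assumes "z \<in> \<Omega>" shows "euler_poly (pCons 0 Q) h z = z * deriv (euler_poly Q h) z"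
proof -
  have d: "degree (pCons 0 Q) < Suc (Suc (degree Q))" by (simp add: degree_pCons_le le_imp_less_Suc)
  have diff: "(euler ^^ i) h field_differentiable at z" for i
    using euler_holomorphic open_dom assms by (rule holomorphic_on_imp_differentiable_at)
  have "euler_poly (pCons 0 Q) h z = (\<Sum>i<Suc (degree Q). coeff Q i * (euler ^^ Suc i) h z)"
    unfolding euler_poly_upto[OF d] sum.lessThan_Suc_shift[of _ "Suc (degree Q)"] by (simp only: coeff_pCons_0 coeff_pCons_Suc) simp
  also have "\<dots> = z * (\<Sum>i\<le>degree Q. coeff Q i * deriv ((euler ^^ i) h) z)"
    by (simp add: euler_def sum_distrib_left lessThan_Suc_atMost mult_ac)
  also have "(\<Sum>i\<le>degree Q. coeff Q i * deriv ((euler ^^ i) h) z) = deriv (euler_poly Q h) z"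
  proof -
    have "(euler_poly Q h has_field_derivative (\<Sum>i\<le>degree Q. coeff Q i * deriv ((euler ^^ i) h) z)) (at z)"
      unfolding euler_poly_def[abs_def]
      by (intro DERIV_sum DERIV_cmult) (use diff in \<open>simp add: field_differentiable_derivI\<close>)
    then show ?thesis by (rule DERIV_imp_deriv[symmetric])
  qed
  finally show ?thesis .
qed

lemma falling_poly_deriv:
  assumes "z \<in> \<Omega>" shows "z ^ i * (deriv ^^ i) h z = euler_poly (falling_poly i) h z"
  using assms
proof (induction i arbitrary: z)
  case 0
  then show ?case by (simp add: euler_poly_def)
next
  case (Suc i)
  have hd: "(deriv ^^ i) h field_differentiable at z"
    using holomorphic_higher_deriv[OF hol open_dom] open_dom Suc.prems by (rule holomorphic_on_imp_differentiable_at)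
  have "deriv (euler_poly (falling_poly i) h) z = deriv (\<lambda>z. z ^ i * (deriv ^^ i) h z) z"
    using Suc open_dom by (intro deriv_cong_ev eventually_nhds_in_open[THEN eventually_mono, of \<Omega>]) auto
  also have "\<dots> = of_nat i * z ^ (i - 1) * (deriv ^^ i) h z + z ^ i * (deriv ^^ Suc i) h z"
  proof (rule DERIV_imp_deriv)
    have "((deriv ^^ i) h has_field_derivative (deriv ^^ Suc i) h z) (at z)"
      using field_differentiable_derivI[OF hd] by simp
    then show "((\<lambda>z. z ^ i * (deriv ^^ i) h z) has_field_derivative of_nat i * z ^ (i - 1) * (deriv ^^ i) h z + z ^ i * (deriv ^^ Suc i) h z) (at z)"
      by (auto intro!: derivative_eq_intros)
  qed
  finally have d: "z * deriv (euler_poly (falling_poly i) h) z = of_nat i * (z ^ i * (deriv ^^ i) h z) + z ^ Suc i * (deriv ^^ Suc i) h z"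
    by (cases i) (auto simp: algebra_simps)
  have neg: "falling_poly (Suc i) = pCons 0 (falling_poly i) + smult (- of_nat i) (falling_poly i)" by simp
  have "euler_poly (falling_poly (Suc i)) h z = z * deriv (euler_poly (falling_poly i) h) z - of_nat i * euler_poly (falling_poly i) h z"
    unfolding neg euler_poly_add euler_poly_smult euler_poly_pCons_0[OF Suc.prems] by simp
  also have "\<dots> = z ^ Suc i * (deriv ^^ Suc i) h z" unfolding d Suc.IH[OF Suc.prems, symmetric] by simp
  finally show ?case by simp
qed

text \<open>
  If \<open>z f'(z) = O(z)\<close>, then \<open>f'\<close> is bounded, and as \<open>f\<close> tends to \<open>0\<close> at \<open>0\<close>, it is \<open>O(z)\<close>.
\<close>

lemma euler_poly_integrate:
  assumes "\<exists>C. \<forall>\<^sub>F w in at_right 0. norm (euler_poly (pCons 0 Q) h (of_real w)) \<le> C * w"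
  shows "\<exists>C. \<forall>\<^sub>F w in at_right 0. norm (euler_poly Q h (of_real w)) \<le> C * w"
proof -
  obtain C where C: "\<forall>\<^sub>F w in at_right 0. norm (euler_poly (pCons 0 Q) h (of_real w)) \<le> C * w" using assms by blast
  define f where "f = euler_poly Q h"
  obtain b where b: "b > 0" "\<And>w. 0 < w \<Longrightarrow> w < b \<Longrightarrow> norm (euler_poly (pCons 0 Q) h (of_real w)) \<le> C * w"
    using C unfolding eventually_at_right_field by auto
  define c where "c = min b w0"
  have c: "c > 0" using b w0 by (auto simp: c_def)
  have dbound: "norm (deriv f (of_real w)) \<le> C" if "0 < w" "w < c" for w
  proof -
    have "norm (of_real w * deriv f (of_real w)) \<le> C * w"
      using b(2)[of w] that euler_poly_pCons_0[OF real_in_dom[of w], of Q] by (simp add: c_def f_def)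
    then show ?thesis using that by (simp add: norm_mult mult.commute)
  qed
  have lip: "norm (f (of_real w) - f (of_real s)) \<le> C * (w - s)" if "0 < s" "s \<le> w" "w < c" for s w
  proof -
    have "norm (f (of_real w) - f (of_real s)) \<le> C * norm (complex_of_real w - of_real s)"
    proof (rule field_differentiable_bound[of "closed_segment (of_real s) (of_real w)" f "deriv f"])
      fix z assume "z \<in> closed_segment (complex_of_real s) (of_real w)"
      then obtain t where t: "z = of_real t" "t \<in> closed_segment s w" by (auto simp: closed_segment_of_real)
      then have t2: "0 < t" "t < c" using that by (auto simp: closed_segment_eq_real_ivl)
      then have "z \<in> \<Omega>" using t real_in_dom by (simp add: c_def)
      then have "(f has_field_derivative deriv f z) (at z)"
        unfolding f_def using euler_poly_holomorphic open_dom by (intro holomorphic_derivI)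
      then show "(f has_field_derivative deriv f z) (at z within closed_segment (of_real s) (of_real w))"
        by (rule has_field_derivative_at_within)
      show "norm (deriv f z) \<le> C" using dbound t t2 by simp
    qed auto
    also have "norm (complex_of_real w - of_real s) = w - s" using that by (simp flip: of_real_diff)
    finally show ?thesis .
  qed
  have "norm (f (of_real w)) \<le> C * w" if w: "0 < w" "w < c" for w
  proof -
    have "((\<lambda>s. norm (f (of_real w) - f (of_real s))) \<longlongrightarrow> norm (f (of_real w) - 0)) (at_right 0)"
      unfolding f_def by (intro tendsto_intros euler_poly_vanish)
    moreover have "((\<lambda>s. C * (w - s)) \<longlongrightarrow> C * (w - 0)) (at_right 0)"
      by (intro tendsto_intros)
    moreover have "\<forall>\<^sub>F s in at_right 0. norm (f (of_real w) - f (of_real s)) \<le> C * (w - s)"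
      using eventually_small[OF w(1)] by eventually_elim (use lip w in auto)
    ultimately have "norm (f (of_real w) - 0) \<le> C * (w - 0)"
      by (intro tendsto_le[of "at_right (0::real)"]) auto
    then show ?thesis by simp
  qed
  then have "\<forall>\<^sub>F w in at_right 0. norm (f (of_real w)) \<le> C * w"
    using eventually_small[OF c] by (auto elim!: eventually_mono)
  then show ?thesis unfolding f_def by blast
qed

text \<open>
  The constant term of \<open>Q\<close> dominates, so \<open>h\<close> itself would be \<open>O(w)\<close>. But \<open>h\<close> loses at most a factor
  \<open>7/8\<close> when \<open>w\<close> is multiplied by \<open>3/4\<close>.
\<close>

lemma euler_poly_not_linear_at_0:
  assumes "coeff Q 0 \<noteq> 0" and C: "\<forall>\<^sub>F w in at_right 0. norm (euler_poly Q h (of_real w)) \<le> C * w"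
  shows False
proof -
  define q where "q = norm (coeff Q 0)"
  have q: "q > 0" using assms by (simp add: q_def)
  have "\<forall>\<^sub>F w in at_right 0. norm (euler_poly Q h (of_real w) - coeff Q 0 * h (of_real w)) \<le> q / 2 * norm (h (of_real w))"
    using q by (intro euler_poly_asymp) auto
  moreover have "\<forall>\<^sub>F w in at_right 0. \<forall>z\<in>cball (of_real w) (w / 4). norm (h z - h (of_real w)) \<le> 1/8 * norm (h (of_real w))"
    by (rule slow) simp
  ultimately
  have "\<forall>\<^sub>F w in at_right 0. q / 2 * norm (h (of_real w)) \<le> C * w \<and> h (of_real w) \<noteq> 0 \<and> 7/8 * norm (h (of_real w)) \<le> norm (h (of_real (3/4 * w)))"
    using C nonzero eventually_small[OF w0]
  proof eventually_elim
    case (elim w)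
    note 1 = elim
    have "norm (coeff Q 0 * h (of_real w)) \<le> norm (euler_poly Q h (of_real w)) + norm (euler_poly Q h (of_real w) - coeff Q 0 * h (of_real w))"
      using norm_triangle_ineq4[of "euler_poly Q h (of_real w)" "euler_poly Q h (of_real w) - coeff Q 0 * h (of_real w)"] by simp
    then have A: "q * norm (h (of_real w)) \<le> C * w + q / 2 * norm (h (of_real w))"
      using 1 by (simp add: norm_mult q_def)
    have "complex_of_real (3/4 * w) \<in> cball (of_real w) (w / 4)"
    proof -
      have "complex_of_real w - of_real (3/4 * w) = of_real (w / 4)" by simp
      then have "norm (complex_of_real w - of_real (3/4 * w)) = \<bar>w / 4\<bar>" by (simp only: norm_of_real)
      then show ?thesis using 1 by (simp only: mem_cball dist_norm) simp
    qed
    then have "norm (h (of_real (3/4 * w)) - h (of_real w)) \<le> 1/8 * norm (h (of_real w))"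
      using 1 by blast
    then show ?case using A 1 norm_triangle_ineq2[of "h (of_real w)" "h (of_real (3/4 * w))"] by (simp add: norm_minus_commute)
  qed
  then obtain b where b: "b > 0" "\<And>w. 0 < w \<Longrightarrow> w < b \<Longrightarrow> q / 2 * norm (h (of_real w)) \<le> C * w \<and> h (of_real w) \<noteq> 0 \<and> 7/8 * norm (h (of_real w)) \<le> norm (h (of_real (3/4 * w)))"
    unfolding eventually_at_right_field by auto
  define w where "w = b / 2"
  have w: "0 < w" "w < b" using b by (auto simp: w_def)
  have wm: "0 < (3/4) ^ m * w" "(3/4) ^ m * w < b" for m
  proof -
    have "(3/4::real) ^ m \<le> 1" by (rule power_le_one) auto
    then have "(3/4) ^ m * w \<le> 1 * w" using w by (intro mult_right_mono) auto
    then show "(3/4) ^ m * w < b" using w by linarith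
  qed (use w in simp)
  have low: "(7/8) ^ m * norm (h (of_real w)) \<le> norm (h (of_real ((3/4) ^ m * w)))" for m
  proof (induction m)
    case (Suc m)
    have "(7/8) ^ Suc m * norm (h (of_real w)) \<le> 7/8 * norm (h (of_real ((3/4) ^ m * w)))"
      unfolding power_Suc mult.assoc by (rule mult_left_mono[OF Suc]) simp
    also have "\<dots> \<le> norm (h (of_real (3/4 * ((3/4) ^ m * w))))" using b(2)[OF wm] by blast
    finally show ?case by (simp only: power_Suc mult.assoc)
  qed simp
  define K where "K = C * w / (q / 2 * norm (h (of_real w)))"
  have h0: "norm (h (of_real w)) > 0" using b(2)[OF w] by simp
  have "(7/6) ^ m \<le> K" for m
  proof -
    have "q / 2 * ((7/8) ^ m * norm (h (of_real w))) \<le> q / 2 * norm (h (of_real ((3/4) ^ m * w)))"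
      using low q by (intro mult_left_mono) auto
    also have "\<dots> \<le> C * ((3/4) ^ m * w)" using b(2)[OF wm] by blast
    finally have "(7/8) ^ m * (q / 2 * norm (h (of_real w))) \<le> (3/4) ^ m * (C * w)" by (simp add: mult_ac)
    moreover have "(7/8 :: real) ^ m = (3/4) ^ m * (7/6) ^ m" by (simp flip: power_mult_distrib)
    ultimately have "(3/4) ^ m * ((7/6) ^ m * (q / 2 * norm (h (of_real w)))) \<le> (3/4) ^ m * (C * w)" by (simp only: mult.assoc)
    then have "(7/6) ^ m * (q / 2 * norm (h (of_real w))) \<le> C * w" by (subst (asm) mult_le_cancel_left_pos) auto
    then show ?thesis unfolding K_def using h0 q by (subst pos_le_divide_eq) auto
  qed
  moreover obtain m where "K < (7/6) ^ m" using real_arch_pow[of "7/6" K] by auto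
  ultimately show False by (meson not_le)
qed

text \<open>
  Write the equation in terms of the Euler operator and divide by the highest possible power of \<open>z\<close>. At
  \<open>z = 0\<close> the coefficients then combine to a nonzero polynomial \<open>Q\<close>, the indicial polynomial, and
  \<open>Q(euler) h = O(w)\<close>: the inhomogeneity coming from the constant \<open>1\<close> vanishes at \<open>0\<close>, because \<open>h\<close>
  does. Integrating away the factors \<open>x\<close> of \<open>Q\<close> leaves a polynomial with a nonzero constant term,
  which is impossible.
\<close>

theorem no_linear_ode:
  assumes ode: "\<And>w. 0 < w \<Longrightarrow> w < w0 \<Longrightarrow> (\<Sum>i\<le>r. poly (p i) (of_real w) * (deriv ^^ i) (\<lambda>z. 1 - h z) (of_real w)) = 0"
  shows "\<forall>i\<le>r. p i = 0"
proof (rule ccontr)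
  assume "\<not> (\<forall>i\<le>r. p i = 0)"
  then obtain i0 where i0: "i0 \<le> r" "p i0 \<noteq> 0" by blast
  (* coefficients after multiplication by z^r, to be combined with z^i (d/dz)^i *)
  define c where "c = (\<lambda>i. monom 1 (r - i) * p i)"
  have c0: "c i = 0 \<longleftrightarrow> p i = 0" for i by (simp add: c_def)
  define N where "N = Min ((\<lambda>i. order 0 (c i)) ` {i. i \<le> r \<and> p i \<noteq> 0})"
  have fin: "finite ((\<lambda>i. order 0 (c i)) ` {i. i \<le> r \<and> p i \<noteq> 0})" by simp
  have dvd: "[:0, 1:] ^ N dvd c i" if "i \<le> r" for i
  proof (cases "p i = 0")
    case False
    then have "N \<le> order 0 (c i)" unfolding N_def using fin that by (intro Min_le) auto
    then show ?thesis using order_1[of 0 "c i"] by (simp add: power_le_dvd)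
  qed (simp add: c_def)
  then have "\<forall>i. \<exists>e. i \<le> r \<longrightarrow> c i = [:0, 1:] ^ N * e" by (auto simp: dvd_def)
  then obtain e where e: "\<And>i. i \<le> r \<Longrightarrow> c i = [:0, 1:] ^ N * e i" by metis
  obtain i1 where i1: "i1 \<le> r" "p i1 \<noteq> 0" "order 0 (c i1) = N"
    using Min_in[OF fin] i0 unfolding N_def by fastforce
  have e1: "poly (e i1) 0 \<noteq> 0"
  proof
    assume "poly (e i1) 0 = 0"
    then obtain g where "e i1 = [:0, 1:] * g" using poly_eq_0_iff_dvd[of "e i1" 0] by (auto simp: dvd_def)
    then have "c i1 = [:0, 1:] ^ Suc N * g" using e[OF i1(1)] by (simp add: mult_ac)
    then have "[:- 0, 1:] ^ Suc N dvd c i1" unfolding minus_zero by (rule dvdI)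
    then have "c i1 = 0 \<or> Suc N \<le> order 0 (c i1)" by (rule iffD1[OF order_divides])
    then show False using i1 c0 by simp
  qed
  (* the homogeneous part of the equation, evaluated at h *)
  define E where "E = (\<lambda>w::real. (\<Sum>i\<le>r. poly (e i) (of_real w) * euler_poly (falling_poly i) h (of_real w)))"
  have Eeq: "E w = poly (e 0) (of_real w)" if w: "0 < w" "w < w0" for w
  proof -
    define z where "z = complex_of_real w"
    have z: "z \<noteq> 0" "z \<in> \<Omega>" using w real_in_dom by (auto simp: z_def)
    have hd: "(deriv ^^ i) (\<lambda>z. 1 - h z) z = (if i = 0 then 1 else 0) - (deriv ^^ i) h z" for i
      using higher_deriv_diff[OF holomorphic_on_const hol open_dom z(2), of i 1] by (simp add: higher_deriv_const)
    have "0 = z ^ r * (\<Sum>i\<le>r. poly (p i) z * (deriv ^^ i) (\<lambda>z. 1 - h z) z)"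
      using ode[OF w] by (simp add: z_def)
    also have "\<dots> = (\<Sum>i\<le>r. poly (c i) z * (z ^ i * (deriv ^^ i) (\<lambda>z. 1 - h z) z))"
      unfolding sum_distrib_left
    proof (rule sum.cong)
      fix i assume "i \<in> {..r}"
      then have "z ^ r = z ^ (r - i) * z ^ i" by (simp flip: power_add)
      then show "z ^ r * (poly (p i) z * (deriv ^^ i) (\<lambda>z. 1 - h z) z) = poly (c i) z * (z ^ i * (deriv ^^ i) (\<lambda>z. 1 - h z) z)"
        by (simp add: c_def poly_monom)
    qed simp
    also have "\<dots> = z ^ N * (\<Sum>i\<le>r. poly (e i) z * (z ^ i * (deriv ^^ i) (\<lambda>z. 1 - h z) z))"
      unfolding sum_distrib_left by (rule sum.cong) (auto simp: e)
    finally have "(\<Sum>i\<le>r. poly (e i) z * (z ^ i * (deriv ^^ i) (\<lambda>z. 1 - h z) z)) = 0" using z by simp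
    also have "(\<Sum>i\<le>r. poly (e i) z * (z ^ i * (deriv ^^ i) (\<lambda>z. 1 - h z) z)) =
       (\<Sum>i\<le>r. (if i = 0 then poly (e 0) z else 0) - poly (e i) z * euler_poly (falling_poly i) h z)"
      unfolding falling_poly_deriv[OF z(2), symmetric] hd by (rule sum.cong) (auto simp: algebra_simps)
    also have "\<dots> = poly (e 0) z - E w" by (simp add: sum_subtractf E_def z_def)
    finally show ?thesis by (simp add: z_def)
  qed
  have pl: "((\<lambda>w. poly q (complex_of_real w)) \<longlongrightarrow> poly q 0) (at_right 0)" for q
  proof -
    have "isCont (\<lambda>w. poly q (complex_of_real w)) 0" by (intro continuous_intros)
    then have "((\<lambda>w. poly q (complex_of_real w)) \<longlongrightarrow> poly q (of_real 0)) (at 0)" by (simp add: isCont_def)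
    then show ?thesis by (simp add: filterlim_at_split)
  qed
  have E0: "(E \<longlongrightarrow> (\<Sum>i\<le>r. poly (e i) 0 * 0)) (at_right 0)"
    unfolding E_def by (intro tendsto_sum tendsto_mult pl euler_poly_vanish)
  have ev: "\<forall>\<^sub>F w in at_right 0. E w = poly (e 0) (of_real w)"
    using eventually_small[OF w0] by eventually_elim (use Eeq in auto)
  then have "(E \<longlongrightarrow> poly (e 0) 0) (at_right 0)"
    using pl[of "e 0"] by (simp add: tendsto_cong)
  with E0 have e00: "poly (e 0) 0 = 0"
    using tendsto_unique[of "at_right (0::real)"] by force
  (* the indicial polynomial *)
  define Q where "Q = (\<Sum>i\<le>r. smult (poly (e i) 0) (falling_poly i))"
  have Q0: "Q \<noteq> 0" unfolding Q_def using i1(1) e1 by (rule falling_poly_combination_nonzero)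
  have QE: "euler_poly Q h (of_real w) = E w - (\<Sum>i\<le>r. (poly (e i) (of_real w) - poly (e i) 0) * euler_poly (falling_poly i) h (of_real w))" for w
    by (simp add: Q_def E_def euler_poly_sum euler_poly_smult left_diff_distrib sum_subtractf)
  have lin: "\<exists>K\<ge>0. \<forall>\<^sub>F w in at_right 0. norm (poly q (complex_of_real w) - poly q 0) \<le> K * w" for q
  proof -
    define g where "g = synthetic_div (q - [:poly q 0:]) 0"
    have eqp: "poly q z - poly q 0 = z * poly g z" for z
    proof -
      have "poly (q - [:poly q 0:]) 0 = 0" by simp
      then have "q - [:poly q 0:] = [:- 0, 1:] * g"
        unfolding g_def using synthetic_div_correct'[of 0 "q - [:poly q 0:]"] by simp
      then have "poly (q - [:poly q 0:]) z = poly ([:- 0, 1:] * g) z" by (rule arg_cong)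
      then show ?thesis by simp
    qed
    have "((\<lambda>w. norm (poly g (complex_of_real w))) \<longlongrightarrow> norm (poly g 0)) (at_right 0)" by (intro tendsto_norm pl)
    then have "\<forall>\<^sub>F w in at_right 0. norm (poly g (complex_of_real w)) < norm (poly g 0) + 1"
      by (rule order_tendstoD) simp
    with eventually_small[OF w0] have "\<forall>\<^sub>F w in at_right 0. norm (poly q (complex_of_real w) - poly q 0) \<le> (norm (poly g 0) + 1) * w"
      by eventually_elim (auto simp: eqp norm_mult mult.commute intro!: mult_left_mono)
    then show ?thesis by (intro exI[of _ "norm (poly g 0) + 1"]) auto
  qed
  have bnd: "\<forall>\<^sub>F w in at_right 0. norm (euler_poly P h (of_real w)) \<le> 1" for P
  proof -
    have "\<forall>\<^sub>F w in at_right 0. norm (euler_poly P h (of_real w)) < 1"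
      using tendsto_norm[OF euler_poly_vanish[of P]] by (rule order_tendstoD) simp
    then show ?thesis by eventually_elim simp
  qed
  obtain K where K: "\<And>q. K q \<ge> 0" "\<And>q. \<forall>\<^sub>F w in at_right 0. norm (poly q (complex_of_real w) - poly q 0) \<le> K q * w"
    using lin by metis
  have "\<exists>C. \<forall>\<^sub>F w in at_right 0. norm (euler_poly Q h (of_real w)) \<le> C * w"
  proof (rule exI[of _ "K (e 0) + (\<Sum>i\<le>r. K (e i))"])
    have "\<forall>\<^sub>F w in at_right 0. \<forall>i\<in>{..r}. norm (poly (e i) (complex_of_real w) - poly (e i) 0) \<le> K (e i) * w"
      by (intro eventually_ball_finite ballI K) auto
    moreover have "\<forall>\<^sub>F w in at_right 0. \<forall>i\<in>{..r}. norm (euler_poly (falling_poly i) h (of_real w)) \<le> 1"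
      by (intro eventually_ball_finite ballI bnd) auto
    ultimately show "\<forall>\<^sub>F w in at_right 0. norm (euler_poly Q h (of_real w)) \<le> (K (e 0) + (\<Sum>i\<le>r. K (e i))) * w"
      using ev eventually_small[OF w0]
    proof eventually_elim
      case (elim w)
      have "norm (poly (e 0) (complex_of_real w) - poly (e 0) 0) \<le> K (e 0) * w" using elim by blast
      then have "norm (E w) \<le> K (e 0) * w" using elim e00 by simp
      moreover have "norm (\<Sum>i\<le>r. (poly (e i) (of_real w) - poly (e i) 0) * euler_poly (falling_poly i) h (of_real w)) \<le> (\<Sum>i\<le>r. K (e i) * w * 1)"
        by (rule order_trans[OF norm_sum], rule sum_mono, subst norm_mult, rule mult_mono) (use elim K in auto)
      ultimately show ?case
        unfolding QE by (intro order_trans[OF norm_triangle_ineq4]) (simp add: distrib_right sum_distrib_right)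
    qed
  qed
  moreover obtain Q' where Q': "Q = [:- 0, 1:] ^ order 0 Q * Q'" "\<not> [:- 0, 1:] dvd Q'"
    using order_decomp[OF Q0, of 0] by blast
  ultimately have bigO: "\<exists>C. \<forall>\<^sub>F w in at_right 0. norm (euler_poly ([:- 0, 1:] ^ order 0 Q * Q') h (of_real w)) \<le> C * w" by simp
  have "\<exists>C. \<forall>\<^sub>F w in at_right 0. norm (euler_poly Q' h (of_real w)) \<le> C * w"
    if "\<exists>C. \<forall>\<^sub>F w in at_right 0. norm (euler_poly ([:- 0, 1:] ^ k * Q') h (of_real w)) \<le> C * w" for k
    using that
  proof (induction k)
    case (Suc k)
    have "[:- 0, 1:] ^ Suc k * Q' = pCons 0 ([:- 0, 1:] ^ k * Q')" by (simp add: mult.assoc)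
    with Suc.prems have "\<exists>C. \<forall>\<^sub>F w in at_right 0. norm (euler_poly (pCons 0 ([:- 0, 1:] ^ k * Q')) h (of_real w)) \<le> C * w"
      by (simp only:)
    from euler_poly_integrate[OF this] show ?case by (rule Suc.IH)
  qed simp
  from this[OF bigO] obtain C where "\<forall>\<^sub>F w in at_right 0. norm (euler_poly Q' h (of_real w)) \<le> C * w" by blast
  moreover have "coeff Q' 0 \<noteq> 0" using Q'(2) poly_eq_0_iff_dvd[of Q' 0] by (simp add: poly_0_coeff_0)
  ultimately show False by (rule euler_poly_not_linear_at_0[rotated])
qed

end

section \<open>Failure of holonomicity\<close>

text \<open>
  Clear denominators.
\<close>

lemma holonomic_polynomial_ode:
  assumes "holonomic f"
  obtains r P where "\<exists>i\<le>r. P i \<noteq> 0" "(\<Sum>i\<le>r. fps_of_poly (P i) * (fps_deriv ^^ i) f) = 0"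
proof -
  obtain r p q where q: "\<And>i. i \<le> r \<Longrightarrow> q i \<noteq> 0" and p: "\<exists>i\<le>r. p i \<noteq> 0"
    and eq: "(\<Sum>i\<le>r. ratfun_fls (p i) (q i) * fps_to_fls ((fps_deriv ^^ i) f)) = 0"
    using assms unfolding holonomic_def by auto
  define P where "P = (\<lambda>i. p i * (\<Prod>j\<in>{..r} - {i}. q j))"
  define D where "D = fps_to_fls (fps_of_poly (\<Prod>j\<le>r. q j))"
  have D: "D * ratfun_fls (p i) (q i) = fps_to_fls (fps_of_poly (P i))" if i: "i \<le> r" for i
  proof -
    have "(\<Prod>j\<le>r. q j) = q i * (\<Prod>j\<in>{..r} - {i}. q j)" using i by (intro prod.remove) auto
    moreover have "fps_to_fls (fps_of_poly (q i)) \<noteq> 0" using q[OF i] by (metis fps_of_poly_0 fps_of_poly_eq_iff fps_to_fls_eq_0_iff)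
    ultimately show ?thesis
      by (simp add: D_def ratfun_fls_def P_def fps_of_poly_mult fls_times_fps_to_fls)
  qed
  have "0 = D * (\<Sum>i\<le>r. ratfun_fls (p i) (q i) * fps_to_fls ((fps_deriv ^^ i) f))" by (simp add: eq)
  also have "\<dots> = (\<Sum>i\<le>r. fps_to_fls (fps_of_poly (P i) * (fps_deriv ^^ i) f))"
    unfolding sum_distrib_left by (intro sum.cong) (auto simp: D fls_times_fps_to_fls mult.assoc[symmetric])
  also have "\<dots> = fps_to_fls (\<Sum>i\<le>r. fps_of_poly (P i) * (fps_deriv ^^ i) f)"
    by (induction r) auto
  finally have "(\<Sum>i\<le>r. fps_of_poly (P i) * (fps_deriv ^^ i) f) = 0"
    by (metis fps_to_fls_eq_0_iff)
  moreover have "\<exists>i\<le>r. P i \<noteq> 0" using p q by (auto simp: P_def)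
  ultimately show thesis using that by blast
qed

lemma radius_higher_deriv:
  fixes f :: "complex fps"
  shows "fps_conv_radius ((fps_deriv ^^ i) f) \<ge> fps_conv_radius f"
  by (induction i) (auto intro: order_trans[OF _ fps_conv_radius_deriv])

lemma eval_fps_higher_deriv:
  fixes f :: "complex fps"
  assumes "ereal R \<le> fps_conv_radius f" "norm z < R"
  shows "(deriv ^^ i) (eval_fps f) z = eval_fps ((fps_deriv ^^ i) f) z"
  using assms(2)
proof (induction i arbitrary: z)
  case (Suc i)
  have "deriv ((deriv ^^ i) (eval_fps f)) z = deriv (eval_fps ((fps_deriv ^^ i) f)) z"
    using Suc by (intro deriv_cong_ev eventually_nhds_in_open[THEN eventually_mono, of "ball 0 R"]) auto
  also have "\<dots> = eval_fps (fps_deriv ((fps_deriv ^^ i) f)) z"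
  proof (rule DERIV_imp_deriv, rule has_field_derivative_eval_fps)
    have "ereal (norm z) < ereal R" using Suc.prems by simp
    also have "\<dots> \<le> fps_conv_radius ((fps_deriv ^^ i) f)" using assms(1) radius_higher_deriv[of f i] by (rule order_trans)
    finally show "ereal (norm z) < fps_conv_radius ((fps_deriv ^^ i) f)" .
  qed
  finally show ?case by simp
qed simp

definition ode :: "nat \<Rightarrow> (nat \<Rightarrow> complex poly) \<Rightarrow> (complex \<Rightarrow> complex) \<Rightarrow> complex \<Rightarrow> complex" where
  "ode r P y z = (\<Sum>i\<le>r. poly (P i) z * (deriv ^^ i) y z)"

lemma ode_fps:
  assumes R: "ereal R \<le> fps_conv_radius f" and z: "norm z < R"
    and eq: "(\<Sum>i\<le>r. fps_of_poly (P i) * (fps_deriv ^^ i) f) = 0"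
  shows "ode r P (eval_fps f) z = 0"
proof -
  have rad: "ereal (norm z) < fps_conv_radius ((fps_deriv ^^ i) f)" for i
  proof -
    have "ereal (norm z) < ereal R" using z by simp
    also have "\<dots> \<le> fps_conv_radius ((fps_deriv ^^ i) f)" using R radius_higher_deriv[of f i] by (rule order_trans)
    finally show ?thesis .
  qed
  have radm: "ereal (norm z) < fps_conv_radius (fps_of_poly (P i) * (fps_deriv ^^ i) f)" for i
    using fps_conv_radius_mult[of "fps_of_poly (P i)" "(fps_deriv ^^ i) f"] rad[of i]
    by (auto intro: less_le_trans)
  have rads: "ereal (norm z) < fps_conv_radius (\<Sum>i\<le>k. fps_of_poly (P i) * (fps_deriv ^^ i) f)" for k
  proof (induction k)
    case (Suc k)
    then show ?case using radm[of "Suc k"] fps_conv_radius_add[of "\<Sum>i\<le>k. fps_of_poly (P i) * (fps_deriv ^^ i) f" "fps_of_poly (P (Suc k)) * (fps_deriv ^^ Suc k) f"]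
      by (auto simp: min_def split: if_splits intro: less_le_trans)
  qed (use radm[of 0] in simp)
  have "eval_fps (\<Sum>i\<le>k. fps_of_poly (P i) * (fps_deriv ^^ i) f) z = (\<Sum>i\<le>k. poly (P i) z * eval_fps ((fps_deriv ^^ i) f) z)" for k
  proof (induction k)
    case 0
    then show ?case using rad[of 0] by (simp add: eval_fps_mult)
  next
    case (Suc k)
    then show ?case using rad[of "Suc k"] rads[of k] radm[of "Suc k"] by (simp add: eval_fps_add eval_fps_mult)
  qed
  from this[of r] have "(\<Sum>i\<le>r. poly (P i) z * eval_fps ((fps_deriv ^^ i) f) z) = 0"
    by (simp only: eq eval_fps_0)
  then show ?thesis unfolding ode_def eval_fps_higher_deriv[OF R z] .
qed

text \<open>
  The permanence principle for linear differential equations.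
\<close>

lemma ode_continuation:
  assumes T1: "open T1" "y1 holomorphic_on T1" and T2: "open T2" "connected T2" "y2 holomorphic_on T2"
    and U: "open U" "U \<noteq> {}" "U \<subseteq> T1" "U \<subseteq> T2" and eq: "\<And>z. z \<in> U \<Longrightarrow> y1 z = y2 z"
    and y1: "\<And>z. z \<in> U \<Longrightarrow> ode r P y1 z = 0" and z: "z \<in> T2"
  shows "ode r P y2 z = 0"
proof (rule analytic_continuation_open[of U T2 "ode r P y2" "\<lambda>_. 0"])
  show "ode r P y2 holomorphic_on T2"
    unfolding ode_def[abs_def] by (intro holomorphic_intros holomorphic_higher_deriv T2)
  fix u assume u: "u \<in> U"
  have "(deriv ^^ i) y2 u = (deriv ^^ i) y1 u" for i
    using U T1 T2 u eq by (intro higher_deriv_transform_within_open[of _ U]) (auto intro: holomorphic_on_subset)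
  then show "ode r P y2 u = 0" using y1[OF u] by (simp add: ode_def)
qed (use assms in auto)

lemma countable_zeros:
  assumes "f holomorphic_on S" "open S" "connected S" "z0 \<in> S" "f z0 \<noteq> 0"
  shows "countable {z\<in>S. f z = 0}"
proof -
  have "\<not> y islimpt {z\<in>S. f z = 0}" if "y \<in> S" for y
  proof
    assume y: "y islimpt {z\<in>S. f z = 0}"
    have "f z0 = 0" by (rule analytic_continuation[OF assms(1-3) _ that y _ assms(4)]) auto
    then show False using assms(5) by simp
  qed
  then have "{z\<in>S. f z = 0} sparse_in S" using assms(2) by (auto simp: sparse_in_def)
  then have "countable (S \<inter> {z\<in>S. f z = 0})" using assms(2) by (intro sparse_imp_countable)
  moreover have "S \<inter> {z\<in>S. f z = 0} = {z\<in>S. f z = 0}" by auto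
  ultimately show ?thesis by simp
qed

lemma open_nonzero:
  assumes "f holomorphic_on S" "open S" shows "open {z\<in>S. f z \<noteq> 0}"
proof -
  have "open (S \<inter> f -` (- {0}))"
    using assms by (intro continuous_open_preimage holomorphic_on_imp_continuous_on) auto
  moreover have "S \<inter> f -` (- {0}) = {z\<in>S. f z \<noteq> 0}" by auto
  ultimately show ?thesis by simp
qed

lemma connected_nonzero:
  assumes "f holomorphic_on S" "open S" "connected S" "z0 \<in> S" "f z0 \<noteq> 0"
  shows "connected {z\<in>S. f z \<noteq> 0}"
proof -
  have "connected (S - {z\<in>S. f z = 0})"
    using assms by (intro connected_open_diff_countable countable_zeros) auto
  moreover have "S - {z\<in>S. f z = 0} = {z\<in>S. f z \<noteq> 0}" by auto
  ultimately show ?thesis by simp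
qed

lemma connected_slit_domain: "d \<ge> 1 \<Longrightarrow> connected (slit_domain d)"
proof (rule starlike_imp_connected)
  assume d: "d \<ge> 1"
  define c where "c = crit d / 2"
  have c: "0 < c" "c < crit d" using crit_pos[OF d] by (auto simp: c_def)
  show "starlike (slit_domain d)"
    unfolding starlike_def
  proof (intro bexI[of _ "of_real c"] ballI subsetI)
    show "of_real c \<in> slit_domain d" using c by (auto simp: slit_domain_def cut_plane_def complex_nonpos_Reals_iff)
    fix w z assume w: "w \<in> slit_domain d" and "z \<in> closed_segment (of_real c) w"
    then obtain t where t: "0 \<le> t" "t \<le> 1" "z = (1 - t) *\<^sub>R of_real c + t *\<^sub>R w" by (auto simp: in_segment)
    have Re: "Re z = (1 - t) * c + t * Re w" and Im: "Im z = t * Im w" by (simp_all add: t(3))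
    show "z \<in> slit_domain d"
    proof (cases "t = 0 \<or> Im w \<noteq> 0")
      case True
      then show ?thesis using c t by (auto simp: slit_domain_def cut_plane_def complex_nonpos_Reals_iff Re Im)
    next
      case False
      then have w': "Im w = 0" "0 < Re w" "Re w < crit d" "0 < t" using w t
        by (auto simp: slit_domain_def cut_plane_def complex_nonpos_Reals_iff)
      have "0 < (1 - t) * c + t * Re w" using w' c t by (intro add_nonneg_pos mult_nonneg_nonneg mult_pos_pos) auto
      moreover have "(1 - t) * c + t * Re w < (1 - t) * crit d + t * crit d"
        using w' c t by (intro add_le_less_mono mult_left_mono mult_strict_left_mono) auto
      ultimately show ?thesis
        by (simp add: slit_domain_def cut_plane_def complex_nonpos_Reals_iff Re Im w' algebra_simps)
    qed
  qed
qed

text \<open>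
  Follow the solution \<open>B = 1 - 1 / Green\<close> from the disc of convergence to the upper side of the cut, through
  the cut by \<open>Green_continuation\<close>, and then over the second sheet. Zeros of the continued \<open>Green\<close> are avoided,
  as removing them leaves a domain connected.
\<close>

lemma second_sheet_ode:
  assumes d: "d = Suc n" and eq: "(\<Sum>i\<le>r. fps_of_poly (P i) * (fps_deriv ^^ i) (B_series d)) = 0"
    and z: "z \<in> slit_domain d" "second_sheet n z \<noteq> 0"
  shows "ode r P (\<lambda>w. 1 - 1 / second_sheet n w) z = 0"
proof -
  have d1: "d \<ge> 1" using d by simp
  have R: "ereal (crit d) \<le> fps_conv_radius (B_series d)" by (simp add: radius_B[OF d1])
  define y0 where "y0 = eval_fps (B_series d)"
  define y1 where "y1 = (\<lambda>w. 1 - 1 / Green d w)"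
  have y1h: "y1 holomorphic_on cut_plane d"
    unfolding y1_def using Green_nonzero[OF d1] by (intro holomorphic_intros Green_holomorphic) auto
  have y0h: "y0 holomorphic_on ball 0 (crit d)"
    unfolding y0_def using R by (intro holomorphic_on_eval_fps ball_eball_mono)
  have ccp: "connected (cut_plane d)" by (rule connected_cut_plane[OF d1])
  have ode1: "ode r P y1 w = 0" if "w \<in> cut_plane d" for w
  proof (rule ode_continuation[of "ball 0 (crit d)" y0 "cut_plane d" y1 "ball 0 (crit d)"])
    show "y0 u = y1 u" if "u \<in> ball 0 (crit d)" for u
      using that eval_B[OF d1 radius_B_ge[OF d1]] by (simp add: y0_def y1_def)
    show "ode r P y0 u = 0" if "u \<in> ball 0 (crit d)" for u
      unfolding y0_def using that by (intro ode_fps[OF R _ eq]) simp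
  qed (use that y0h y1h ccp open_cut_plane ball_subset_cut_plane[OF d1] crit_pos[OF d1] in auto)
  (* any point of the cut near its end would do *)
  define x0 where "x0 = complex_of_real (cut_point d (1/2))"
  obtain F \<delta> where F: "\<delta> > 0" "F holomorphic_on ball x0 \<delta>"
    "\<And>w. w \<in> ball x0 \<delta> \<Longrightarrow> Im w > 0 \<Longrightarrow> F w = Green d w"
    "\<And>w. w \<in> ball x0 \<delta> \<Longrightarrow> Im w < 0 \<Longrightarrow> F w = second_sheet n w"
    by (rule Green_continuation[of "1/2" n, folded d, folded x0_def]) (auto intro: that)
  have off: "w \<in> cut_plane d" if "Im w \<noteq> 0" for w using that by (simp add: cut_plane_def)
  define u0 where "u0 = x0 + \<i> * of_real (\<delta> / 2)"
  have u0: "u0 \<in> ball x0 \<delta>" "Im u0 > 0" using F(1) by (auto simp: u0_def x0_def dist_norm norm_mult)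
  have Fu0: "F u0 \<noteq> 0" using F(3)[OF u0] Green_nonzero[OF d1 off[of u0]] u0 by simp
  define T where "T = {w\<in>ball x0 \<delta>. F w \<noteq> 0}"
  have T: "open T" "connected T"
    unfolding T_def
    by (rule open_nonzero[OF F(2) open_ball], rule connected_nonzero[OF F(2) open_ball connected_ball u0(1) Fu0])
  define y2 where "y2 = (\<lambda>w. 1 - 1 / F w)"
  have y2h: "y2 holomorphic_on T" unfolding y2_def T_def
    by (intro holomorphic_intros holomorphic_on_subset[OF F(2)]) auto
  have ode2: "ode r P y2 w = 0" if "w \<in> T" for w
  proof (rule ode_continuation[of "cut_plane d" y1 T y2 "T \<inter> {z. Im z > 0}"])
    show "T \<inter> {z. Im z > 0} \<noteq> {}" using u0 Fu0 by (auto simp: T_def)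
    show "y1 u = y2 u" if "u \<in> T \<inter> {z. Im z > 0}" for u
      using that F(3)[of u] by (auto simp: y1_def y2_def T_def)
    show "ode r P y1 u = 0" if "u \<in> T \<inter> {z. Im z > 0}" for u using that by (intro ode1 off) auto
  qed (use that T y1h y2h open_cut_plane off in \<open>auto intro: open_halfspace_Im_gt\<close>)
  define W where "W = {w\<in>slit_domain d. second_sheet n w \<noteq> 0}"
  have ssh: "second_sheet n holomorphic_on slit_domain d" unfolding d by (rule second_sheet_holomorphic)
  have W: "open W" "connected W"
    unfolding W_def
    by (rule open_nonzero[OF ssh open_slit_domain],
        rule connected_nonzero[OF ssh open_slit_domain connected_slit_domain[OF d1] z])
  define y3 where "y3 = (\<lambda>w. 1 - 1 / second_sheet n w)"
  have y3h: "y3 holomorphic_on W" unfolding y3_def W_def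
    by (intro holomorphic_intros holomorphic_on_subset[OF ssh]) auto
  have in_slit: "w \<in> slit_domain d" if "Im w \<noteq> 0" for w
    using that by (auto simp: slit_domain_def cut_plane_def complex_nonpos_Reals_iff)
  (* F is not identically zero, so its zeros do not fill the lower half of the disc *)
  have ne: "T \<inter> {z. Im z < 0} \<noteq> {}"
  proof
    assume e: "T \<inter> {z. Im z < 0} = {}"
    define u1 where "u1 = x0 - \<i> * of_real (\<delta> / 2)"
    have sub: "ball u1 (\<delta> / 4) \<subseteq> {w\<in>ball x0 \<delta>. F w = 0}"
    proof
      fix w assume w: "w \<in> ball u1 (\<delta> / 4)"
      have "dist x0 u1 = \<delta> / 2" using F(1) by (simp add: u1_def dist_norm norm_mult)
      then have 1: "w \<in> ball x0 \<delta>" using w F(1) dist_triangle[of x0 w u1] by auto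
      have "\<bar>Im (u1 - w)\<bar> < \<delta> / 4" using w abs_Im_le_cmod[of "u1 - w"] by (simp add: dist_norm)
      then have "Im w < 0" using F(1) abs_ge_minus_self[of "Im (u1 - w)"] by (simp add: u1_def x0_def)
      then show "w \<in> {w\<in>ball x0 \<delta>. F w = 0}" using 1 e by (auto simp: T_def)
    qed
    moreover have "countable {w\<in>ball x0 \<delta>. F w = 0}"
      using F(2) u0 Fu0 by (intro countable_zeros) auto
    ultimately have "countable (ball u1 (\<delta> / 4))" by (rule countable_subset)
    then show False using uncountable_ball[of "\<delta> / 4" u1] F(1) by simp
  qed
  have "ode r P y3 z = 0"
  proof (rule ode_continuation[of T y2 W y3 "T \<inter> {z. Im z < 0}"])
    show "T \<inter> {z. Im z < 0} \<subseteq> W" using F(4) in_slit by (auto simp: T_def W_def)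
    show "y2 u = y3 u" if "u \<in> T \<inter> {z. Im z < 0}" for u
      using that F(4)[of u] by (auto simp: y2_def y3_def T_def)
    show "ode r P y2 u = 0" if "u \<in> T \<inter> {z. Im z < 0}" for u using that by (intro ode2) auto
    show "z \<in> W" using z by (simp add: W_def)
  qed (use T W y2h y3h ne in \<open>auto intro: open_halfspace_Im_lt\<close>)
  then show ?thesis by (simp add: y3_def)
qed

lemma csqrt_scale:
  assumes "0 < x" "0 < Re l" shows "csqrt (l * of_real x) = csqrt l * of_real (sqrt x)"
proof (rule csqrt_unique)
  show "(csqrt l * of_real (sqrt x))\<^sup>2 = l * of_real x"
    using assms by (simp add: power_mult_distrib del: csqrt.simps flip: of_real_power)
  have "0 < Re (csqrt l)" using assms by (intro Re_csqrt_pos) (auto simp: complex_nonpos_Reals_iff)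
  then show "0 < Re (csqrt l * of_real (sqrt x)) \<or> Re (csqrt l * of_real (sqrt x)) = 0 \<and> 0 \<le> Im (csqrt l * of_real (sqrt x))"
    using assms by (simp del: csqrt.simps)
qed

lemma inverse_csqrt_near_1:
  assumes "m \<in> cball 1 (1/4)" shows "norm (1 / csqrt m - 1) \<le> 1/3"
proof -
  define s where "s = csqrt m"
  have nm: "norm (m - 1) \<le> 1/4" using assms by (simp add: dist_norm norm_minus_commute)
  have "Re s \<ge> 0" unfolding s_def by (rule Re_csqrt)
  then have "1 \<le> norm (s + 1)" using complex_Re_le_cmod[of "s + 1"] by simp
  then have "norm (s - 1) * 1 \<le> norm (s - 1) * norm (s + 1)" by (intro mult_left_mono) auto
  also have "\<dots> = norm (m - 1)"
  proof -
    have "(s - 1) * (s + 1) = m - 1" by (simp add: algebra_simps s_def del: csqrt.simps flip: power2_eq_square)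
    then show ?thesis by (simp flip: norm_mult)
  qed
  finally have s1: "norm (s - 1) \<le> 1/4" using nm by simp
  then have s2: "norm s \<ge> 3/4" using norm_triangle_ineq2[of 1 "1 - s"] by (simp add: norm_minus_commute)
  then have s0: "s \<noteq> 0" by auto
  have "norm (1 / s - 1) = norm (s - 1) / norm s"
    using s0 by (simp add: norm_divide[symmetric] norm_minus_commute diff_divide_distrib)
  also have "\<dots> \<le> (1/4) / (3/4)" using s1 s2 by (intro frac_le) auto
  finally show ?thesis by (simp add: s_def)
qed

text \<open>
  The asymptotic size, up to a constant factor, of the difference of the two sheets at the gap \<open>- x\<close>.
\<close>

definition kappa :: "nat \<Rightarrow> real \<Rightarrow> real" where
  "kappa n x = sqrt x ^ Suc n * phi n (- x)"

text \<open>
  The point \<open>w\<close> near \<open>0\<close> corresponds to the gap \<open>d - energy w = - depth n w\<close> with \<open>d = n + 1\<close>.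
\<close>

definition depth :: "nat \<Rightarrow> real \<Rightarrow> real" where
  "depth n w = 1 / (2 * sqrt w) - real (Suc n)"

lemma depth_at_top: "filterlim (depth n) at_top (at_right 0)"
  unfolding depth_def by real_asymp

text \<open>
  For \<open>n = 0\<close> it is bounded; this is where dimension one is exceptional.
\<close>

lemma kappa_at_top: "n \<ge> 1 \<Longrightarrow> filterlim (kappa n) at_top at_top"
  using phi_growth_Suc[of "n - 1"] by (simp add: kappa_def[abs_def])

text \<open>
  On the disc of radius \<open>w/4\<close> about \<open>w\<close>, the negated gap \<open>energy z - d\<close> is the multiple \<open>l\<close> of its value at
  \<open>w\<close>, with \<open>l\<close> in a fixed disc about \<open>1\<close>.
\<close>

lemma second_sheet_rescaled:
  assumes w: "0 < w" and x: "depth n w \<ge> 2 * real (Suc n)" and z: "z \<in> cball (of_real w) (w / 4)"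
  obtains l where "l \<in> cball 1 (1/2)"
    "second_sheet n z = Green (Suc n) z - jump_const n * ((1 + of_real (Suc n) / (l * of_real (depth n w))) *
      (of_real (sqrt (depth n w) ^ Suc n) * scaled_Phi n l (depth n w)))"
proof -
  define E where "E = 1 / (2 * sqrt w)"
  define x where "x = depth n w"
  define D where "D = real (Suc n)"
  have D: "D \<ge> 1" by (simp add: D_def)
  have Ex: "E = x + D" by (simp add: E_def x_def depth_def D_def)
  have x2: "x \<ge> 2 * D" using assms(2) by (simp add: x_def D_def)
  define m where "m = z / of_real w"
  have zm: "z = m * of_real w" using w by (simp add: m_def)
  have "norm (z - of_real w) \<le> w / 4" using z by (simp add: dist_norm norm_minus_commute)
  moreover have "z - of_real w = (m - 1) * of_real w" by (simp add: zm algebra_simps)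
  ultimately have "norm (m - 1) * w \<le> 1/4 * w" using w by (simp add: norm_mult)
  then have nm: "norm (m - 1) \<le> 1/4" using w by (subst (asm) mult_le_cancel_right_pos) auto
  then have m: "m \<in> cball 1 (1/4)" by (simp add: dist_norm norm_minus_commute)
  have "\<bar>Re (m - 1)\<bar> \<le> 1/4" using abs_Re_le_cmod[of "m - 1"] nm by linarith
  then have Rm: "Re m > 0" unfolding minus_complex.sel one_complex.sel by linarith
  have en: "energy z = of_real E / csqrt m"
    unfolding energy_def zm csqrt_scale[OF w Rm] by (simp add: E_def del: csqrt.simps)
  define l where "l = (energy z - of_real D) / of_real x"
  have x0: "x > 0" using x2 D by simp
  have y: "energy z - of_real D = l * of_real x" using x0 by (simp add: l_def)
  have "l - 1 = of_real (E / x) * (1 / csqrt m - 1)"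
    using x0 by (simp add: l_def en Ex field_simps del: csqrt.simps)
  then have "norm (l - 1) = \<bar>E / x\<bar> * norm (1 / csqrt m - 1)" by (simp only: norm_mult norm_of_real)
  also have "\<bar>E / x\<bar> * norm (1 / csqrt m - 1) = E / x * norm (1 / csqrt m - 1)" using x0 D by (simp add: Ex)
  also have "\<dots> \<le> (3/2) * (1/3)"
    using inverse_csqrt_near_1[OF m] x0 x2 D by (intro mult_mono) (auto simp: Ex field_simps simp del: csqrt.simps)
  finally have nl: "norm (l - 1) \<le> 1/2" by simp
  then have lb: "l \<in> cball 1 (1/2)" by (simp add: dist_norm norm_minus_commute)
  have "\<bar>Re (l - 1)\<bar> \<le> 1/2" using abs_Re_le_cmod[of "l - 1"] nl by linarith
  then have Rl: "Re l > 0" unfolding minus_complex.sel one_complex.sel by linarith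
  then have l0: "l \<noteq> 0" by auto
  have "energy z / (l * of_real x) = 1 + of_real D / (l * of_real x)"
  proof -
    have "energy z = l * of_real x + of_real D" using y by (simp add: algebra_simps)
    then show ?thesis using l0 x0 by (simp add: add_divide_distrib)
  qed
  moreover have "csqrt (l * of_real x) ^ Suc n * Phi n (- (l * of_real x)) = of_real (sqrt x ^ Suc n) * scaled_Phi n l x"
    unfolding csqrt_scale[OF x0 Rl] scaled_Phi_def power_mult_distrib by (simp add: mult_ac del: csqrt.simps power_Suc)
  ultimately have "second_sheet n z = Green (Suc n) z - jump_const n * ((1 + of_real D / (l * of_real x)) * (of_real (sqrt x ^ Suc n) * scaled_Phi n l x))"
    unfolding second_sheet_def D_def[symmetric] y by simp
  then show thesis using that[OF lb] unfolding x_def D_def by simp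
qed

lemma Green_bounded_near_0: "\<forall>\<^sub>F w in at_right 0. \<forall>z\<in>cball (of_real w) (w / 4). norm (Green (Suc n) z) \<le> 2"
proof -
  have G0: "Green (Suc n) 0 = 1" by (simp add: Green_def anglesP.prob_space)
  have "0 \<in> cut_plane (Suc n)" using crit_pos[of "Suc n"] by (simp add: cut_plane_def)
  then have "isCont (Green (Suc n)) 0"
    using holomorphic_on_imp_continuous_on[OF Green_holomorphic[of "Suc n"]] open_cut_plane[of "Suc n"]
    by (simp add: continuous_on_eq_continuous_at)
  then have "(Green (Suc n) \<longlongrightarrow> Green (Suc n) 0) (nhds 0)" by (simp add: isCont_def tendsto_at_iff_tendsto_nhds)
  then have "\<forall>\<^sub>F z in nhds 0. norm (Green (Suc n) z) < 2"
    using tendsto_norm[of "Green (Suc n)" "Green (Suc n) 0"] by (intro order_tendstoD(2)[of _ "norm (Green (Suc n) 0)"]) (auto simp: G0)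
  then obtain \<delta> where \<delta>: "\<delta> > 0" "\<And>z. dist z 0 < \<delta> \<Longrightarrow> norm (Green (Suc n) z) < 2"
    unfolding eventually_nhds_metric by blast
  have "\<forall>\<^sub>F w in at_right (0::real). 0 < w \<and> w < \<delta> / 2"
    using eventually_at_right_field[of "\<lambda>w. 0 < w \<and> w < \<delta> / 2" 0] \<delta>(1) by (auto intro: exI[of _ "\<delta> / 2"])
  then show ?thesis
  proof eventually_elim
    case (elim w)
    show ?case
    proof
      fix z assume "z \<in> cball (complex_of_real w) (w / 4)"
      then have "norm (z - of_real w) \<le> w / 4" by (simp add: dist_norm norm_minus_commute)
      then have "norm z \<le> w / 4 + w" using norm_triangle_ineq2[of z "of_real w"] elim by simp
      then show "norm (Green (Suc n) z) \<le> 2" using \<delta>(2)[of z] elim by simp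
    qed
  qed
qed

text \<open>
  The density term \<open>- jump_const n * kappa n (depth n w)\<close> dominates the bounded \<open>Green\<close>, and by
  \<open>scaled_Phi_bounded_asymp\<close> it hardly varies over the disc.
\<close>

lemma second_sheet_asymp:
  assumes n: "n \<ge> 1" and e: "e > 0"
  shows "\<forall>\<^sub>F w in at_right 0. \<forall>z\<in>cball (of_real w) (w / 4). z \<in> slit_domain (Suc n) \<and>
    norm (second_sheet n z / (- jump_const n * of_real (kappa n (depth n w))) - 1) \<le> e"
proof -
  define \<eta> where "\<eta> = min 1 (e / 4)"
  have \<eta>: "0 < \<eta>" "\<eta> \<le> 1" "4 * \<eta> \<le> e" using e by (auto simp: \<eta>_def)
  define J where "J = norm (jump_const n)"
  have J: "J > 0" using jump_const_nonzero by (simp add: J_def)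
  define D where "D = real (Suc n)"
  have D: "D \<ge> 1" by (simp add: D_def)
  have P: "\<forall>\<^sub>F x in at_top. \<forall>l\<in>cball 1 (1/2). norm (scaled_Phi n l x - of_real (phi n (- x))) \<le> \<eta> * phi n (- x)"
    using scaled_Phi_bounded_asymp[of n] \<eta>(1) by blast
  have K: "\<forall>\<^sub>F x in at_top. 2 / (J * \<eta>) \<le> kappa n x"
    using kappa_at_top[OF n] by (simp add: filterlim_at_top)
  have X: "\<forall>\<^sub>F x in at_top. max (2 * D) (2 * D / \<eta>) \<le> x" by (rule eventually_ge_at_top)
  have "\<forall>\<^sub>F x in at_top. (\<forall>l\<in>cball 1 (1/2). norm (scaled_Phi n l x - of_real (phi n (- x))) \<le> \<eta> * phi n (- x)) \<and> 2 / (J * \<eta>) \<le> kappa n x \<and> max (2 * D) (2 * D / \<eta>) \<le> x"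
    using P K X by eventually_elim simp
  then have ev: "\<forall>\<^sub>F w in at_right 0. (\<forall>l\<in>cball 1 (1/2). norm (scaled_Phi n l (depth n w) - of_real (phi n (- depth n w))) \<le> \<eta> * phi n (- depth n w)) \<and> 2 / (J * \<eta>) \<le> kappa n (depth n w) \<and> max (2 * D) (2 * D / \<eta>) \<le> depth n w"
    using depth_at_top[of n] by (rule eventually_compose_filterlim)
  have cr: "crit (Suc n) > 0" by (rule crit_pos) simp
  have small: "\<forall>\<^sub>F w in at_right (0::real). 0 < w \<and> w < crit (Suc n) / 2"
    using eventually_at_right_field[of "\<lambda>w. 0 < w \<and> w < crit (Suc n) / 2" 0] cr by (auto intro: exI[of _ "crit (Suc n) / 2"])
  show ?thesis using ev small Green_bounded_near_0[of n]
  proof eventually_elim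
    case (elim w)
    define x where "x = depth n w"
    have x: "x \<ge> 2 * D" "x \<ge> 2 * D / \<eta>" "x > 0" using elim D by (auto simp: x_def)
    have ph: "phi n (- x) > 0" using x by (intro phi_pos) auto
    have sx: "sqrt x ^ Suc n > 0" using x by simp
    have kx: "kappa n x > 0" unfolding kappa_def using ph sx by (rule mult_pos_pos[rotated])
    show ?case
    proof
      fix z assume z: "z \<in> cball (complex_of_real w) (w / 4)"
      have nz: "norm (z - of_real w) \<le> w / 4" using z by (simp add: dist_norm norm_minus_commute)
      have "\<bar>Re (z - of_real w)\<bar> \<le> w / 4" using abs_Re_le_cmod[of "z - of_real w"] nz by linarith
      then have "Re z > 0" using elim(2) unfolding minus_complex.sel Re_complex_of_real by linarith
      then have zn: "z \<notin> \<real>\<^sub>\<le>\<^sub>0" by (auto simp: complex_nonpos_Reals_iff)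
      have "norm z \<le> w / 4 + w" using norm_triangle_ineq2[of z "of_real w"] elim nz by simp
      then have "norm z < crit (Suc n)" using elim by simp
      then have zs: "z \<in> slit_domain (Suc n)" using zn ball_subset_cut_plane[of "Suc n"] by (auto simp: slit_domain_def)
      have dw: "depth n w \<ge> 2 * real (Suc n)" using x by (simp add: x_def D_def)
      obtain l where l: "l \<in> cball 1 (1/2)" and ss: "second_sheet n z = Green (Suc n) z - jump_const n * ((1 + of_real D / (l * of_real x)) *
        (of_real (sqrt x ^ Suc n) * scaled_Phi n l x))"
        using second_sheet_rescaled[OF conjunct1[OF elim(2)] dw z] unfolding D_def x_def by blast
      have ln: "norm l \<ge> 1/2" using l norm_triangle_ineq2[of 1 "1 - l"] by (simp add: dist_norm)
      then have l0: "l \<noteq> 0" by auto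
      define Rr where "Rr = of_real D / (l * complex_of_real x)"
      define Q where "Q = scaled_Phi n l x / of_real (phi n (- x)) - 1"
      define G where "G = Green (Suc n) z / (- jump_const n * of_real (kappa n x))"
      have R: "norm Rr \<le> \<eta>"
      proof -
        have "norm Rr = D / (norm l * x)" using D x by (simp add: Rr_def norm_divide norm_mult)
        also have "\<dots> \<le> D / (1/2 * x)" using D x ln by (intro divide_left_mono mult_right_mono mult_pos_pos) auto
        also have "\<dots> \<le> \<eta>" using x \<eta> D by (simp add: field_simps)
        finally show ?thesis .
      qed
      have Q: "norm Q \<le> \<eta>"
      proof -
        have "Q = (scaled_Phi n l x - of_real (phi n (- x))) / of_real (phi n (- x))" using ph by (simp add: Q_def diff_divide_distrib)
        then have "norm Q = norm (scaled_Phi n l x - of_real (phi n (- x))) / phi n (- x)" using ph by (simp add: norm_divide)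
        also have "\<dots> \<le> \<eta>" using elim(1) l ph by (simp add: x_def pos_divide_le_eq)
        finally show ?thesis .
      qed
      have G: "norm G \<le> \<eta>"
      proof -
        have "norm G = norm (Green (Suc n) z) / (J * kappa n x)" using kx by (simp add: G_def norm_divide norm_mult J_def)
        also have "\<dots> \<le> 2 / (J * (2 / (J * \<eta>)))"
          using elim z J kx \<eta> by (intro frac_le mult_left_mono mult_pos_pos divide_pos_pos) (auto simp: x_def)
        also have "\<dots> = \<eta>" using J \<eta> by simp
        finally show ?thesis .
      qed
      have "second_sheet n z / (- jump_const n * of_real (kappa n x)) = G + (1 + Rr) * (1 + Q)"
      proof -
        have k: "of_real (sqrt x ^ Suc n) * scaled_Phi n l x = of_real (kappa n x) * (1 + Q)"
          using ph by (simp add: kappa_def Q_def)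
        show ?thesis unfolding ss k Rr_def[symmetric] G_def using kx jump_const_nonzero[of n]
          by (simp add: field_simps)
      qed
      then have "norm (second_sheet n z / (- jump_const n * of_real (kappa n x)) - 1) = norm (G + (Rr + Q + Rr * Q))"
        by (simp add: algebra_simps)
      also have "\<dots> \<le> norm G + (norm Rr + norm Q + norm Rr * norm Q)"
        by (intro order_trans[OF norm_triangle_ineq] add_mono order_refl) (auto simp: norm_mult intro: order_trans[OF norm_triangle_ineq] norm_triangle_ineq)
      also have "\<dots> \<le> \<eta> + (\<eta> + \<eta> + 1 * \<eta>)" using R Q G \<eta> by (intro add_mono mult_mono) auto
      also have "\<dots> \<le> e" using \<eta> by simp
      finally show "z \<in> slit_domain (Suc n) \<and> norm (second_sheet n z / (- jump_const n * of_real (kappa n (depth n w))) - 1) \<le> e"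
        using zs by (simp add: x_def)
    qed
  qed
qed

text \<open>
  \<open>1 / second_sheet\<close> is slowly varying and tends to \<open>0\<close>, so \<open>no_linear_ode\<close> applies to it.
\<close>

lemma not_holonomic_B:
  assumes d: "d \<ge> 2" shows "\<not> holonomic (B_series d)"
proof
  assume "holonomic (B_series d)"
  then obtain r P where P: "\<exists>i\<le>r. P i \<noteq> 0" "(\<Sum>i\<le>r. fps_of_poly (P i) * (fps_deriv ^^ i) (B_series d)) = 0"
    by (rule holonomic_polynomial_ode)
  obtain n where n: "d = Suc n" "n \<ge> 1" using d by (cases d) auto
  define s where "s = second_sheet n"
  define N where "N = (\<lambda>w. - jump_const n * complex_of_real (kappa n (depth n w)))"
  define \<Omega> where "\<Omega> = {z\<in>slit_domain d. s z \<noteq> 0}"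
  have sh: "s holomorphic_on slit_domain d" unfolding s_def n by (rule second_sheet_holomorphic)
  have asym: "\<forall>\<^sub>F w in at_right 0. \<forall>z\<in>cball (of_real w) (w / 4). z \<in> slit_domain d \<and> norm (s z / N w - 1) \<le> e" if "e > 0" for e
    using second_sheet_asymp[OF n(2) that] by (simp add: n s_def N_def)
  have half: "\<forall>\<^sub>F w in at_right 0. \<forall>z\<in>cball (of_real w) (w / 4). z \<in> \<Omega>"
    using asym[of "1/2"]
  proof (rule eventually_mono)
    fix w assume a: "\<forall>z\<in>cball (of_real w) (w / 4). z \<in> slit_domain d \<and> norm (s z / N w - 1) \<le> 1/2"
    show "\<forall>z\<in>cball (of_real w) (w / 4). z \<in> \<Omega>"
    proof
      fix z assume z: "z \<in> cball (complex_of_real w) (w / 4)"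
      then have "z \<in> slit_domain d" "norm (s z / N w - 1) \<le> 1/2" using a by blast+
      then show "z \<in> \<Omega>" by (auto simp: \<Omega>_def)
    qed
  qed simp
  then obtain w0 where small: "w0 > 0" "\<And>w. 0 < w \<Longrightarrow> w < w0 \<Longrightarrow> cball (of_real w) (w / 4) \<subseteq> \<Omega>"
    unfolding eventually_at_right_field by auto
  have pos: "\<forall>\<^sub>F w in at_right (0::real). 0 < w \<and> w < 1"
    using eventually_at_right_field[of "\<lambda>w. 0 < w \<and> w < 1" 0] by (auto intro: exI[of _ 1])
  interpret slowly_varying "\<lambda>z. 1 / s z" \<Omega> w0
  proof
    show "open \<Omega>" unfolding \<Omega>_def using sh open_slit_domain by (rule open_nonzero)
    show "(\<lambda>z. 1 / s z) holomorphic_on \<Omega>"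
      by (intro holomorphic_intros holomorphic_on_subset[OF sh]) (auto simp: \<Omega>_def)
    show "w0 > 0" by (rule small)
    show "cball (of_real w) (w / 4) \<subseteq> \<Omega>" if "0 < w" "w < w0" for w using that by (rule small)
    show "\<forall>\<^sub>F w in at_right 0. 1 / s (of_real w) \<noteq> 0"
      using half pos by eventually_elim (auto simp: \<Omega>_def)
    fix e :: real assume e: "e > 0"
    define \<eta> where "\<eta> = min (1/2) (e / 4)"
    have \<eta>: "0 < \<eta>" "\<eta> \<le> 1/2" "4 * \<eta> \<le> e" using e by (auto simp: \<eta>_def)
    show "\<forall>\<^sub>F w in at_right 0. \<forall>z\<in>cball (of_real w) (w / 4). norm (1 / s z - 1 / s (of_real w)) \<le> e * norm (1 / s (of_real w))"
      using asym[OF \<eta>(1)] half pos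
    proof eventually_elim
      case (elim w)
      show ?case
      proof
        fix z assume z: "z \<in> cball (complex_of_real w) (w / 4)"
        define a where "a = s z / N w"
        define b where "b = s (of_real w) / N w"
        have wc: "complex_of_real w \<in> cball (of_real w) (w / 4)" using elim by simp
        have a: "norm (a - 1) \<le> \<eta>" using elim(1) z by (auto simp: a_def)
        have b: "norm (b - 1) \<le> \<eta>" using elim(1) wc by (auto simp: b_def)
        have sz: "s z \<noteq> 0" "s (of_real w) \<noteq> 0" using elim(2) z wc by (auto simp: \<Omega>_def)
        have N0: "N w \<noteq> 0" using a \<eta> by (auto simp: a_def)
        have na: "norm a \<ge> 1/2" using a \<eta> norm_triangle_ineq2[of 1 "1 - a"] by (simp add: norm_minus_commute)
        have "norm (b - a) \<le> norm (b - 1) + norm (a - 1)" using norm_triangle_ineq4[of "b - 1" "a - 1"] by simp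
        then have ab: "norm (b - a) \<le> 2 * \<eta>" using a b by linarith
        have "1 / s z - 1 / s (of_real w) = (b - a) / a * (1 / s (of_real w))"
          using sz N0 by (simp add: a_def b_def field_simps)
        then have "norm (1 / s z - 1 / s (of_real w)) = norm (b - a) / norm a * norm (1 / s (of_real w))"
          by (simp add: norm_mult norm_divide)
        also have "\<dots> \<le> (2 * \<eta>) / (1/2) * norm (1 / s (of_real w))"
          using ab na \<eta> by (intro mult_right_mono frac_le) auto
        also have "\<dots> \<le> e * norm (1 / s (of_real w))" using \<eta> by (intro mult_right_mono) auto
        finally show "norm (1 / s z - 1 / s (of_real w)) \<le> e * norm (1 / s (of_real w))" .
      qed
    qed
  next
    show "((\<lambda>w. 1 / s (of_real w)) \<longlongrightarrow> 0) (at_right 0)"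
    proof (rule Lim_null_comparison)
      define J where "J = norm (jump_const n)"
      have J: "J > 0" using jump_const_nonzero by (simp add: J_def)
      have kt: "filterlim (\<lambda>w. kappa n (depth n w)) at_top (at_right 0)"
        using kappa_at_top[OF n(2)] depth_at_top by (rule filterlim_compose)
      then have kp: "\<forall>\<^sub>F w in at_right 0. 0 < kappa n (depth n w)"
        by (simp add: filterlim_at_top_dense)
      have "\<forall>\<^sub>F w in at_right 0. \<forall>z\<in>cball (of_real w) (w / 4). z \<in> slit_domain d \<and> norm (s z / N w - 1) \<le> 1/2"
        by (rule asym) simp
      with kp pos show "\<forall>\<^sub>F w in at_right 0. norm (1 / s (of_real w)) \<le> 2 / J * inverse (kappa n (depth n w))"
      proof eventually_elim
        case (elim w)
        define b where "b = s (of_real w) / N w"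
        have "norm (b - 1) \<le> 1/2" using elim by (auto simp: b_def)
        then have nb: "norm b \<ge> 1/2" using norm_triangle_ineq2[of 1 "1 - b"] by (simp add: norm_minus_commute)
        have nN: "norm (N w) = J * kappa n (depth n w)" using elim by (simp add: N_def J_def norm_mult)
        then have N0: "norm (N w) > 0" using J elim by simp
        have "norm (s (of_real w)) = norm b * norm (N w)" using N0 by (simp add: b_def norm_divide)
        also have "\<dots> \<ge> 1/2 * norm (N w)" using nb by (intro mult_right_mono) auto
        finally have "norm (1 / s (of_real w)) \<le> 1 / (1/2 * norm (N w))"
          unfolding norm_divide using N0 by (intro frac_le) auto
        then show ?case unfolding nN by (simp add: field_simps)
      qed
      show "((\<lambda>w. 2 / J * inverse (kappa n (depth n w))) \<longlongrightarrow> 0) (at_right 0)"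
        by (intro tendsto_mult_right_zero tendsto_inverse_0_at_top kt)
    qed
  qed
  have "\<forall>i\<le>r. P i = 0"
  proof (rule no_linear_ode)
    fix w :: real assume w: "0 < w" "w < w0"
    then have "complex_of_real w \<in> \<Omega>" using small(2)[OF w] by auto
    then have "ode r P (\<lambda>w. 1 - 1 / second_sheet n w) (of_real w) = 0"
      by (intro second_sheet_ode[OF n(1) P(2)]) (auto simp: \<Omega>_def s_def)
    then show "(\<Sum>i\<le>r. poly (P i) (of_real w) * (deriv ^^ i) (\<lambda>z. 1 - 1 / s z) (of_real w)) = 0"
      by (simp add: ode_def s_def)
  qed
  then show False using P(1) by blast
qed

theorem theorem6:
  shows
    "(\<forall>d\<ge>1. (1 - B_series d) * A_series d = 1) \<and>
     (\<forall>d\<ge>1. fps_conv_radius (B_series d) = ereal (1 / (2 * real d)\<^sup>2) \<and>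
        uniformly_convergent_on (sphere 0 (1 / (2 * real d)\<^sup>2))
          (\<lambda>N w. \<Sum>n<N. fps_nth (B_series d) n * w ^ n)) \<and>
     (\<forall>d\<ge>2. \<not> holonomic (B_series d)) \<and>
     (\<forall>d\<ge>1. Delta_analytic (B_series d)) \<and>
     (\<forall>w. norm w \<le> 1 / 4 \<longrightarrow> eval_fps (B_series 1) w = 1 - csqrt (1 - 4 * w)) \<and>
     eval_fps (B_series 1) (1 / 4) = 1 \<and>
     eval_fps (B_series 2) (1 / 16) = 1 \<and>
     (\<forall>d\<ge>3. summable (m_term d) \<and>
        eval_fps (B_series d) (1 / (2 * of_nat d)\<^sup>2) = of_real (1 - 1 / m_const d) \<and>
        1 - 1 / m_const d = return_prob d)"
proof (intro conjI allI impI)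
  fix d :: nat assume "d \<ge> 1"
  show "(1 - B_series d) * A_series d = 1" by (rule renewal_equation)
next
  fix d :: nat assume d: "d \<ge> 1"
  show "fps_conv_radius (B_series d) = ereal (1 / (2 * real d)\<^sup>2)"
    using radius_B[OF d] by (simp only: crit_def)
  show "uniformly_convergent_on (sphere 0 (1 / (2 * real d)\<^sup>2)) (\<lambda>N w. \<Sum>n<N. fps_nth (B_series d) n * w ^ n)"
    using B_uniformly_convergent[OF d] by (simp only: crit_def)
next
  fix d :: nat assume "d \<ge> 2"
  then show "\<not> holonomic (B_series d)" by (rule not_holonomic_B)
next
  fix d :: nat assume d: "d \<ge> 1"
  show "Delta_analytic (B_series d)" by (rule Delta_analytic_B[OF d radius_B[OF d]])
next
  fix w :: complex assume "norm w \<le> 1 / 4"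
  then show "eval_fps (B_series 1) w = 1 - csqrt (1 - 4 * w)" by (rule eval_B_1)
next
  show "eval_fps (B_series 1) (1 / 4) = 1" using eval_B_1[of "1 / 4"] by simp
next
  show "eval_fps (B_series 2) (1 / 16) = 1"
    using eval_B_crit[of 2] recurrent_if_not_summable[OF _ not_summable_m_term_2] by (simp add: crit_def)
next
  fix d :: nat assume d: "d \<ge> 3"
  show "summable (m_term d)" using d by (rule summable_m_term)
  show r: "1 - 1 / m_const d = return_prob d"
    using d summable_m_term[OF d] by (intro return_prob_transient) auto
  have "1 / (2 * of_nat d)\<^sup>2 = complex_of_real (crit d)" by (simp add: crit_def)
  then show "eval_fps (B_series d) (1 / (2 * of_nat d)\<^sup>2) = of_real (1 - 1 / m_const d)"
    unfolding r using d by (simp only: eval_B_crit)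
qed

end
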